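(* Let $\Bbbk$ be a field of characteristic $0$, $A=\Bbbk[x_1,\dots,x_d]=\Bbbk\langle x_1,\dots,x_d\rangle/\langle x_jx_i-x_ix_j\rangle_{1\le i<j\le d}$, and let $R=\{(x_jx_i,x_ix_j)\}_{1\le i<j\le d}$, $S=\{x_jx_i\}_{1\le i<j\le d}$. Let $(B,\mathfrak m)$ be a complete local Noetherian $\Bbbk$-algebra. Given any degree zero element $\widetilde\varphi\in\mathbf p(Q,R)\widehat\otimes\mathfrak m$, i.e. any $\widetilde\varphi\in\mathrm{Hom}_{\Bbbk}(\Bbbk S,A)\widehat\otimes\mathfrak m$, the associated combinatorial star product $\star$ can be given as $$f\star g=\sum_{k\ge0}\ \sum_{\Pi\in\mathfrak G^{\mathrm C}_{k,2}}C_\Pi(f,g)\qquad (f,g\in A),$$ where $\mathfrak G^{\mathrm C}_{k,2}$ is a set of graphs in bijection to the set of Kontsevich graphs (with $k$ vertices of first type and $2$ vertices of second type) without oriented cycles and with an ordering of the incoming edges at each vertex, and each $C_\Pi$ is a bidifferential operator associated to the graph $\Pi$.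
   Context: $Q$ is the quiver with one vertex and $d$ loops $x_1,\dots,x_d$, so $\Bbbk Q=\Bbbk\langle x_1,\dots,x_d\rangle$; $\mathrm{Irr}_S$ is the set of ordered monomials $x_{i_1}\cdots x_{i_p}$, $i_1\le\dots\le i_p$; $\pi:\Bbbk Q\to A$ is the projection and $\sigma:A\to\Bbbk\mathrm{Irr}_S$ the inverse of $\pi|_{\Bbbk\mathrm{Irr}_S}$. $\mathbf p(Q,R)$ is an L$_\infty[1]$ algebra whose degree $0$ part is $\mathrm{Hom}_{\Bbbk}(\Bbbk S,A)$ (only this is needed here). $\widehat\otimes$ is the $\mathfrak m$-adically completed tensor product, $\varphi_{x_jx_i}=x_ix_j$, $\widetilde\varphi_{s}=\sigma\widetilde\varphi(s)$. Combinatorial star product: let $z$ be a formal central variable. Let $\mathrm{red}_{\varphi+z\widetilde\varphi}$ be the linear map fixing irreducible words and sending a reducible word $p=qsr$, $s$ the rightmost subword of $p$ in $S$, to $q\varphi_sr+z\,q\widetilde\varphi_sr$. Modulo each $z^{n+1}$ its iterates on a given word stabilize, which in the limit gives $\mathrm{red}^{(\infty)}_{\varphi+z\widetilde\varphi}$ with values in $(\Bbbk\mathrm{Irr}_S\widehat\otimes B)[[z]]$. Then $f\star g=\pi\big(\mathrm{red}^{(\infty)}_{\varphi+z\widetilde\varphi}(\sigma(f)\sigma(g))|_{z=1}\big)$, and $f\star^kg$ denotes the part with $z^k$, i.e. obtained by performing rightmost reductions using $\widetilde\varphi$ exactly $k$ times; $f\star g=\sum_{k\ge0}f\star^kg$,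 $f\star^0g=fg$. Graphs: by linearity assume $f,g$ and the values of $\widetilde\varphi$ are (multiples of) monomials. Represent $f$ and $g$ by two horizontal line segments whose points are the linear factors in increasing order. Each use of $\widetilde\varphi$ in the reduction process, replacing an adjacent pair $x_bx_a$ ($b>a$) by the ordered monomial in $\widetilde\varphi_{x_bx_a}$, adds a new line segment representing this monomial, together with two arrows (legs) from the new segment: the left one to the factor $x_b$ and the right one to the factor $x_a$, on the segments from which these factors originate. Remembering only the segments, the arrows and the left-to-right order of arrows arriving at each segment, one obtains a graph $\Pi$ with $2+k$ segments and $2k$ arrows for each term of $f\star^kg$. $\mathfrak G^{\mathrm C}_{k,2}$ is the set of graphs so appearing for $\star^k$, and $C_\Pi(f,g)$ is the sum of the terms in $f\star^kg$ whose graph is $\Pi$; "bidifferential operator" means a formal ($\mathfrak m$-adically convergent) series of bidifferential operators, starting in order $\mathfrak m^k$, with coefficients in $A\widehat\otimes\mathfrak m^k$. Kontsevich graphs $\mathfrak G_{k,2}$ (considered up to isomorphism fixing the two vertices of second type, without labelling of the first-type vertices or of the edges): directed graphs with $k$ vertices of first type and $2$ of second type, with $2k$ arrows, such that each vertex of first type has exactly two outgoing arrows, without parallel arrows and without loops. "With an ordering" means a pair $(\Lambda,\{<_v\})$ where $\Lambda$ is such a graph and $<_v$ is a total order on the set of incoming edges at each vertex $v$. The bijection contracts each line segment of $\Pi$ to a vertex and lets $<_v$ be the left-to-right order of the arrows arriving along the segment.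
   Formalization: The set of graphs consists of all formal segment graphs, ignoring inequalities between variable indices, not only those appearing in the star product; with only the latter the bijection fails (d=1, k=1; for every d at k=3). Graphs that do not appear have zero operator. *)

theory Defs
  imports
    "HOL-Library.Multiset"
    "HOL-Library.Poly_Mapping"
    "HOL-Combinatorics.Permutations"
    "HOL-Computational_Algebra.Formal_Power_Series"
begin

section \<open>Complete local Noetherian algebras and completed tensor products\<close>

abbreviation is_ideal :: "'b::comm_ring_1 set \<Rightarrow> bool" where
  "is_ideal \<equiv> module.subspace (*)"

abbreviation ideal_gen :: "'b::comm_ring_1 set \<Rightarrow> 'b set" where
  "ideal_gen \<equiv> module.span (*)"

definition is_maximal_ideal :: "'b::comm_ring_1 set \<Rightarrow> bool" where
  "is_maximal_ideal I \<longleftrightarrow>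
     is_ideal I \<and> I \<noteq> UNIV \<and> (\<forall>J. is_ideal J \<and> I \<subseteq> J \<and> J \<noteq> UNIV \<longrightarrow> J = I)"

fun ideal_pow :: "'b::comm_ring_1 set \<Rightarrow> nat \<Rightarrow> 'b set" where
  "ideal_pow m 0 = UNIV"
| "ideal_pow m (Suc n) = ideal_gen {a * b | a b. a \<in> m \<and> b \<in> ideal_pow m n}"

text \<open>
  The last two conjuncts say that the canonical map from the ring to the inverse limit of its
  quotients by the powers of \<open>m\<close> is injective and surjective.
\<close>

definition complete_local_noetherian :: "'b::comm_ring_1 set \<Rightarrow> bool" where
  "complete_local_noetherian m \<longleftrightarrow>
     (\<forall>I. is_maximal_ideal I \<longleftrightarrow> I = m) \<and>
     (\<forall>I::'b set. is_ideal I \<longrightarrow> (\<exists>S. finite S \<and> I = ideal_gen S)) \<and>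
     (\<Inter>n. ideal_pow m n) = {0} \<and>
     (\<forall>a. (\<forall>n. a (Suc n) - a n \<in> ideal_pow m n) \<longrightarrow> (\<exists>b. \<forall>n. b - a n \<in> ideal_pow m n))"

definition algebra_map :: "('k::field \<Rightarrow> 'b::comm_ring_1) \<Rightarrow> bool" where
  "algebra_map \<iota> \<longleftrightarrow> \<iota> 1 = 1 \<and> (\<forall>a b. \<iota> (a + b) = \<iota> a + \<iota> b) \<and> (\<forall>a b. \<iota> (a * b) = \<iota> a * \<iota> b)"

text \<open>
  Let \<open>V\<close> be a vector space with basis indexed by \<open>'i\<close>. The \<open>m\<close>-adic completion of
  \<open>V \<otimes> m^n\<close> consists of the families of coefficients in \<open>m^n\<close> which, modulo each power of \<open>m\<close>,
  have finite support. For \<open>n = 0\<close> this is the completed tensor product of \<open>V\<close> with the ring.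
\<close>

definition ctensor :: "'b::comm_ring_1 set \<Rightarrow> nat \<Rightarrow> ('i \<Rightarrow> 'b) set" where
  "ctensor m n = {F. (\<forall>i. F i \<in> ideal_pow m n) \<and> (\<forall>l. finite {i. F i \<notin> ideal_pow m l})}"

definition has_adic_sum :: "'b::comm_ring_1 set \<Rightarrow> (nat \<Rightarrow> 'i \<Rightarrow> 'b) \<Rightarrow> ('i \<Rightarrow> 'b) \<Rightarrow> bool" where
  "has_adic_sum m a s \<longleftrightarrow> s \<in> ctensor m 0 \<and>
     (\<forall>n. \<exists>N. \<forall>K\<ge>N. (\<lambda>i. (\<Sum>k<K. a k i) - s i) \<in> ctensor m n)"


section \<open>Polynomials and words\<close>

text \<open>
  The variables \<open>x\<^sub>1 < \<dots> < x\<^sub>d\<close> are the elements of a finite linearly ordered type \<open>'x\<close>. A monomial is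
  a multiset of variables, so that \<open>A\<close> is the monoid algebra of \<open>'x multiset\<close>; elements of the completed
  tensor product of \<open>A\<close> (of the free algebra) with the ring are families indexed by monomials (by words).
\<close>

type_synonym ('x, 'k) pol = "'x multiset \<Rightarrow>\<^sub>0 'k"

definition scalar_ext :: "('k \<Rightarrow> 'b) \<Rightarrow> ('x, 'k::zero) pol \<Rightarrow> 'x multiset \<Rightarrow> 'b" where
  "scalar_ext \<iota> f M = \<iota> (Poly_Mapping.lookup f M)"

definition ctimes :: "('x multiset \<Rightarrow> 'b::comm_ring_1) \<Rightarrow> ('x multiset \<Rightarrow> 'b) \<Rightarrow> 'x multiset \<Rightarrow> 'b" where
  "ctimes F G M = (\<Sum>(M1, M2) | M1 + M2 = M. F M1 * G M2)"

text \<open>The maps \<open>\<sigma>\<close> and \<open>\<pi>\<close>, extended to completed tensor products.\<close>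

definition section_map :: "('x::linorder multiset \<Rightarrow> 'b::zero) \<Rightarrow> 'x list \<Rightarrow> 'b" where
  "section_map F w = (if sorted w then F (mset w) else 0)"

definition projection :: "('x list \<Rightarrow> 'b::comm_monoid_add) \<Rightarrow> 'x multiset \<Rightarrow> 'b" where
  "projection F M = (\<Sum>w | mset w = M. F w)"

definition word_times :: "('x list \<Rightarrow> 'b::comm_ring_1) \<Rightarrow> ('x list \<Rightarrow> 'b) \<Rightarrow> 'x list \<Rightarrow> 'b" where
  "word_times F G w = (\<Sum>(u, v) | u @ v = w. F u * G v)"


section \<open>The combinatorial star product\<close>

text \<open>The positions of the subwords of a word which lie in \<open>S\<close>.\<close>

definition red_positions :: "'x::linorder list \<Rightarrow> nat set" where
  "red_positions p = {i. Suc i < length p \<and> p ! Suc i < p ! i}"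

text \<open>
  An element of \<open>Hom(kS, A)\<close>, with coefficients in the completion along \<open>m\<close>: the value on
  \<open>x\<^sub>b x\<^sub>a \<in> S\<close>, that is \<open>a < b\<close>, is \<open>phi b a\<close>. The other values of \<open>phi\<close> are irrelevant.
\<close>

definition cochain :: "'b::comm_ring_1 set \<Rightarrow> ('x::linorder \<Rightarrow> 'x \<Rightarrow> 'x multiset \<Rightarrow> 'b) \<Rightarrow> bool" where
  "cochain m phi \<longleftrightarrow> (\<forall>a b. a < b \<longrightarrow> phi b a \<in> ctensor m 1)"

text \<open>
  \<open>red_word phi p w\<close> is the coefficient, a power series in \<open>z\<close>, of the word \<open>w\<close> in the reduction of the
  word \<open>p\<close>. The inner sum has at most one term, the monomial \<open>M\<close> with \<open>w = q \<sigma>(M) r\<close>.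
\<close>

definition red_word ::
  "('x::linorder \<Rightarrow> 'x \<Rightarrow> 'x multiset \<Rightarrow> 'b::comm_ring_1) \<Rightarrow> 'x list \<Rightarrow> 'x list \<Rightarrow> 'b fps" where
  "red_word phi p w =
     (if red_positions p = {} then of_bool (w = p)
      else let i = Max (red_positions p); q = take i p; b = p ! i; a = p ! Suc i; r = drop (i + 2) p
        in of_bool (w = q @ [a, b] @ r) +
           fps_X * fps_const (\<Sum>M | w = q @ sorted_list_of_multiset M @ r. phi b a M))"

text \<open>
  The linear extension of \<open>red_word\<close>. The sum over all words \<open>p\<close> has only finitely many nonzero terms,
  since for given \<open>w\<close> only finitely many words can be reduced to \<open>w\<close> in one step.
\<close>

definition red ::
  "('x::linorder \<Rightarrow> 'x \<Rightarrow> 'x multiset \<Rightarrow> 'b::comm_ring_1) \<Rightarrow> ('x list \<Rightarrow> 'b fps) \<Rightarrow> 'x list \<Rightarrow> 'b fps" where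
  "red phi F w = (\<Sum>p. F p * red_word phi p w)"

text \<open>The limit is taken in the \<open>z\<close>-adic topology of the library on formal power series.\<close>

definition red_inf ::
  "('x::linorder \<Rightarrow> 'x \<Rightarrow> 'x multiset \<Rightarrow> 'b::comm_ring_1) \<Rightarrow> ('x list \<Rightarrow> 'b fps) \<Rightarrow> 'x list \<Rightarrow> 'b fps" where
  "red_inf phi F w = lim (\<lambda>N. (red phi ^^ N) F w)"

definition eval_at_one :: "'b::comm_ring_1 set \<Rightarrow> ('i \<Rightarrow> 'b fps) \<Rightarrow> 'i \<Rightarrow> 'b" where
  "eval_at_one m F = (THE G. has_adic_sum m (\<lambda>k i. fps_nth (F i) k) G)"

definition star ::
  "('k::field \<Rightarrow> 'b::comm_ring_1) \<Rightarrow> 'b set \<Rightarrow> ('x::linorder \<Rightarrow> 'x \<Rightarrow> 'x multiset \<Rightarrow> 'b) \<Rightarrow>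
   ('x, 'k) pol \<Rightarrow> ('x, 'k) pol \<Rightarrow> 'x multiset \<Rightarrow> 'b" where
  "star \<iota> m phi f g =
     projection (eval_at_one m (red_inf phi (\<lambda>w. fps_const
       (word_times (section_map (scalar_ext \<iota> f)) (section_map (scalar_ext \<iota> g)) w))))"


section \<open>Segments and arrows\<close>

text \<open>
  Segments are numbered: \<open>0\<close> and \<open>1\<close> are the segments of \<open>f\<close> and \<open>g\<close>, and the others represent the
  uses of \<open>phi\<close>. A graph is encoded as the list whose \<open>v\<close>-th entry is the list of the segments of
  origin of the arrows arriving at segment \<open>v\<close>, from left to right. The numbering of the segments
  other than \<open>0\<close> and \<open>1\<close> is immaterial, so the actual graphs are classes for \<open>diagram_iso\<close>.
\<close>

type_synonym diagram = "nat list list"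

definition relabel_diagram :: "(nat \<Rightarrow> nat) \<Rightarrow> diagram \<Rightarrow> diagram" where
  "relabel_diagram h D = map (\<lambda>v. map h (D ! inv h v)) [0..<length D]"

definition diagram_iso :: "nat \<Rightarrow> (diagram \<times> diagram) set" where
  "diagram_iso k = {(D, relabel_diagram h D) | D h. h permutes {2..<k + 2}}"

text \<open>
  The graphs obtained by \<open>k\<close> uses of \<open>phi\<close>. Each use adds a segment with two arrows to factors on
  two different existing segments (the factors on a single segment are in increasing order and
  never form a pair in \<open>S\<close>). The arrowheads may be anywhere relative to the arrows already
  arriving at these segments; comparisons of the indices of the variables are disregarded, so
  that the set of graphs depends neither on \<open>d\<close> nor on \<open>phi\<close>. Not all of these graphs can be
  realized by actual variables (some graphs with \<open>k = 3\<close> cannot); the operator associated to a graph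
  which is not realized is zero.
\<close>

inductive_set diagrams :: "diagram set" where
  initial: "[[], []] \<in> diagrams"
| add_segment: "\<lbrakk>D \<in> diagrams; v < length D; w < length D; v \<noteq> w; D ! v = xs @ ys; D ! w = us @ vs\<rbrakk>
    \<Longrightarrow> D[v := xs @ [length D] @ ys, w := us @ [length D] @ vs] @ [[]] \<in> diagrams"

definition GC :: "nat \<Rightarrow> diagram set set" where
  "GC k = {D \<in> diagrams. length D = k + 2} // diagram_iso k"


section \<open>The operators associated to the graphs\<close>

text \<open>
  In a tracked word each factor is a triple \<open>(x, v, i)\<close>: the variable \<open>x\<close>, which is the \<open>i\<close>-th
  factor on segment \<open>v\<close>. A picture lists, for each segment, its points, where a point is \<open>None\<close> or \<open>Some n\<close>
  according to whether no arrow or an arrow from segment \<open>n\<close> arrives at it.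
\<close>

type_synonym 'x tracked = "('x \<times> nat \<times> nat) list"
type_synonym picture = "nat option list list"

definition segment_factors :: "nat \<Rightarrow> 'x::linorder multiset \<Rightarrow> 'x tracked" where
  "segment_factors v M = map (\<lambda>i. (sorted_list_of_multiset M ! i, v, i)) [0..<size M]"

definition set_arrow :: "nat \<Rightarrow> nat \<times> nat \<Rightarrow> picture \<Rightarrow> picture" where
  "set_arrow n = (\<lambda>(v, i) P. P[v := (P ! v)[i := Some n]])"

definition diagram_of :: "picture \<Rightarrow> diagram" where
  "diagram_of P = map (List.map_filter (\<lambda>t. t)) P"

text \<open>
  The reduction of a single word, with the choices made at each rightmost reduction: \<open>None\<close> stands
  for exchanging the two variables, \<open>Some M\<close> for using the monomial \<open>M\<close> in the value of \<open>phi\<close> on them.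
  The result is \<open>None\<close> unless the list of choices leads exactly to an irreducible word.
  Otherwise it consists of this word, the picture, and the product of the coefficients used.
\<close>

fun run ::
  "('x::linorder \<Rightarrow> 'x \<Rightarrow> 'x multiset \<Rightarrow> 'b::comm_ring_1) \<Rightarrow> 'x multiset option list \<Rightarrow>
   'x tracked \<times> picture \<times> 'b \<Rightarrow> ('x tracked \<times> picture \<times> 'b) option" where
  "run phi [] (p, P, c) = (if red_positions (map fst p) = {} then Some (p, P, c) else None)"
| "run phi (t # ts) (p, P, c) =
     (if red_positions (map fst p) = {} then None
      else let i = Max (red_positions (map fst p)); q = take i p; r = drop (i + 2) p;
               (b, e) = p ! i; (a, e') = p ! Suc i; n = length P
        in run phi ts (case t of
             None \<Rightarrow> (q @ [(a, e'), (b, e)] @ r, P, c)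
           | Some M \<Rightarrow> (q @ segment_factors n M @ r,
               set_arrow n e (set_arrow n e' P) @ [replicate (size M) None],
               c * phi b a M)))"

definition run_monomials ::
  "('x::linorder \<Rightarrow> 'x \<Rightarrow> 'x multiset \<Rightarrow> 'b::comm_ring_1) \<Rightarrow> 'x multiset \<Rightarrow> 'x multiset \<Rightarrow>
   'x multiset option list \<Rightarrow> ('x tracked \<times> picture \<times> 'b) option" where
  "run_monomials phi \<alpha> \<beta> ts = run phi ts
     (segment_factors 0 \<alpha> @ segment_factors 1 \<beta>,
      [replicate (size \<alpha>) None, replicate (size \<beta>) None], 1)"

definition runs_with_graph ::
  "('x::linorder \<Rightarrow> 'x \<Rightarrow> 'x multiset \<Rightarrow> 'b::comm_ring_1) \<Rightarrow> diagram set \<Rightarrow> 'x multiset \<Rightarrow> 'x multiset \<Rightarrow>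
   'x multiset \<Rightarrow> ('x multiset option list \<times> 'b) set" where
  "runs_with_graph phi G \<alpha> \<beta> M = {(ts, c). \<exists>p P. run_monomials phi \<alpha> \<beta> ts = Some (p, P, c) \<and>
     diagram_of P \<in> G \<and> mset (map fst p) = M}"

text \<open>
  The sum of the terms of the star product with graph \<open>G\<close>. For fixed \<open>M\<close> there are only finitely many
  runs, as each use of \<open>phi\<close> lowers the degree by at most two.
\<close>

definition graph_op ::
  "('k::field \<Rightarrow> 'b::comm_ring_1) \<Rightarrow> ('x::linorder \<Rightarrow> 'x \<Rightarrow> 'x multiset \<Rightarrow> 'b) \<Rightarrow> diagram set \<Rightarrow>
   ('x, 'k) pol \<Rightarrow> ('x, 'k) pol \<Rightarrow> 'x multiset \<Rightarrow> 'b" where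
  "graph_op \<iota> phi G f g M =
     (\<Sum>\<alpha>\<in>Poly_Mapping.keys f. \<Sum>\<beta>\<in>Poly_Mapping.keys g. \<iota> (Poly_Mapping.lookup f \<alpha> * Poly_Mapping.lookup g \<beta>) * (\<Sum>(ts, c)\<in>runs_with_graph phi G \<alpha> \<beta> M. c))"

text \<open>The graphs of the terms in the reductions with \<open>k\<close> uses of \<open>phi\<close>, whether or not their
  coefficient vanishes.\<close>

definition occurring_graphs ::
  "('x::linorder \<Rightarrow> 'x \<Rightarrow> 'x multiset \<Rightarrow> 'b::comm_ring_1) \<Rightarrow> nat \<Rightarrow> diagram set set" where
  "occurring_graphs phi k = {diagram_iso k `` {diagram_of P} | P \<alpha> \<beta> ts p c.
     run_monomials phi \<alpha> \<beta> ts = Some (p, P, c) \<and> length (filter (\<lambda>t. t \<noteq> None) ts) = k}"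

definition partial_deriv :: "'x \<Rightarrow> ('x multiset \<Rightarrow> 'b::comm_ring_1) \<Rightarrow> 'x multiset \<Rightarrow> 'b" where
  "partial_deriv x F M = of_nat (Suc (count M x)) * F (add_mset x M)"

definition multi_deriv :: "'x::linorder multiset \<Rightarrow> ('x multiset \<Rightarrow> 'b::comm_ring_1) \<Rightarrow> 'x multiset \<Rightarrow> 'b" where
  "multi_deriv \<alpha> = fold partial_deriv (sorted_list_of_multiset \<alpha>)"

text \<open>
  Formal \<open>m\<close>-adically convergent series of bidifferential operators, starting in order \<open>m^k\<close>. For given
  \<open>f\<close> and \<open>g\<close> only finitely many terms are nonzero.
\<close>

definition bidifferential ::
  "('k::field \<Rightarrow> 'b::comm_ring_1) \<Rightarrow> 'b set \<Rightarrow> nat \<Rightarrow>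
   (('x::linorder, 'k) pol \<Rightarrow> ('x, 'k) pol \<Rightarrow> 'x multiset \<Rightarrow> 'b) \<Rightarrow> bool" where
  "bidifferential \<iota> m k C \<longleftrightarrow> (\<exists>c.
     (\<forall>\<alpha> \<beta>. c \<alpha> \<beta> \<in> ctensor m k) \<and>
     (\<forall>n. finite {(\<alpha>, \<beta>). c \<alpha> \<beta> \<notin> ctensor m n}) \<and>
     (\<forall>f g M. C f g M = (\<Sum>(\<alpha>, \<beta>).
        ctimes (c \<alpha> \<beta>) (ctimes (multi_deriv \<alpha> (scalar_ext \<iota> f)) (multi_deriv \<beta> (scalar_ext \<iota> g))) M)))"


section \<open>Kontsevich graphs without oriented cycles and with an ordering\<close>

text \<open>
  The vertices of second type are \<open>0\<close> and \<open>1\<close>, those of first type are \<open>2, \<dots>, k + 1\<close>. As there are no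
  parallel arrows, the arrows form a relation on the vertices.
\<close>

definition kontsevich_graph :: "nat \<Rightarrow> (nat \<times> nat) set \<Rightarrow> bool" where
  "kontsevich_graph k E \<longleftrightarrow> E \<subseteq> {0..<k + 2} \<times> {0..<k + 2} \<and> card E = 2 * k \<and>
     (\<forall>v\<in>{2..<k + 2}. card {e \<in> E. fst e = v} = 2) \<and> irrefl E"

type_synonym ordered_graph = "(nat \<times> nat) set \<times> (nat \<Rightarrow> ((nat \<times> nat) \<times> (nat \<times> nat)) set)"

definition incoming :: "(nat \<times> nat) set \<Rightarrow> nat \<Rightarrow> (nat \<times> nat) set" where
  "incoming E v = {e \<in> E. snd e = v}"

definition acyclic_ordered_graphs :: "nat \<Rightarrow> ordered_graph set" where
  "acyclic_ordered_graphs k = {(E, ord). kontsevich_graph k E \<and> acyclic E \<and>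
     (\<forall>v. ord v \<subseteq> incoming E v \<times> incoming E v \<and> strict_linear_order_on (incoming E v) (ord v))}"

definition relabel_graph :: "(nat \<Rightarrow> nat) \<Rightarrow> ordered_graph \<Rightarrow> ordered_graph" where
  "relabel_graph h = (\<lambda>(E, ord). (map_prod h h ` E,
     \<lambda>v. map_prod (map_prod h h) (map_prod h h) ` ord (inv h v)))"

definition graph_iso :: "nat \<Rightarrow> (ordered_graph \<times> ordered_graph) set" where
  "graph_iso k = {(X, relabel_graph h X) | X h. h permutes {2..<k + 2}}"

definition kontsevich_classes :: "nat \<Rightarrow> ordered_graph set set" where
  "kontsevich_classes k = acyclic_ordered_graphs k // graph_iso k"

text \<open>Contraction of each segment to a vertex.\<close>

definition contract :: "diagram \<Rightarrow> ordered_graph" where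
  "contract D = ({(u, v). v < length D \<and> u \<in> set (D ! v)},
     \<lambda>v. {((D ! v ! i, v), (D ! v ! j, v)) | i j. v < length D \<and> i < j \<and> j < length (D ! v)})"

end

theory Submission
  imports Defs
begin

text \<open>
  A word is reduced by replacing its rightmost descent \<open>x\<^sub>b x\<^sub>a\<close> either by \<open>x\<^sub>a x\<^sub>b\<close> or by a monomial of
  \<open>phi b a\<close>. An exchange removes an inversion and a use of \<open>phi\<close> is counted by a power of \<open>z\<close>, so the
  coefficient of \<open>z^k\<close> in the limit is a finite sum over the reductions with exactly \<open>k\<close> uses of \<open>phi\<close>
  (\<open>red_matrix_coefficient\<close>). It lies in \<open>m^k\<close>, hence the sum over \<open>k\<close> converges and is the star
  product (\<open>star_has_adic_sum\<close>). Sorting the reductions by their graphs gives the expansion into the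
  operators of the graphs.

  The factors remaining on one segment are always in increasing order, so that the two factors of a
  descent lie on different segments. This is why every reduction gives a graph built by adding
  segments with two arrows to two different segments (\<open>run_wf\<close>). The lists built in this way are those
  in which the arrows descend and each new segment has two arrows to different segments. Up to
  renumbering, they are the acyclic graphs with an order of the incoming edges, because a finite
  acyclic graph has a topological numbering (\<open>contract_bij\<close>).

  The operators are bidifferential because a factor of \<open>f\<close> or \<open>g\<close> which no arrow reaches can be deleted
  from the word without affecting the reduction of the other factors (\<open>run_sum_delete\<close>). So the
  terms for \<open>x^\<alpha>\<close> and \<open>x^\<beta>\<close> with a given graph are a sum over the positions of the hit factors, and
  the summand depends only on the monomials \<open>x^\<gamma>\<close> and \<open>x^\<delta>\<close> of these factors, apart from the deleted
  factors \<open>x^(\<alpha> - \<gamma>)\<close> and \<open>x^(\<beta> - \<delta>)\<close>, which reappear unchanged. The number of positions is the product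
  of the binomial coefficients of \<open>\<alpha>\<close> over \<open>\<gamma>\<close>, and this number times \<open>x^(\<alpha> - \<gamma>)\<close> is the derivative
  \<open>\<partial>^\<gamma> x^\<alpha>\<close> divided by \<open>\<gamma>!\<close>; likewise for \<open>\<beta>\<close> and \<open>\<delta>\<close>. A graph with \<open>k\<close> new segments has at most \<open>k\<close>
  arrows at each of the two old ones, so only finitely many \<open>\<gamma>\<close> and \<open>\<delta>\<close> occur
  (\<open>graph_op_bidifferential\<close>).
\<close>


section \<open>Convergence along the powers of the maximal ideal\<close>

lemma ring_module: "module ((*) :: 'b::comm_ring_1 \<Rightarrow> 'b \<Rightarrow> 'b)"
  by unfold_locales (simp_all add: algebra_simps)

lemma maximal_is_ideal: "complete_local_noetherian m \<Longrightarrow> is_ideal m"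
  unfolding complete_local_noetherian_def is_maximal_ideal_def by blast

lemma is_ideal_pow: "is_ideal (ideal_pow m n)"
  by (cases n) (simp_all add: module.subspace_UNIV[OF ring_module] module.subspace_span[OF ring_module])

lemma ideal_pow_zero [simp]: "0 \<in> ideal_pow m n"
  by (rule module.subspace_0[OF ring_module is_ideal_pow])

lemma ideal_pow_add: "a \<in> ideal_pow m n \<Longrightarrow> b \<in> ideal_pow m n \<Longrightarrow> a + b \<in> ideal_pow m n"
  by (rule module.subspace_add[OF ring_module is_ideal_pow])

lemma ideal_pow_diff: "a \<in> ideal_pow m n \<Longrightarrow> b \<in> ideal_pow m n \<Longrightarrow> a - b \<in> ideal_pow m n"
  by (rule module.subspace_diff[OF ring_module is_ideal_pow])

lemma ideal_pow_mult: "a \<in> ideal_pow m n \<Longrightarrow> c * a \<in> ideal_pow m n"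
  by (rule module.subspace_scale[OF ring_module is_ideal_pow])

lemma ideal_pow_mult': "a \<in> ideal_pow m n \<Longrightarrow> a * c \<in> ideal_pow m n"
  by (metis ideal_pow_mult mult.commute)

lemma ideal_pow_sum: "(\<And>i. i \<in> I \<Longrightarrow> f i \<in> ideal_pow m n) \<Longrightarrow> sum f I \<in> ideal_pow m n"
  by (rule module.subspace_sum[OF ring_module is_ideal_pow])

lemma ideal_pow_Suc_subset: "ideal_pow m (Suc n) \<subseteq> ideal_pow m n"
proof -
  have "{a * b | a b. a \<in> m \<and> b \<in> ideal_pow m n} \<subseteq> ideal_pow m n"
    using ideal_pow_mult by blast
  then show ?thesis
    by (simp add: module.span_minimal[OF ring_module] is_ideal_pow)
qed

lemma ideal_pow_antimono: "n \<le> l \<Longrightarrow> ideal_pow m l \<subseteq> ideal_pow m n"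
  by (rule lift_Suc_antimono_le[of "ideal_pow m"]) (rule ideal_pow_Suc_subset)

lemma ideal_pow_1:
  assumes "is_ideal m"
  shows "ideal_pow m 1 \<subseteq> m"
proof -
  have "{a * b | a b. a \<in> m \<and> b \<in> ideal_pow m 0} \<subseteq> m"
    using module.subspace_scale[OF ring_module assms] by (auto simp: mult.commute)
  then show ?thesis
    by (simp add: module.span_minimal[OF ring_module] assms)
qed

lemma ideal_pow_Suc_mult:
  assumes "is_ideal m" "a \<in> ideal_pow m 1" "b \<in> ideal_pow m n"
  shows "a * b \<in> ideal_pow m (Suc n)"
proof -
  have "a \<in> m"
    using ideal_pow_1 assms by blast
  then show ?thesis
    using assms(3) by (auto intro!: module.span_base[OF ring_module])
qed

lemma ctensorI:
  "(\<And>i. F i \<in> ideal_pow m n) \<Longrightarrow> (\<And>l. finite {i. F i \<notin> ideal_pow m l}) \<Longrightarrow> F \<in> ctensor m n"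
  by (simp add: ctensor_def)

lemma ctensor_mem: "F \<in> ctensor m n \<Longrightarrow> F i \<in> ideal_pow m n"
  by (simp add: ctensor_def)

lemma ctensor_finite: "F \<in> ctensor m n \<Longrightarrow> finite {i. F i \<notin> ideal_pow m l}"
  by (simp add: ctensor_def)

lemma ctensor_antimono: "n \<le> l \<Longrightarrow> ctensor m l \<subseteq> ctensor m n"
  using ideal_pow_antimono[of n l m] by (auto simp: ctensor_def)

lemma ctensor_zero [simp]: "(\<lambda>i. 0) \<in> ctensor m n"
  by (simp add: ctensor_def)

lemma ctensor_add: "F \<in> ctensor m n \<Longrightarrow> G \<in> ctensor m n \<Longrightarrow> (\<lambda>i. F i + G i) \<in> ctensor m n"
proof (rule ctensorI)
  fix l assume F: "F \<in> ctensor m n" and G: "G \<in> ctensor m n"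
  have "{i. F i + G i \<notin> ideal_pow m l} \<subseteq> {i. F i \<notin> ideal_pow m l} \<union> {i. G i \<notin> ideal_pow m l}"
    using ideal_pow_add by blast
  then show "finite {i. F i + G i \<notin> ideal_pow m l}"
    using ctensor_finite[OF F] ctensor_finite[OF G] by (meson finite_UnI finite_subset)
qed (simp add: ctensor_mem ideal_pow_add)

lemma ctensor_scale: "F \<in> ctensor m n \<Longrightarrow> (\<lambda>i. c * F i) \<in> ctensor m n"
proof (rule ctensorI)
  fix l assume F: "F \<in> ctensor m n"
  have "{i. c * F i \<notin> ideal_pow m l} \<subseteq> {i. F i \<notin> ideal_pow m l}"
    using ideal_pow_mult by blast
  then show "finite {i. c * F i \<notin> ideal_pow m l}"
    using ctensor_finite[OF F] by (meson finite_subset)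
qed (simp add: ctensor_mem ideal_pow_mult)

lemma ctensor_diff:
  assumes "F \<in> ctensor m n" "G \<in> ctensor m n"
  shows "(\<lambda>i. F i - G i) \<in> ctensor m n"
  using ctensor_add[OF assms(1) ctensor_scale[OF assms(2), of "-1"]] by simp

lemma ctensor_sum:
  "(\<And>j. j \<in> J \<Longrightarrow> F j \<in> ctensor m n) \<Longrightarrow> (\<lambda>i. \<Sum>j\<in>J. F j i) \<in> ctensor m n"
  by (induction J rule: infinite_finite_induct) (simp_all add: ctensor_add)

lemma has_adic_sum_unique:
  assumes m: "complete_local_noetherian m" and s: "has_adic_sum m a s" and t: "has_adic_sum m a t"
  shows "s = t"
proof
  fix i
  have "s i - t i \<in> ideal_pow m n" for n
  proof -
    obtain N where N: "\<forall>K\<ge>N. (\<lambda>i. (\<Sum>k<K. a k i) - s i) \<in> ctensor m n"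
      using s unfolding has_adic_sum_def by blast
    obtain N' where N': "\<forall>K\<ge>N'. (\<lambda>i. (\<Sum>k<K. a k i) - t i) \<in> ctensor m n"
      using t unfolding has_adic_sum_def by blast
    have "(\<lambda>i. (\<Sum>k<max N N'. a k i) - s i) \<in> ctensor m n"
      "(\<lambda>i. (\<Sum>k<max N N'. a k i) - t i) \<in> ctensor m n"
      using N N' by simp_all
    then show ?thesis
      using ideal_pow_diff[OF ctensor_mem ctensor_mem, of "\<lambda>i. (\<Sum>k<max N N'. a k i) - t i" m n
          "\<lambda>i. (\<Sum>k<max N N'. a k i) - s i" i i] by simp
  qed
  then have "s i - t i \<in> (\<Inter>n. ideal_pow m n)"
    by blast
  then show "s i = t i"
    using m unfolding complete_local_noetherian_def by simp
qed

text \<open>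
  The coefficients converge by completeness; the error of the partial sums up to \<open>K\<close> lies in the
  \<open>K\<close>-th power of \<open>m\<close>, uniformly in the coefficient.
\<close>

lemma has_adic_sum_exists:
  assumes m: "complete_local_noetherian m" and a: "\<And>k. a k \<in> ctensor m k"
  shows "\<exists>s. has_adic_sum m a s"
proof -
  have "\<exists>b. \<forall>n. b - (\<Sum>k<n. a k i) \<in> ideal_pow m n" for i
  proof -
    have "\<forall>n. (\<Sum>k<Suc n. a k i) - (\<Sum>k<n. a k i) \<in> ideal_pow m n"
      using a ctensor_mem by fastforce
    moreover have "\<forall>a. (\<forall>n. a (Suc n) - a n \<in> ideal_pow m n) \<longrightarrow> (\<exists>b. \<forall>n. b - a n \<in> ideal_pow m n)"
      using m unfolding complete_local_noetherian_def by (elim conjE)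
    ultimately show ?thesis
      using spec[where x = "\<lambda>n. \<Sum>k<n. a k i"] by blast
  qed
  then have "\<exists>s. \<forall>i n. s i - (\<Sum>k<n. a k i) \<in> ideal_pow m n"
    by (intro choice allI)
  then obtain s where s: "\<And>i n. s i - (\<Sum>k<n. a k i) \<in> ideal_pow m n"
    by blast
  have a0: "a k \<in> ctensor m 0" for k
    using a ctensor_antimono[of 0 k m] by blast
  have s0: "s \<in> ctensor m 0"
  proof (rule ctensorI)
    fix l
    have "s i \<in> ideal_pow m l" if "(\<Sum>k<l. a k i) \<in> ideal_pow m l" for i
      using ideal_pow_add[OF s[of i l] that] by simp
    then have "{i. s i \<notin> ideal_pow m l} \<subseteq> {i. (\<Sum>k<l. a k i) \<notin> ideal_pow m l}"
      by blast
    then show "finite {i. s i \<notin> ideal_pow m l}"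
      using ctensor_finite[OF ctensor_sum[of "{..<l}" a, OF a0]] by (meson finite_subset)
  qed simp
  have "(\<lambda>i. (\<Sum>k<K. a k i) - s i) \<in> ctensor m n" if "n \<le> K" for n K
  proof (rule ctensorI)
    fix i
    have "0 - (s i - (\<Sum>k<K. a k i)) \<in> ideal_pow m n"
      by (intro ideal_pow_diff ideal_pow_zero subsetD[OF ideal_pow_antimono[OF that] s])
    then show "(\<Sum>k<K. a k i) - s i \<in> ideal_pow m n"
      by simp
  next
    show "finite {i. (\<Sum>k<K. a k i) - s i \<notin> ideal_pow m l}" for l
      by (rule ctensor_finite[OF ctensor_diff[OF ctensor_sum s0]]) (rule a0)
  qed
  then have "has_adic_sum m a s"
    unfolding has_adic_sum_def using s0 by blast
  then show ?thesis
    by (intro exI)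
qed

lemma finite_words_with_content: "finite {w. mset w = M}"
proof (rule finite_subset)
  show "{w. mset w = M} \<subseteq> {w. set w \<subseteq> set_mset M \<and> length w = size M}"
    by auto
qed (simp add: finite_lists_length_eq)

lemma projection_ctensor:
  assumes F: "F \<in> ctensor m n"
  shows "projection F \<in> ctensor m n"
proof (rule ctensorI)
  fix l
  have "{M. projection F M \<notin> ideal_pow m l} \<subseteq> mset ` {w. F w \<notin> ideal_pow m l}"
  proof
    fix M assume "M \<in> {M. projection F M \<notin> ideal_pow m l}"
    then obtain w where "mset w = M" "F w \<notin> ideal_pow m l"
      unfolding projection_def using ideal_pow_sum[of "{w. mset w = M}" F m l] by blast
    then show "M \<in> mset ` {w. F w \<notin> ideal_pow m l}"
      by blast
  qed
  then show "finite {M. projection F M \<notin> ideal_pow m l}"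
    using ctensor_finite[OF F] by (meson finite_surj)
qed (simp add: projection_def ideal_pow_sum ctensor_mem[OF F])

lemma has_adic_sum_projection:
  assumes "has_adic_sum m a s"
  shows "has_adic_sum m (\<lambda>k. projection (a k)) (projection s)"
proof -
  have "(\<lambda>M. (\<Sum>k<K. projection (a k) M) - projection s M) \<in> ctensor m n"
    if "(\<lambda>i. (\<Sum>k<K. a k i) - s i) \<in> ctensor m n" for n K
  proof -
    have "projection (\<lambda>i. (\<Sum>k<K. a k i) - s i) = (\<lambda>M. (\<Sum>k<K. projection (a k) M) - projection s M)"
      by (simp add: projection_def fun_eq_iff sum_subtractf sum.swap[of _ "{..<K}"])
    then show ?thesis
      using projection_ctensor[OF that] by simp
  qed
  then show ?thesis
    using assms projection_ctensor unfolding has_adic_sum_def by meson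
qed


section \<open>Rightmost descents\<close>

lemma red_positions_empty_iff: "red_positions w = {} \<longleftrightarrow> sorted w"
  by (auto simp: red_positions_def sorted_iff_nth_Suc not_less[symmetric])

lemma finite_red_positions: "finite (red_positions w)"
  by (rule finite_subset[of _ "{..<length w}"]) (auto simp: red_positions_def)

text \<open>
  A descent is the rightmost one when the letters from its second one on are sorted. All the
  reductions below are described by such a decomposition of the word instead of by positions.
\<close>

lemma Max_red_positions:
  assumes "a < b" "sorted (a # r)"
  shows "Max (red_positions (q @ b # a # r)) = length q" "red_positions (q @ b # a # r) \<noteq> {}"
proof -
  let ?w = "q @ b # a # r"
  have mem: "length q \<in> red_positions ?w"
    using assms by (simp add: red_positions_def nth_append)
  have "i \<le> length q" if i: "i \<in> red_positions ?w" for i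
  proof (rule ccontr)
    assume "\<not> i \<le> length q"
    then obtain j where j: "i = length q + Suc j"
      by (metis add_Suc_right less_imp_Suc_add not_le)
    have "?w ! Suc i < ?w ! i" "Suc i < length ?w"
      using i by (auto simp: red_positions_def)
    then have "(a # r) ! Suc j < (a # r) ! j" "Suc j < length (a # r)"
      by (simp_all add: j nth_append)
    then show False
      using sorted_nth_mono[OF assms(2), of j "Suc j"] by simp
  qed
  then show "Max (red_positions ?w) = length q"
    using mem finite_red_positions by (intro Max_eqI) auto
  show "red_positions ?w \<noteq> {}"
    using mem by blast
qed

lemma rightmost_descent_exists:
  assumes "\<not> sorted (map f p)"
  shows "\<exists>q y z r. p = q @ y # z # r \<and> f z < f y \<and> sorted (map f (z # r))"
  using assms
proof (induction p)
  case (Cons y p)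
  show ?case
  proof (cases "sorted (map f p)")
    case True
    with Cons.prems obtain z r where "p = z # r" "f z < f y"
      by (cases p) force+
    then show ?thesis
      using True by (metis append_Nil)
  next
    case False
    then show ?thesis
      using Cons.IH by (metis append_Cons)
  qed
qed simp

fun inversions :: "'x::linorder list \<Rightarrow> nat" where
  "inversions [] = 0"
| "inversions (x # xs) = length (filter (\<lambda>y. y < x) xs) + inversions xs"

lemma inversions_swap: "a < b \<Longrightarrow> inversions (q @ a # b # r) < inversions (q @ b # a # r)"
  by (induction q) auto

lemma tracked_word_cases [case_names irreducible reducible]:
  fixes p :: "'x::linorder tracked"
  obtains "sorted (map fst p)"
  | q b e a e' r where "p = q @ (b, e) # (a, e') # r" "a < b" "sorted (a # map fst r)"
proof (cases "sorted (map fst p)")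
  case False
  then obtain q y z r where p: "p = q @ y # z # r" "fst z < fst y" "sorted (map fst (z # r))"
    using rightmost_descent_exists by blast
  obtain b e a e' where "y = (b, e)" "z = (a, e')"
    by (metis surj_pair)
  then show ?thesis
    using p that(2) by simp
qed (rule that(1))

text \<open>
  The reduction of a word terminates: a use of \<open>phi\<close> lowers the number \<open>k\<close> of uses still to come, and
  an exchange keeps \<open>k\<close> and removes an inversion. The induction is therefore lexicographic.
\<close>

lemma reduction_induct [case_names irreducible reducible]:
  fixes p :: "'x::linorder tracked"
  assumes irreducible: "\<And>k p P. sorted (map fst p) \<Longrightarrow> Pr k p P"
    and reducible: "\<And>k q b e a e' r P. \<lbrakk>a < b; sorted (a # map fst r); Pr k (q @ (a, e') # (b, e) # r) P;
        \<And>k' p' P'. k = Suc k' \<Longrightarrow> Pr k' p' P'\<rbrakk> \<Longrightarrow> Pr k (q @ (b, e) # (a, e') # r) P"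
  shows "Pr k p P"
proof (induction k arbitrary: p P rule: less_induct)
  case (less k p P)
  note fewer_uses = less.IH
  show ?case
  proof (induction "inversions (map fst p)" arbitrary: p P rule: less_induct)
    case (less p P)
    show ?case
    proof (cases p rule: tracked_word_cases)
      case irreducible
      then show ?thesis by (rule assms(1))
    next
      case (reducible q b e a e' r)
      show ?thesis
        unfolding reducible(1)
      proof (rule assms(2)[OF reducible(2,3)])
        show "Pr k (q @ (a, e') # (b, e) # r) P"
          by (rule less(1)) (use reducible in \<open>simp add: inversions_swap\<close>)
        show "Pr k' p' P'" if "k = Suc k'" for k' p' P'
          using that by (intro fewer_uses) simp
      qed
    qed
  qed
qed


section \<open>Sums over the reductions of a tracked word\<close>

lemma length_sorted_list_of_multiset: "length (sorted_list_of_multiset M) = size M"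
  by (metis mset_sorted_list_of_multiset size_mset)

lemma length_segment_factors [simp]: "length (segment_factors v M) = size M"
  by (simp add: segment_factors_def)

lemma map_fst_segment_factors [simp]: "map fst (segment_factors v M) = sorted_list_of_multiset M"
  by (rule nth_equalityI) (simp_all add: segment_factors_def length_sorted_list_of_multiset)

abbreviation apply_phi ::
  "nat \<times> nat \<Rightarrow> nat \<times> nat \<Rightarrow> 'x multiset \<Rightarrow> picture \<Rightarrow> picture" where
  "apply_phi e e' M P \<equiv> set_arrow (length P) e (set_arrow (length P) e' P) @ [replicate (size M) None]"

lemma run_irreducible:
  assumes "sorted (map fst p)"
  shows "run phi ts (p, P, c) = (if ts = [] then Some (p, P, c) else None)"
  using assms by (cases ts) (simp_all add: red_positions_empty_iff)

lemma run_reducible: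
  assumes "a < b" "sorted (a # map fst r)"
  shows "run phi ts (q @ (b, e) # (a, e') # r, P, c) =
    (case ts of [] \<Rightarrow> None
     | None # ts' \<Rightarrow> run phi ts' (q @ (a, e') # (b, e) # r, P, c)
     | Some M # ts' \<Rightarrow> run phi ts' (q @ segment_factors (length P) M @ r, apply_phi e e' M P, c * phi b a M))"
proof -
  have "Max (red_positions (map fst (q @ (b, e) # (a, e') # r))) = length q"
    "red_positions (map fst (q @ (b, e) # (a, e') # r)) \<noteq> {}"
    using Max_red_positions[OF assms, of "map fst q"] by simp_all
  then show ?thesis
    by (cases ts) (simp_all add: Let_def nth_append split: option.split)
qed

lemma run_scale:
  "run phi ts (p, P, c * d) = map_option (\<lambda>(p', P', e). (p', P', c * e)) (run phi ts (p, P, d))"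
proof (induction ts arbitrary: p P d)
  case Nil
  show ?case by simp
next
  case (Cons t ts)
  show ?case
  proof (cases p rule: tracked_word_cases)
    case (reducible q b e a e' r)
    show ?thesis
      unfolding reducible(1)
      by (subst (1 2) run_reducible[OF reducible(2,3)])
        (simp_all add: Cons.IH mult.assoc del: run.simps split: option.split)
  qed (simp add: run_irreducible del: run.simps)
qed

definition phi_uses :: "'x multiset option list \<Rightarrow> nat" where
  "phi_uses ts = length (filter (\<lambda>t. t \<noteq> None) ts)"

lemma phi_uses_simps [simp]:
  "phi_uses [] = 0" "phi_uses (None # ts) = phi_uses ts" "phi_uses (Some M # ts) = Suc (phi_uses ts)"
  by (simp_all add: phi_uses_def)

text \<open>
  A list of choices determines its final state and coefficient, so that sums over reductions are
  sums over sets of such lists.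
\<close>

definition run_choices ::
  "('x::linorder \<Rightarrow> 'x \<Rightarrow> 'x multiset \<Rightarrow> 'b::comm_ring_1) \<Rightarrow> nat \<Rightarrow> ('x tracked \<Rightarrow> picture \<Rightarrow> bool) \<Rightarrow>
   'x tracked \<Rightarrow> picture \<Rightarrow> 'x multiset option list set" where
  "run_choices phi k Q p P = {ts. phi_uses ts = k \<and>
     (\<exists>p' P' c. run phi ts (p, P, 1) = Some (p', P', c) \<and> Q p' P')}"

definition run_weight ::
  "('x::linorder \<Rightarrow> 'x \<Rightarrow> 'x multiset \<Rightarrow> 'b::comm_ring_1) \<Rightarrow> 'x tracked \<Rightarrow> picture \<Rightarrow>
   'x multiset option list \<Rightarrow> 'b" where
  "run_weight phi p P ts = snd (snd (the (run phi ts (p, P, 1))))"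

text \<open>
  Both the coefficients of the star product and those of the operators of the graphs are sums of this
  kind: they differ only in the condition \<open>Q\<close> on the final word and picture.
\<close>

definition run_sum ::
  "('x::linorder \<Rightarrow> 'x \<Rightarrow> 'x multiset \<Rightarrow> 'b::comm_ring_1) \<Rightarrow> nat \<Rightarrow> ('x tracked \<Rightarrow> picture \<Rightarrow> bool) \<Rightarrow>
   'x tracked \<Rightarrow> picture \<Rightarrow> 'b" where
  "run_sum phi k Q p P = (\<Sum>ts\<in>run_choices phi k Q p P. run_weight phi p P ts)"

text \<open>A bound on the final length leaves only finitely many monomials for each use of \<open>phi\<close>.\<close>

definition length_bound :: "nat \<Rightarrow> ('x tracked \<Rightarrow> picture \<Rightarrow> bool) \<Rightarrow> bool" where
  "length_bound L Q \<longleftrightarrow> (\<forall>p P. Q p P \<longrightarrow> length p \<le> L)"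

definition multisets_upto :: "nat \<Rightarrow> 'x multiset set" where
  "multisets_upto n = {M. size M \<le> n}"

lemma mem_multisets_upto [simp]: "M \<in> multisets_upto n \<longleftrightarrow> size M \<le> n"
  by (simp add: multisets_upto_def)

lemma finite_multisets_upto [simp]: "finite (multisets_upto n :: 'x::finite multiset set)"
proof -
  have "finite {xs :: 'x list. set xs \<subseteq> UNIV \<and> length xs \<le> n}"
    by (rule finite_lists_length_le) simp
  moreover have "multisets_upto n \<subseteq> mset ` {xs :: 'x list. set xs \<subseteq> UNIV \<and> length xs \<le> n}"
    unfolding multisets_upto_def by (smt (verit) ex_mset image_eqI mem_Collect_eq size_mset subsetI subset_UNIV)
  ultimately show ?thesis
    by (meson finite_surj)
qed

lemma run_choices_irreducible:
  "sorted (map fst p) \<Longrightarrow> run_choices phi k Q p P = (if k = 0 \<and> Q p P then {[]} else {})"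
  by (auto simp: run_choices_def run_irreducible)

lemma run_sum_irreducible:
  "sorted (map fst p) \<Longrightarrow> run_sum phi k Q p P = of_bool (k = 0 \<and> Q p P)"
  by (simp add: run_sum_def run_choices_irreducible run_weight_def run_irreducible)

lemma run_scale1:
  "run phi ts (p, P, c) = map_option (\<lambda>(p', P', e). (p', P', c * e)) (run phi ts (p, P, 1))"
  using run_scale[of phi ts p P c 1] by simp

lemma run_choices_reducible:
  fixes phi :: "'x::linorder \<Rightarrow> 'x \<Rightarrow> 'x multiset \<Rightarrow> 'b::comm_ring_1"
  assumes "a < b" "sorted (a # map fst r)"
  shows "run_choices phi k Q (q @ (b, e) # (a, e') # r) P =
    (#) None ` run_choices phi k Q (q @ (a, e') # (b, e) # r) P \<union>
    (\<Union>M. \<Union>k'\<in>{k'. k = Suc k'}. (#) (Some M) `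
       run_choices phi k' Q (q @ segment_factors (length P) M @ r) (apply_phi e e' M P))"
  (is "?L = ?R")
proof (rule set_eqI)
  fix ts
  note red = run_reducible[OF assms, of phi]
  show "ts \<in> ?L \<longleftrightarrow> ts \<in> ?R"
  proof (cases ts)
    case Nil
    then show ?thesis by (auto simp: run_choices_def red)
  next
    case (Cons t ts')
    show ?thesis
    proof (cases t)
      case None
      then show ?thesis
        using Cons by (auto simp: run_choices_def red)
    next
      case (Some M)
      have "ts \<in> ?L \<longleftrightarrow> k = Suc (phi_uses ts') \<and> (\<exists>p' P' c. run phi ts'
          (q @ segment_factors (length P) M @ r, apply_phi e e' M P, phi b a M) = Some (p', P', c) \<and> Q p' P')"
        using Cons Some by (auto simp: run_choices_def red)
      also have "\<dots> \<longleftrightarrow> k = Suc (phi_uses ts') \<and> (\<exists>p' P' c. run phi ts'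
          (q @ segment_factors (length P) M @ r, apply_phi e e' M P, 1) = Some (p', P', c) \<and> Q p' P')"
        by (subst run_scale1) auto
      also have "\<dots> \<longleftrightarrow> ts \<in> ?R"
        using Cons Some by (auto simp: run_choices_def image_iff)
      finally show ?thesis .
    qed
  qed
qed

lemma run_weight_exchange:
  assumes "a < b" "sorted (a # map fst r)"
  shows "run_weight phi (q @ (b, e) # (a, e') # r) P (None # ts) =
    run_weight phi (q @ (a, e') # (b, e) # r) P ts"
  by (simp add: run_weight_def run_reducible[OF assms])

lemma run_weight_phi:
  assumes "a < b" "sorted (a # map fst r)"
    and ts: "ts \<in> run_choices phi k Q (q @ segment_factors (length P) M @ r) (apply_phi e e' M P)"
  shows "run_weight phi (q @ (b, e) # (a, e') # r) P (Some M # ts) =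
    phi b a M * run_weight phi (q @ segment_factors (length P) M @ r) (apply_phi e e' M P) ts"
proof -
  obtain p' P' c where "run phi ts (q @ segment_factors (length P) M @ r, apply_phi e e' M P, 1) = Some (p', P', c)"
    using ts by (auto simp: run_choices_def)
  then show ?thesis
    using run_scale1[of phi ts _ _ "phi b a M"] by (simp add: run_weight_def run_reducible[OF assms(1,2)])
qed

text \<open>A use of \<open>phi\<close> lowers the length by at most two.\<close>

lemma run_choices_length:
  assumes "length_bound L Q" "run_choices phi k Q p P \<noteq> {}"
  shows "length p \<le> L + 2 * k"
  using assms(2)
proof (induction k p P rule: reduction_induct)
  case (irreducible k p P)
  then show ?case
    using assms(1) by (auto simp: run_choices_irreducible length_bound_def split: if_splits)
next
  case (reducible k q b e a e' r P)
  consider "run_choices phi k Q (q @ (a, e') # (b, e) # r) P \<noteq> {}"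
    | k' M where "k = Suc k'" "run_choices phi k' Q (q @ segment_factors (length P) M @ r) (apply_phi e e' M P) \<noteq> {}"
    using reducible.prems unfolding run_choices_reducible[OF reducible.hyps(1,2)] by blast
  then show ?case
    using reducible.IH by cases force+
qed

lemma run_choices_monomial_size:
  assumes "length_bound L Q" "run_choices phi k Q (q @ segment_factors n M @ r) P \<noteq> {}"
  shows "M \<in> multisets_upto (L + 2 * k)"
  using run_choices_length[OF assms] by (simp add: multisets_upto_def)

lemma finite_run_choices:
  fixes phi :: "'x::{finite, linorder} \<Rightarrow> 'x \<Rightarrow> 'x multiset \<Rightarrow> 'b::comm_ring_1"
  assumes Q: "length_bound L Q"
  shows "finite (run_choices phi k Q p P)"
proof (induction k p P rule: reduction_induct)
  case (reducible k q b e a e' r P)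
  let ?C = "\<lambda>M. \<Union>k'\<in>{k'. k = Suc k'}. (#) (Some M) `
       run_choices phi k' Q (q @ segment_factors (length P) M @ r) (apply_phi e e' M P)"
  have "M \<in> multisets_upto (L + 2 * k)" if ne: "?C M \<noteq> {}" for M
  proof -
    obtain k' where "k = Suc k'"
      "run_choices phi k' Q (q @ segment_factors (length P) M @ r) (apply_phi e e' M P) \<noteq> {}"
      using ne by blast
    then show ?thesis
      using run_choices_monomial_size[OF Q] by (fastforce simp: multisets_upto_def)
  qed
  then have "(\<Union>M. ?C M) = (\<Union>M\<in>multisets_upto (L + 2 * k). ?C M)"
    by blast
  moreover have "finite (?C M)" for M
  proof (rule finite_UN_I)
    show "finite {k'. k = Suc k'}"
      by (rule finite_subset[of _ "{k - 1}"]) auto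
  qed (simp add: reducible.IH(2))
  ultimately have "finite (\<Union>M. ?C M)"
    by simp
  then show ?case
    unfolding run_choices_reducible[OF reducible.hyps(1,2)] using reducible.IH(1) by simp
qed (simp add: run_choices_irreducible)

text \<open>
  The first step is an exchange or, for \<open>k > 0\<close>, a use of \<open>phi\<close>. Monomials of degree above \<open>N\<close> lead to
  final words which are too long for \<open>Q\<close>.
\<close>

lemma run_sum_reducible:
  fixes phi :: "'x::{finite, linorder} \<Rightarrow> 'x \<Rightarrow> 'x multiset \<Rightarrow> 'b::comm_ring_1"
  assumes Q: "length_bound L Q" and ab: "a < b" "sorted (a # map fst r)" and N: "L + 2 * k \<le> N"
  shows "run_sum phi k Q (q @ (b, e) # (a, e') # r) P =
    run_sum phi k Q (q @ (a, e') # (b, e) # r) P +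
    (case k of 0 \<Rightarrow> 0 | Suc k' \<Rightarrow> \<Sum>M\<in>multisets_upto N. phi b a M *
       run_sum phi k' Q (q @ segment_factors (length P) M @ r) (apply_phi e e' M P))"
proof -
  let ?p = "q @ (b, e) # (a, e') # r"
  let ?w = "run_weight phi ?p P"
  define A where "A = (#) None ` run_choices phi k Q (q @ (a, e') # (b, e) # r) P"
  define C where "C k' M = run_choices phi k' Q (q @ segment_factors (length P) M @ r) (apply_phi e e' M P)" for k' M
  have A: "sum ?w A = run_sum phi k Q (q @ (a, e') # (b, e) # r) P"
    unfolding A_def run_sum_def by (subst sum.reindex) (simp_all add: run_weight_exchange[OF ab])
  have C: "sum ?w ((#) (Some M) ` C k' M) = phi b a M *
      run_sum phi k' Q (q @ segment_factors (length P) M @ r) (apply_phi e e' M P)" for k' M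
    unfolding C_def run_sum_def sum_distrib_left
    by (subst sum.reindex) (auto intro!: sum.cong simp: run_weight_phi[OF ab])
  show ?thesis
  proof (cases k)
    case 0
    then have "run_choices phi k Q ?p P = A"
      unfolding run_choices_reducible[OF ab] A_def by simp
    then show ?thesis
      using A 0 by (simp add: run_sum_def)
  next
    case (Suc k')
    have mem: "M \<in> multisets_upto N" if "ts \<in> C k' M" for ts M
      using run_choices_monomial_size[OF Q, of phi k' q "length P" M r] that N Suc
      unfolding C_def multisets_upto_def by fastforce
    have "run_choices phi k Q ?p P = A \<union> (\<Union>M. (#) (Some M) ` C k' M)"
      unfolding run_choices_reducible[OF ab] A_def C_def using Suc by auto
    also have "\<dots> = A \<union> (\<Union>M\<in>multisets_upto N. (#) (Some M) ` C k' M)"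
      using mem by fast
    finally have S: "run_choices phi k Q ?p P = A \<union> (\<Union>M\<in>multisets_upto N. (#) (Some M) ` C k' M)" .
    have "sum ?w (run_choices phi k Q ?p P) = sum ?w A + (\<Sum>M\<in>multisets_upto N. sum ?w ((#) (Some M) ` C k' M))"
      unfolding S
      by (subst sum.union_disjoint, simp_all add: A_def C_def finite_run_choices[OF Q], blast)
        (subst sum.UNION_disjoint, auto simp: finite_run_choices[OF Q])
    then show ?thesis
      unfolding A C using Suc by (simp add: run_sum_def)
  qed
qed

lemma run_sum_cong:
  assumes "\<And>ts p' P' c. phi_uses ts = k \<Longrightarrow> run phi ts (p, P, 1) = Some (p', P', c) \<Longrightarrow> Q p' P' \<longleftrightarrow> Q' p' P'"
  shows "run_sum phi k Q p P = run_sum phi k Q' p P"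
proof -
  have "run_choices phi k Q p P = run_choices phi k Q' p P"
    unfolding run_choices_def using assms by blast
  then show ?thesis
    by (simp add: run_sum_def)
qed

lemma run_sum_empty:
  assumes "\<And>ts p' P' c. phi_uses ts = k \<Longrightarrow> run phi ts (p, P, 1) = Some (p', P', c) \<Longrightarrow> \<not> Q p' P'"
  shows "run_sum phi k Q p P = 0"
proof -
  have "run_choices phi k Q p P = {}"
    unfolding run_choices_def using assms by blast
  then show ?thesis
    by (simp add: run_sum_def)
qed

text \<open>
  The reductions are sorted below by their final word, by their graph, and by the factors of the two
  arguments which are hit.
\<close>

lemma run_sum_partition:
  fixes phi :: "'x::{finite, linorder} \<Rightarrow> 'x \<Rightarrow> 'x multiset \<Rightarrow> 'b::comm_ring_1"
  assumes Q: "length_bound L Q" and J: "finite J"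
    and f: "\<And>ts p' P' c. phi_uses ts = k \<Longrightarrow> run phi ts (p, P, 1) = Some (p', P', c) \<Longrightarrow> Q p' P' \<Longrightarrow> f p' P' \<in> J"
  shows "run_sum phi k Q p P = (\<Sum>j\<in>J. run_sum phi k (\<lambda>p' P'. Q p' P' \<and> f p' P' = j) p P)"
proof -
  let ?C = "\<lambda>j. run_choices phi k (\<lambda>p' P'. Q p' P' \<and> f p' P' = j) p P"
  have U: "run_choices phi k Q p P = (\<Union>j\<in>J. ?C j)"
    using f by (fastforce simp: run_choices_def)
  have fin: "finite (?C j)" for j
    by (rule finite_subset[OF _ finite_run_choices[OF Q, of phi k p P]]) (auto simp: run_choices_def)
  have "?C i \<inter> ?C j = {}" if "i \<noteq> j" for i j
    using that by (auto simp: run_choices_def)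
  then show ?thesis
    unfolding run_sum_def U using J fin by (intro sum.UNION_disjoint) auto
qed

lemma run_sum_in_ideal_pow:
  fixes phi :: "'x::{finite, linorder} \<Rightarrow> 'x \<Rightarrow> 'x multiset \<Rightarrow> 'b::comm_ring_1"
  assumes m: "is_ideal m" and phi: "cochain m phi" and Q: "length_bound L Q"
  shows "run_sum phi k Q p P \<in> ideal_pow m k"
proof (induction k p P rule: reduction_induct)
  case (irreducible k p P)
  then show ?case
    by (simp add: run_sum_irreducible)
next
  case (reducible k q b e a e' r P)
  have "phi b a M \<in> ideal_pow m 1" for M
    using phi \<open>a < b\<close> ctensor_mem[of "phi b a" m 1 M] by (simp add: cochain_def del: ideal_pow.simps)
  then show ?case
    unfolding run_sum_reducible[OF Q reducible.hyps(1,2) order_refl]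
    using reducible.IH m
    by (intro ideal_pow_add) (auto split: nat.split intro!: ideal_pow_sum ideal_pow_Suc_mult simp del: ideal_pow.simps)
qed

text \<open>
  Modulo a power of \<open>m\<close> each value of \<open>phi\<close> has only finitely many monomials, so only finitely many
  branches of the reduction contribute.
\<close>

lemma run_sum_ctensor:
  fixes phi :: "'x::{finite, linorder} \<Rightarrow> 'x \<Rightarrow> 'x multiset \<Rightarrow> 'b::comm_ring_1"
  assumes m: "is_ideal m" and phi: "cochain m phi"
    and content: "\<And>p. length p \<le> l (content p)"
  shows "(\<lambda>i. run_sum phi k (\<lambda>p' P'. content p' = i \<and> Q p' P') p P) \<in> ctensor m k"
proof (rule ctensorI)
  have bound: "length_bound (l i) (\<lambda>p' P'. content p' = i \<and> Q p' P')" for i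
    using content by (auto simp: length_bound_def)
  show "run_sum phi k (\<lambda>p' P'. content p' = i \<and> Q p' P') p P \<in> ideal_pow m k" for i
    by (rule run_sum_in_ideal_pow[OF m phi bound])
  fix n
  show "finite {i. run_sum phi k (\<lambda>p' P'. content p' = i \<and> Q p' P') p P \<notin> ideal_pow m n}"
    (is "finite (?bad k p P)")
  proof (induction k p P rule: reduction_induct)
    case (irreducible k p P)
    then have "?bad k p P \<subseteq> {content p}"
      by (auto simp: run_sum_irreducible)
    then show ?case
      by (rule finite_subset) simp
  next
    case (reducible k q b e a e' r P)
    define S where "S = ?bad k (q @ (a, e') # (b, e) # r) P"
    define T where "T = {M. phi b a M \<notin> ideal_pow m n}"
    define V where "V M = ?bad (k - 1) (q @ segment_factors (length P) M @ r) (apply_phi e e' M P)" for M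
    have "?bad k (q @ (b, e) # (a, e') # r) P \<subseteq> S \<union> (if k = 0 then {} else \<Union>M\<in>T. V M)"
    proof (rule subsetI, rule ccontr)
      fix i
      assume i: "i \<in> ?bad k (q @ (b, e) # (a, e') # r) P"
        and n: "i \<notin> S \<union> (if k = 0 then {} else \<Union>M\<in>T. V M)"
      have "run_sum phi k (\<lambda>p' P'. content p' = i \<and> Q p' P') (q @ (b, e) # (a, e') # r) P \<in> ideal_pow m n"
        unfolding run_sum_reducible[OF bound reducible.hyps(1,2) order_refl]
      proof (rule ideal_pow_add)
        show "(case k of 0 \<Rightarrow> 0 | Suc k' \<Rightarrow> \<Sum>M\<in>multisets_upto (l i + 2 * k). phi b a M *
          run_sum phi k' (\<lambda>p' P'. content p' = i \<and> Q p' P') (q @ segment_factors (length P) M @ r)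
            (apply_phi e e' M P)) \<in> ideal_pow m n"
        proof (cases k)
          case (Suc k')
          have "phi b a M * run_sum phi k' (\<lambda>p' P'. content p' = i \<and> Q p' P')
            (q @ segment_factors (length P) M @ r) (apply_phi e e' M P) \<in> ideal_pow m n" for M
            using n Suc by (cases "M \<in> T") (auto simp: T_def V_def intro: ideal_pow_mult ideal_pow_mult')
          then show ?thesis
            using Suc by (auto intro: ideal_pow_sum)
        qed simp
      qed (use n in \<open>simp add: S_def\<close>)
      then show False
        using i by simp
    qed
    moreover have "finite T"
      using phi \<open>a < b\<close> unfolding T_def cochain_def by (blast intro: ctensor_finite)
    moreover have "k \<noteq> 0 \<Longrightarrow> finite (V M)" for M
      unfolding V_def by (rule reducible.IH(2)) simp
    moreover have "finite S"
      unfolding S_def by (rule reducible.IH(1))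
    ultimately show ?case
      by (auto intro: finite_subset)
  qed
qed

abbreviation start_word :: "'x::linorder multiset \<Rightarrow> 'x multiset \<Rightarrow> 'x tracked" where
  "start_word \<alpha> \<beta> \<equiv> segment_factors 0 \<alpha> @ segment_factors 1 \<beta>"

abbreviation start_picture :: "'x multiset \<Rightarrow> 'x multiset \<Rightarrow> picture" where
  "start_picture \<alpha> \<beta> \<equiv> [replicate (size \<alpha>) None, replicate (size \<beta>) None]"


section \<open>The star product as a sum over reductions\<close>

definition words_upto :: "nat \<Rightarrow> 'x list set" where
  "words_upto n = {w. length w \<le> n}"

lemma mem_words_upto [simp]: "w \<in> words_upto n \<longleftrightarrow> length w \<le> n"
  by (simp add: words_upto_def)

lemma finite_words_upto [simp]: "finite (words_upto n :: 'x::finite list set)"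
  using finite_lists_length_le[of "UNIV :: 'x set" n] by (simp add: words_upto_def)

lemma fps_const_sum: "fps_const (sum f A) = (\<Sum>x\<in>A. fps_const (f x))"
  by (rule fps_ext) (simp add: fps_sum_nth)

lemma red_word_irreducible: "sorted p \<Longrightarrow> red_word phi p w = of_bool (w = p)"
  by (simp add: red_word_def red_positions_empty_iff)

lemma red_word_reducible:
  assumes "a < b" "sorted (a # r)"
  shows "red_word phi (q @ b # a # r) w = of_bool (w = q @ a # b # r) +
    fps_X * fps_const (\<Sum>M | w = q @ sorted_list_of_multiset M @ r. phi b a M)"
  using Max_red_positions[OF assms, of q] by (simp add: red_word_def Let_def nth_append)

lemma red_word_length:
  assumes "red_word phi p w \<noteq> 0"
  shows "length p \<le> length w + 2"
proof (cases "sorted p")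
  case True
  then show ?thesis
    using assms by (auto simp: red_word_irreducible split: if_splits)
next
  case False
  then obtain q b a r where p: "p = q @ b # a # r" "a < b" "sorted (a # r)"
    using rightmost_descent_exists[of "\<lambda>x. x" p] by auto
  have "w = q @ a # b # r \<or> (\<exists>M. w = q @ sorted_list_of_multiset M @ r)"
    using assms unfolding p(1) red_word_reducible[OF p(2,3)] by (auto split: if_splits)
  then show ?thesis
    unfolding p(1) by auto
qed

lemma red_eq_sum:
  fixes phi :: "'x::{finite, linorder} \<Rightarrow> 'x \<Rightarrow> 'x multiset \<Rightarrow> 'b::comm_ring_1"
  assumes "length w + 2 \<le> L"
  shows "red phi F w = (\<Sum>p\<in>words_upto L. F p * red_word phi p w)"
  unfolding red_def
proof (rule Sum_any.expand_superset)
  show "{p. F p * red_word phi p w \<noteq> 0} \<subseteq> words_upto L"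
  proof
    fix p assume "p \<in> {p. F p * red_word phi p w \<noteq> 0}"
    then have "red_word phi p w \<noteq> 0"
      by auto
    then show "p \<in> words_upto L"
      using red_word_length assms by fastforce
  qed
qed simp

text \<open>
  The entry at \<open>(p, w)\<close> of the \<open>N\<close>-th power of the matrix of \<open>red\<close>, expanded along the first step.
\<close>

fun red_matrix ::
  "('x::{finite, linorder} \<Rightarrow> 'x \<Rightarrow> 'x multiset \<Rightarrow> 'b::comm_ring_1) \<Rightarrow> nat \<Rightarrow> 'x list \<Rightarrow> 'x list \<Rightarrow> 'b fps" where
  "red_matrix phi 0 p w = of_bool (w = p)"
| "red_matrix phi (Suc N) p w = (\<Sum>p'\<in>words_upto (length w + 2 * N). red_word phi p p' * red_matrix phi N p' w)"

lemma red_matrix_length: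
  assumes "red_matrix phi N p w \<noteq> 0"
  shows "length p \<le> length w + 2 * N"
proof (cases N)
  case 0
  then show ?thesis
    using assms by (auto split: if_splits)
next
  case (Suc N')
  then obtain p' where "p' \<in> words_upto (length w + 2 * N')" "red_word phi p p' \<noteq> 0"
    using assms by (metis (no_types, lifting) mult_zero_left red_matrix.simps(2) sum.neutral)
  then show ?thesis
    using red_word_length[of phi p p'] Suc by simp
qed

lemma red_power:
  "length w + 2 * N \<le> L \<Longrightarrow> (red phi ^^ N) F w = (\<Sum>p\<in>words_upto L. F p * red_matrix phi N p w)"
proof (induction N arbitrary: F L)
  case 0
  have "(\<Sum>p\<in>words_upto L. F p * red_matrix phi 0 p w) = (\<Sum>p\<in>words_upto L. if p = w then F p else 0)"
    by (rule sum.cong) auto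
  then show ?case
    using 0 by simp
next
  case (Suc N)
  let ?V = "words_upto (length w + 2 * N) :: 'a list set"
  have "(red phi ^^ Suc N) F w = (red phi ^^ N) (red phi F) w"
    by (simp add: funpow_Suc_right del: funpow.simps)
  also have "\<dots> = (\<Sum>p\<in>?V. red phi F p * red_matrix phi N p w)"
    by (rule Suc.IH) simp
  also have "\<dots> = (\<Sum>p\<in>?V. (\<Sum>p'\<in>words_upto L. F p' * red_word phi p' p) * red_matrix phi N p w)"
    using Suc.prems by (intro sum.cong refl arg_cong2[where f = "(*)"] red_eq_sum) auto
  also have "\<dots> = (\<Sum>p'\<in>words_upto L. F p' * red_matrix phi (Suc N) p' w)"
    by (simp add: sum_distrib_left sum_distrib_right mult.assoc sum.swap[of _ ?V])
  finally show ?case .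
qed

lemma red_matrix_irreducible:
  assumes "sorted p"
  shows "red_matrix phi N p w = of_bool (w = p)"
proof (induction N)
  case (Suc N)
  have "red_matrix phi (Suc N) p w =
      (\<Sum>p'\<in>words_upto (length w + 2 * N). if p' = p then red_matrix phi N p w else 0)"
    unfolding red_matrix.simps by (rule sum.cong) (simp_all add: red_word_irreducible[OF assms])
  also have "\<dots> = red_matrix phi N p w"
    using red_matrix_length[of phi N p w] by auto
  finally show ?case
    using Suc by simp
qed simp

lemma red_matrix_reducible:
  assumes ab: "a < b" "sorted (a # r)" and L: "length w + 2 * N \<le> L"
  shows "red_matrix phi (Suc N) (q @ b # a # r) w = red_matrix phi N (q @ a # b # r) w +
    fps_X * (\<Sum>M\<in>multisets_upto L. fps_const (phi b a M) *
      red_matrix phi N (q @ sorted_list_of_multiset M @ r) w)"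
proof -
  let ?V = "words_upto L :: 'a list set" and ?M = "multisets_upto L :: 'a multiset set"
  let ?g = "\<lambda>M. q @ sorted_list_of_multiset M @ r"
  have len: "size M \<le> length (?g M)" for M
    by (simp add: length_sorted_list_of_multiset)
  have zero: "red_matrix phi N p w = 0" if "p \<notin> words_upto (length w + 2 * N)" for p
    using that red_matrix_length[of phi N p w] by auto
  have "red_matrix phi (Suc N) (q @ b # a # r) w = (\<Sum>p\<in>?V. red_word phi (q @ b # a # r) p * red_matrix phi N p w)"
    unfolding red_matrix.simps using L zero
    by (intro sum.mono_neutral_left) auto
  also have "\<dots> = (\<Sum>p\<in>?V. of_bool (p = q @ a # b # r) * red_matrix phi N p w) +
      (\<Sum>p\<in>?V. fps_X * fps_const (\<Sum>M | p = ?g M. phi b a M) * red_matrix phi N p w)"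
    by (simp add: red_word_reducible[OF ab] distrib_right sum.distrib)
  also have "(\<Sum>p\<in>?V. of_bool (p = q @ a # b # r) * red_matrix phi N p w) = red_matrix phi N (q @ a # b # r) w"
  proof -
    have "(\<Sum>p\<in>?V. of_bool (p = q @ a # b # r) * red_matrix phi N p w) =
        (\<Sum>p\<in>?V. if p = q @ a # b # r then red_matrix phi N p w else 0)"
      by (rule sum.cong) auto
    then show ?thesis
      using zero[of "q @ a # b # r"] L by auto
  qed
  also have "(\<Sum>p\<in>?V. fps_X * fps_const (\<Sum>M | p = ?g M. phi b a M) * red_matrix phi N p w) =
      fps_X * (\<Sum>p\<in>?V. \<Sum>M | M \<in> {M \<in> ?M. ?g M \<in> ?V} \<and> ?g M = p. fps_const (phi b a M) * red_matrix phi N (?g M) w)"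
    unfolding sum_distrib_left
  proof (rule sum.cong[OF refl])
    fix p assume p: "p \<in> ?V"
    have "M \<in> ?M \<and> ?g M \<in> ?V" if "p = ?g M" for M
      using p len[of M] that by simp
    then have "{M. p = ?g M} = {M \<in> {M \<in> ?M. ?g M \<in> ?V}. ?g M = p}"
      by blast
    then have "fps_X * fps_const (\<Sum>M | p = ?g M. phi b a M) * red_matrix phi N p w =
       fps_X * (fps_const (\<Sum>M | M \<in> {M \<in> ?M. ?g M \<in> ?V} \<and> ?g M = p. phi b a M) * red_matrix phi N p w)"
      by (simp add: mult.assoc)
    also have "\<dots> = (\<Sum>M | M \<in> {M \<in> ?M. ?g M \<in> ?V} \<and> ?g M = p. fps_X * (fps_const (phi b a M) * red_matrix phi N (?g M) w))"
      unfolding fps_const_sum sum_distrib_left sum_distrib_right by (rule sum.cong) auto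
    finally show "fps_X * fps_const (\<Sum>M | p = ?g M. phi b a M) * red_matrix phi N p w = \<dots>" .
  qed
  also have "(\<Sum>p\<in>?V. \<Sum>M | M \<in> {M \<in> ?M. ?g M \<in> ?V} \<and> ?g M = p. fps_const (phi b a M) * red_matrix phi N (?g M) w) =
      (\<Sum>M\<in>{M \<in> ?M. ?g M \<in> ?V}. fps_const (phi b a M) * red_matrix phi N (?g M) w)"
    by (rule sum.group, rule finite_subset[OF _ finite_multisets_upto[of L]]) auto
  also have "\<dots> = (\<Sum>M\<in>?M. fps_const (phi b a M) * red_matrix phi N (?g M) w)"
  proof (rule sum.mono_neutral_left)
    have "red_matrix phi N (?g M) w = 0" if "?g M \<notin> ?V" for M
      using zero[of "?g M"] that L by simp
    then show "\<forall>M\<in>?M - {M \<in> ?M. ?g M \<in> ?V}. fps_const (phi b a M) * red_matrix phi N (?g M) w = 0"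
      by fastforce
  qed auto
  finally show ?thesis .
qed

lemma red_matrix_coefficient_length:
  assumes "fps_nth (red_matrix phi N p w) k \<noteq> 0"
  shows "length p \<le> length w + 2 * k"
  using assms
proof (induction N arbitrary: p k)
  case 0
  then show ?case
    by (cases "w = p") auto
next
  case (Suc N)
  show ?case
  proof (cases "sorted p")
    case True
    then show ?thesis
      using Suc.prems by (cases "w = p") (simp_all add: red_matrix_irreducible del: red_matrix.simps)
  next
    case False
    then obtain q b a r where p: "p = q @ b # a # r" "a < b" "sorted (a # r)"
      using rightmost_descent_exists[of "\<lambda>x. x" p] by auto
    let ?S = "\<Sum>M\<in>multisets_upto (length w + 2 * N). fps_const (phi b a M) *
      red_matrix phi N (q @ sorted_list_of_multiset M @ r) w"
    have "fps_nth (red_matrix phi N (q @ a # b # r) w) k \<noteq> 0 \<or> fps_nth (fps_X * ?S) k \<noteq> 0"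
      using Suc.prems unfolding p(1) red_matrix_reducible[OF p(2,3) order_refl] by (auto simp del: red_matrix.simps)
    then show ?thesis
    proof
      assume "fps_nth (red_matrix phi N (q @ a # b # r) w) k \<noteq> 0"
      then show ?thesis
        using Suc.IH p(1) by fastforce
    next
      assume "fps_nth (fps_X * ?S) k \<noteq> 0"
      then have k: "k \<noteq> 0" and "fps_nth ?S (k - 1) \<noteq> 0"
        by (auto split: if_splits)
      then obtain M where "fps_nth (red_matrix phi N (q @ sorted_list_of_multiset M @ r) w) (k - 1) \<noteq> 0"
        using sum.not_neutral_contains_not_neutral[of "\<lambda>M. phi b a M *
          fps_nth (red_matrix phi N (q @ sorted_list_of_multiset M @ r) w) (k - 1)"]
        by (force simp: fps_sum_nth)
      from Suc.IH[OF this] show ?thesis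
        using k p(1) by simp
    qed
  qed
qed

lemma fps_nth_of_bool: "fps_nth (of_bool B) k = of_bool (B \<and> k = 0)"
  by auto

text \<open>
  In the recursion for the matrix a use of \<open>phi\<close> carries a factor \<open>z\<close>, so that the coefficient of \<open>z^k\<close>
  satisfies the same recursion as the sums over the reductions with \<open>k\<close> uses. Only finitely many
  monomials matter for given \<open>k\<close> and final word, hence the number of steps after which the
  coefficient is stationary can be chosen for all of them.
\<close>

lemma red_matrix_coefficient:
  fixes phi :: "'x::{finite, linorder} \<Rightarrow> 'x \<Rightarrow> 'x multiset \<Rightarrow> 'b::comm_ring_1"
  shows "\<forall>\<^sub>F N in sequentially. fps_nth (red_matrix phi N (map fst p) w) k =
     run_sum phi k (\<lambda>p' P'. map fst p' = w) p P"
proof (induction k p P rule: reduction_induct)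
  case (irreducible k p P)
  then show ?case
    by (auto simp: red_matrix_irreducible run_sum_irreducible fps_nth_of_bool)
next
  case (reducible k q b e a e' r P)
  let ?Q = "\<lambda>p' P'. map fst p' = w"
  let ?s = "q @ (a, e') # (b, e) # r" and ?q = "map fst q" and ?r = "map fst r"
  let ?p = "\<lambda>M. q @ segment_factors (length P) M @ r"
  \<comment> \<open>From longer words, \<open>w\<close> cannot be reached with \<open>k\<close> uses of \<open>phi\<close>.\<close>
  define I where "I = (multisets_upto (length w + 2 * k) :: 'x multiset set)"
  have bound: "length_bound (length w) ?Q"
    by (auto simp: length_bound_def)
  have "\<forall>\<^sub>F N in sequentially. fps_nth (red_matrix phi (Suc N) (?q @ b # a # ?r) w) k =
     run_sum phi k ?Q (q @ (b, e) # (a, e') # r) P"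
  proof (cases k)
    case 0
    have "\<forall>\<^sub>F N in sequentially. fps_nth (red_matrix phi N (map fst ?s) w) k = run_sum phi k ?Q ?s P"
      by (rule reducible.IH(1))
    then show ?thesis
    proof eventually_elim
      case (elim N)
      then show ?case
        unfolding red_matrix_reducible[OF reducible.hyps(1,2) order_refl]
          run_sum_reducible[OF bound reducible.hyps(1,2) order_refl]
        using 0 by simp
    qed
  next
    case (Suc k')
    have IH: "\<forall>\<^sub>F N in sequentially. fps_nth (red_matrix phi N (map fst (?p M)) w) k' =
        run_sum phi k' ?Q (?p M) (apply_phi e e' M P)" for M
      by (rule reducible.IH(2)[OF Suc])
    have "\<forall>\<^sub>F N in sequentially. \<forall>M\<in>I. fps_nth (red_matrix phi N (map fst (?p M)) w) k' =
        run_sum phi k' ?Q (?p M) (apply_phi e e' M P)"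
      by (rule eventually_ball_finite) (use IH in \<open>auto simp: I_def\<close>)
    moreover have "\<forall>\<^sub>F N in sequentially. fps_nth (red_matrix phi N (map fst ?s) w) k = run_sum phi k ?Q ?s P"
      by (rule reducible.IH(1))
    moreover have "\<forall>\<^sub>F N in sequentially. k \<le> N"
      by (rule eventually_ge_at_top)
    ultimately show ?thesis
    proof eventually_elim
      case (elim N)
      let ?R = "\<lambda>M. red_matrix phi N (?q @ sorted_list_of_multiset M @ ?r) w"
      have "fps_nth (?R M) k' = 0" if "M \<notin> I" for M
        using red_matrix_coefficient_length[of phi N "?q @ sorted_list_of_multiset M @ ?r" w k'] that Suc
        by (force simp: I_def length_sorted_list_of_multiset)
      moreover have "I \<subseteq> multisets_upto (length w + 2 * N)"
        using elim(3) by (auto simp: I_def)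
      ultimately have "(\<Sum>M\<in>multisets_upto (length w + 2 * N). phi b a M * fps_nth (?R M) k') =
          (\<Sum>M\<in>I. phi b a M * fps_nth (?R M) k')"
        by (intro sum.mono_neutral_right) auto
      also have "\<dots> = (\<Sum>M\<in>I. phi b a M * run_sum phi k' ?Q (?p M) (apply_phi e e' M P))"
        using elim(1) by simp
      finally show ?case
        unfolding red_matrix_reducible[OF reducible.hyps(1,2) order_refl]
          run_sum_reducible[OF bound reducible.hyps(1,2) order_refl] I_def
        using elim(2) Suc by (simp add: fps_sum_nth)
    qed
  qed
  then show ?case
    by (subst (asm) eventually_sequentially_Suc) simp
qed

lemma sum_word_times:
  fixes h :: "'x::linorder list \<Rightarrow> 'b::comm_ring_1"
  assumes A: "finite A" "\<And>\<alpha>. \<alpha> \<notin> A \<Longrightarrow> F \<alpha> = 0" and B: "finite B" "\<And>\<beta>. \<beta> \<notin> B \<Longrightarrow> G \<beta> = 0"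
    and Z: "finite Z" "\<And>\<alpha> \<beta>. \<alpha> \<in> A \<Longrightarrow> \<beta> \<in> B \<Longrightarrow> sorted_list_of_multiset \<alpha> @ sorted_list_of_multiset \<beta> \<in> Z"
  shows "(\<Sum>p\<in>Z. word_times (section_map F) (section_map G) p * h p) =
    (\<Sum>\<alpha>\<in>A. \<Sum>\<beta>\<in>B. F \<alpha> * G \<beta> * h (sorted_list_of_multiset \<alpha> @ sorted_list_of_multiset \<beta>))"
proof -
  let ?s = "sorted_list_of_multiset :: 'x multiset \<Rightarrow> 'x list"
  let ?j = "\<lambda>(\<alpha>, \<beta>). (?s \<alpha>, ?s \<beta>)" and ?g = "\<lambda>(\<alpha>, \<beta>). ?s \<alpha> @ ?s \<beta>"
  have sF: "section_map F (?s \<alpha>) = F \<alpha>" and sG: "section_map G (?s \<alpha>) = G \<alpha>" for \<alpha>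
    by (simp_all add: section_map_def)
  have inj: "inj ?s"
    by (rule inj_on_inverseI[of _ mset]) simp
  have times: "word_times (section_map F) (section_map G) p = (\<Sum>(\<alpha>, \<beta>) | (\<alpha>, \<beta>) \<in> A \<times> B \<and> ?g (\<alpha>, \<beta>) = p. F \<alpha> * G \<beta>)" for p
  proof -
    let ?I = "{(\<alpha>, \<beta>). (\<alpha>, \<beta>) \<in> A \<times> B \<and> ?g (\<alpha>, \<beta>) = p}"
    have fin: "finite {(u, v). u @ v = p}"
    proof (rule finite_subset)
      show "{(u, v). u @ v = p} \<subseteq> (\<lambda>n. (take n p, drop n p)) ` {..length p}"
      proof
        fix x assume "x \<in> {(u, v). u @ v = p}"
        then obtain u v where x: "x = (u, v)" "p = u @ v"
          by auto
        show "x \<in> (\<lambda>n. (take n p, drop n p)) ` {..length p}"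
          unfolding x by (rule image_eqI[of _ _ "length u"]) auto
      qed
    qed simp
    define T where "T = ?j ` ?I"
    have "(\<Sum>(u, v) | u @ v = p. section_map F u * section_map G v) =
        (\<Sum>(u, v)\<in>T. section_map F u * section_map G v)"
    proof (rule sum.mono_neutral_right[OF fin])
      show "T \<subseteq> {(u, v). u @ v = p}"
        by (auto simp: T_def)
      have "section_map F u * section_map G v = 0" if uv: "u @ v = p" "(u, v) \<notin> T" for u v
      proof (cases "sorted u \<and> sorted v")
        case True
        then have s: "?s (mset u) = u" "?s (mset v) = v"
          by (simp_all add: sorted_sort_id)
        have "(mset u, mset v) \<notin> ?I"
        proof
          assume "(mset u, mset v) \<in> ?I"
          then have "(u, v) \<in> T"
            unfolding T_def by (rule rev_image_eqI) (simp add: True sorted_sort_id)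
          with uv(2) show False ..
        qed
        then have "mset u \<notin> A \<or> mset v \<notin> B"
          using uv(1) s by auto
        then show ?thesis
          using A(2) B(2) by (auto simp: section_map_def)
      qed (auto simp: section_map_def)
      then show "\<forall>x\<in>{(u, v). u @ v = p} - T. (case x of (u, v) \<Rightarrow> section_map F u * section_map G v) = 0"
        by auto
    qed
    also have "\<dots> = (\<Sum>(\<alpha>, \<beta>) | (\<alpha>, \<beta>) \<in> A \<times> B \<and> ?g (\<alpha>, \<beta>) = p. F \<alpha> * G \<beta>)"
    proof -
      have "inj ?j"
        by (rule injI) (auto simp: inj_eq[OF inj])
      then have "inj_on ?j ?I"
        by (rule inj_on_subset) simp
      then have "(\<Sum>(u, v)\<in>T. section_map F u * section_map G v) = (\<Sum>x\<in>?I. (case ?j x of (u, v) \<Rightarrow> section_map F u * section_map G v))"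
        unfolding T_def by (simp only: sum.reindex comp_def)
      also have "\<dots> = (\<Sum>(\<alpha>, \<beta>)\<in>?I. F \<alpha> * G \<beta>)"
        by (rule sum.cong[OF refl]) (simp add: sF sG split_def)
      finally show ?thesis .
    qed
    finally show ?thesis
      by (simp add: word_times_def)
  qed
  have "(\<Sum>p\<in>Z. word_times (section_map F) (section_map G) p * h p) =
      (\<Sum>p\<in>Z. \<Sum>x | x \<in> A \<times> B \<and> ?g x = p. (case x of (\<alpha>, \<beta>) \<Rightarrow> F \<alpha> * G \<beta> * h (?g x)))"
    unfolding times sum_distrib_right by (auto intro!: sum.cong)
  also have "\<dots> = (\<Sum>x\<in>A \<times> B. (case x of (\<alpha>, \<beta>) \<Rightarrow> F \<alpha> * G \<beta> * h (?g x)))"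
    by (rule sum.group) (use A B Z in auto)
  also have "\<dots> = (\<Sum>\<alpha>\<in>A. \<Sum>\<beta>\<in>B. F \<alpha> * G \<beta> * h (?s \<alpha> @ ?s \<beta>))"
    by (simp add: sum.cartesian_product split_def)
  finally show ?thesis .
qed

lemma algebra_map_zero: "algebra_map \<iota> \<Longrightarrow> \<iota> 0 = 0"
  unfolding algebra_map_def by (metis add_cancel_right_left)

lemma red_inf_eq:
  fixes phi :: "'x::{finite, linorder} \<Rightarrow> 'x \<Rightarrow> 'x multiset \<Rightarrow> 'b::comm_ring_1"
  assumes A: "finite A" "\<And>\<alpha>. \<alpha> \<notin> A \<Longrightarrow> F \<alpha> = 0" and B: "finite B" "\<And>\<beta>. \<beta> \<notin> B \<Longrightarrow> G \<beta> = 0"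
  shows "fps_nth (red_inf phi (\<lambda>w. fps_const (word_times (section_map F) (section_map G) w)) w) k =
    (\<Sum>\<alpha>\<in>A. \<Sum>\<beta>\<in>B. F \<alpha> * G \<beta> *
       run_sum phi k (\<lambda>p' P'. map fst p' = w) (start_word \<alpha> \<beta>) (start_picture \<alpha> \<beta>))"
proof -
  let ?W = "\<lambda>w. fps_const (word_times (section_map F) (section_map G) w)"
  let ?g = "\<lambda>\<alpha> \<beta>. sorted_list_of_multiset \<alpha> @ sorted_list_of_multiset \<beta>"
  define S where "S k = (\<Sum>\<alpha>\<in>A. \<Sum>\<beta>\<in>B. F \<alpha> * G \<beta> *
       run_sum phi k (\<lambda>p' P'. map fst p' = w) (start_word \<alpha> \<beta>) (start_picture \<alpha> \<beta>))" for k
  obtain L where L: "\<And>\<alpha> \<beta>. \<alpha> \<in> A \<Longrightarrow> \<beta> \<in> B \<Longrightarrow> length (?g \<alpha> \<beta>) \<le> L"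
  proof -
    have "finite ((\<lambda>(\<alpha>, \<beta>). length (?g \<alpha> \<beta>)) ` (A \<times> B))"
      using A B by simp
    from finite_nat_set_iff_bounded_le[THEN iffD1, OF this]
    obtain L where "\<forall>n\<in>(\<lambda>(\<alpha>, \<beta>). length (?g \<alpha> \<beta>)) ` (A \<times> B). n \<le> L" ..
    then show ?thesis
      by (intro that[of L]) fastforce
  qed
  have coeff: "fps_nth ((red phi ^^ N) ?W w) k =
      (\<Sum>\<alpha>\<in>A. \<Sum>\<beta>\<in>B. F \<alpha> * G \<beta> * fps_nth (red_matrix phi N (?g \<alpha> \<beta>) w) k)" for N k
  proof -
    let ?L = "L + (length w + 2 * N)"
    have "fps_nth ((red phi ^^ N) ?W w) k =
        (\<Sum>p\<in>words_upto ?L. word_times (section_map F) (section_map G) p * fps_nth (red_matrix phi N p w) k)"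
      by (subst red_power[of w N ?L]) (simp_all add: fps_sum_nth)
    also have "\<dots> = (\<Sum>\<alpha>\<in>A. \<Sum>\<beta>\<in>B. F \<alpha> * G \<beta> * fps_nth (red_matrix phi N (?g \<alpha> \<beta>) w) k)"
      by (rule sum_word_times) (use A B L in \<open>auto simp: trans_le_add1\<close>)
    finally show ?thesis .
  qed
  have "(\<lambda>N. (red phi ^^ N) ?W w) \<longlonglongrightarrow> Abs_fps S"
  proof (rule tendsto_fpsI)
    fix k
    have "\<forall>\<^sub>F N in sequentially. \<forall>x\<in>A \<times> B. fps_nth (red_matrix phi N (?g (fst x) (snd x)) w) k =
       run_sum phi k (\<lambda>p' P'. map fst p' = w) (start_word (fst x) (snd x)) (start_picture (fst x) (snd x))"
    proof (rule eventually_ball_finite)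
      show "\<forall>x\<in>A \<times> B. \<forall>\<^sub>F N in sequentially. fps_nth (red_matrix phi N (?g (fst x) (snd x)) w) k =
       run_sum phi k (\<lambda>p' P'. map fst p' = w) (start_word (fst x) (snd x)) (start_picture (fst x) (snd x))"
      proof
        fix x
        show "\<forall>\<^sub>F N in sequentially. fps_nth (red_matrix phi N (?g (fst x) (snd x)) w) k =
          run_sum phi k (\<lambda>p' P'. map fst p' = w) (start_word (fst x) (snd x)) (start_picture (fst x) (snd x))"
          using red_matrix_coefficient[of phi "start_word (fst x) (snd x)" w k "start_picture (fst x) (snd x)"]
          by simp
      qed
    qed (use A B in simp)
    then show "\<forall>\<^sub>F N in sequentially. fps_nth ((red phi ^^ N) ?W w) k = fps_nth (Abs_fps S) k"
      by eventually_elim (simp add: coeff S_def)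
  qed
  then have "red_inf phi ?W w = Abs_fps S"
    unfolding red_inf_def by (rule limI)
  then show ?thesis
    by (simp add: S_def)
qed

text \<open>
  Each of the \<open>k\<close> uses of \<open>phi\<close> contributes a factor in \<open>m\<close>, which is what makes the evaluation at
  \<open>z = 1\<close> converge. The projection to \<open>A\<close> collects the final words with a given monomial.
\<close>

theorem star_has_adic_sum:
  fixes phi :: "'x::{finite, linorder} \<Rightarrow> 'x \<Rightarrow> 'x multiset \<Rightarrow> 'b::comm_ring_1"
    and \<iota> :: "'k::field \<Rightarrow> 'b"
  assumes \<iota>: "algebra_map \<iota>" and m: "complete_local_noetherian m" and phi: "cochain m phi"
  shows "has_adic_sum m (\<lambda>k M. \<Sum>\<alpha>\<in>Poly_Mapping.keys f. \<Sum>\<beta>\<in>Poly_Mapping.keys g.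
      \<iota> (Poly_Mapping.lookup f \<alpha> * Poly_Mapping.lookup g \<beta>) *
      run_sum phi k (\<lambda>p' P'. mset (map fst p') = M) (start_word \<alpha> \<beta>) (start_picture \<alpha> \<beta>))
    (star \<iota> m phi f g)"
proof -
  let ?A = "Poly_Mapping.keys f" and ?B = "Poly_Mapping.keys g"
  let ?F = "scalar_ext \<iota> f" and ?G = "scalar_ext \<iota> g"
  let ?W = "\<lambda>w. fps_const (word_times (section_map ?F) (section_map ?G) w)"
  define a where "a k w = fps_nth (red_inf phi ?W w) k" for k w
  have ideal: "is_ideal m"
    by (rule maximal_is_ideal[OF m])
  have a: "a k w = (\<Sum>\<alpha>\<in>?A. \<Sum>\<beta>\<in>?B. ?F \<alpha> * ?G \<beta> *
       run_sum phi k (\<lambda>p' P'. map fst p' = w) (start_word \<alpha> \<beta>) (start_picture \<alpha> \<beta>))" for k w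
    unfolding a_def using algebra_map_zero[OF \<iota>]
    by (intro red_inf_eq) (auto simp: scalar_ext_def in_keys_iff)
  have "(\<lambda>w. run_sum phi k (\<lambda>p' P'. map fst p' = w) p P) \<in> ctensor m k" for k p P
    using run_sum_ctensor[OF ideal phi, of length "map fst" k "\<lambda>p P. True"] by simp
  then have "a k \<in> ctensor m k" for k
    unfolding a[abs_def] by (intro ctensor_sum ctensor_scale)
  then obtain s where s: "has_adic_sum m a s"
    using has_adic_sum_exists[OF m] by blast
  have "eval_at_one m (red_inf phi ?W) = s"
    unfolding eval_at_one_def a_def[abs_def, symmetric]
    by (rule the_equality[where P = "has_adic_sum m a", OF s]) (rule has_adic_sum_unique[OF m _ s])
  then have "star \<iota> m phi f g = projection s"
    unfolding star_def by simp
  moreover have "projection (a k) = (\<lambda>M. \<Sum>\<alpha>\<in>?A. \<Sum>\<beta>\<in>?B.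
      \<iota> (Poly_Mapping.lookup f \<alpha> * Poly_Mapping.lookup g \<beta>) *
      run_sum phi k (\<lambda>p' P'. mset (map fst p') = M) (start_word \<alpha> \<beta>) (start_picture \<alpha> \<beta>))" for k
  proof
    fix M
    have "run_sum phi k (\<lambda>p' P'. mset (map fst p') = M) p P =
        (\<Sum>w | mset w = M. run_sum phi k (\<lambda>p' P'. map fst p' = w) p P)" for p P
    proof -
      have "length_bound (size M) (\<lambda>(p' :: 'x tracked) P'. mset (map fst p') = M)"
        by (auto simp: length_bound_def simp del: mset_map)
      then have "run_sum phi k (\<lambda>p' P'. mset (map fst p') = M) p P =
        (\<Sum>w | mset w = M. run_sum phi k (\<lambda>p' P'. mset (map fst p') = M \<and> map fst p' = w) p P)"
        by (rule run_sum_partition) (simp_all add: finite_words_with_content)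
      also have "\<dots> = (\<Sum>w | mset w = M. run_sum phi k (\<lambda>p' P'. map fst p' = w) p P)"
        by (intro sum.cong refl run_sum_cong) auto
      finally show ?thesis .
    qed
    then show "projection (a k) M = (\<Sum>\<alpha>\<in>?A. \<Sum>\<beta>\<in>?B.
      \<iota> (Poly_Mapping.lookup f \<alpha> * Poly_Mapping.lookup g \<beta>) *
      run_sum phi k (\<lambda>p' P'. mset (map fst p') = M) (start_word \<alpha> \<beta>) (start_picture \<alpha> \<beta>))"
      using \<iota> unfolding projection_def a algebra_map_def
      by (simp add: sum_distrib_left scalar_ext_def sum.swap[of _ _ "{w. mset w = M}"] del: mset_map)
  qed
  ultimately show ?thesis
    using has_adic_sum_projection[OF s] by simp
qed


section \<open>The graphs of the reductions\<close>

abbreviation arrows :: "nat option list \<Rightarrow> nat list" where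
  "arrows \<equiv> List.map_filter (\<lambda>t. t)"

lemma arrows_simps [simp]:
  "arrows [] = []" "arrows (None # xs) = arrows xs" "arrows (Some n # xs) = n # arrows xs"
  "arrows (xs @ ys) = arrows xs @ arrows ys" "arrows (replicate k None) = []"
  by (simp_all add: List.map_filter_def)

lemma arrows_hit:
  assumes "i < length xs" "xs ! i = None"
  shows "arrows xs = arrows (take i xs) @ arrows (drop (Suc i) xs)"
    "arrows (xs[i := Some n]) = arrows (take i xs) @ [n] @ arrows (drop (Suc i) xs)"
proof -
  have "arrows xs = arrows (take i xs @ None # drop (Suc i) xs)"
    using id_take_nth_drop[OF assms(1)] assms(2) by simp
  then show "arrows xs = arrows (take i xs) @ arrows (drop (Suc i) xs)"
    by simp
  show "arrows (xs[i := Some n]) = arrows (take i xs) @ [n] @ arrows (drop (Suc i) xs)"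
    by (simp add: upd_conv_take_nth_drop[OF assms(1)])
qed

lemma length_diagram_of [simp]: "length (diagram_of P) = length P"
  by (simp add: diagram_of_def)

lemma diagram_of_nth [simp]: "v < length P \<Longrightarrow> diagram_of P ! v = arrows (P ! v)"
  by (simp add: diagram_of_def)

text \<open>
  The last condition is the reason why the two arrows of a new segment point to different segments:
  on each segment the remaining factors stay in increasing order, so that they never form a descent.
\<close>

definition wf_state :: "'x::linorder tracked \<Rightarrow> picture \<Rightarrow> bool" where
  "wf_state p P \<longleftrightarrow> diagram_of P \<in> diagrams \<and>
     (\<forall>(x, v, i)\<in>set p. v < length P \<and> i < length (P ! v) \<and> P ! v ! i = None) \<and>
     sorted_wrt (\<lambda>(x, v, i) (y, v', j). v = v' \<longrightarrow> i < j \<and> x \<le> y) p"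

lemma set_segment_factors:
  "(x, v, i) \<in> set (segment_factors n M) \<longleftrightarrow> v = n \<and> i < size M \<and> x = sorted_list_of_multiset M ! i"
  by (auto simp: segment_factors_def)

lemma sorted_segment_factors:
  "sorted_wrt (\<lambda>(x, v, i) (y, v', j). v = v' \<longrightarrow> i < j \<and> x \<le> y) (segment_factors n M)"
  by (auto simp: segment_factors_def sorted_wrt_iff_nth_less length_sorted_list_of_multiset
      intro!: sorted_nth_mono)

lemma wf_start: "wf_state (start_word \<alpha> \<beta>) (start_picture \<alpha> \<beta>)"
proof -
  have "diagram_of (start_picture \<alpha> \<beta>) = [[], []]"
    by (simp add: diagram_of_def)
  then show ?thesis
    unfolding wf_state_def using sorted_segment_factors[of 0 \<alpha>] sorted_segment_factors[of 1 \<beta>]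
    by (auto simp: diagrams.initial set_segment_factors sorted_wrt_append)
qed

lemma wf_state_descent:
  assumes "wf_state (q @ (b, v, i) # (a, v', j) # r) P" "a < b"
  shows "v \<noteq> v'"
  using assms by (auto simp: wf_state_def sorted_wrt_append)

lemma sorted_wrt_swap:
  "sorted_wrt R (q @ x # y # r) \<Longrightarrow> R y x \<Longrightarrow> sorted_wrt R (q @ y # x # r)"
  by (auto simp: sorted_wrt_append)

lemma wf_exchange:
  assumes "wf_state (q @ (b, e) # (a, e') # r) P" "a < b"
  shows "wf_state (q @ (a, e') # (b, e) # r) P"
proof -
  obtain v i v' j where e: "e = (v, i)" "e' = (v', j)"
    by (metis surj_pair)
  show ?thesis
    unfolding wf_state_def
  proof (intro conjI)
    show "sorted_wrt (\<lambda>(x, v, i) (y, v', j). v = v' \<longrightarrow> i < j \<and> x \<le> y) (q @ (a, e') # (b, e) # r)"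
      by (rule sorted_wrt_swap[of _ q "(b, e)" "(a, e')" r])
        (use assms wf_state_descent[of q b v i a v' j r P] in \<open>simp_all add: wf_state_def e\<close>)
  qed (use assms(1) in \<open>simp_all add: wf_state_def\<close>)
qed

lemma set_arrow_simp: "set_arrow n (v, i) P = P[v := (P ! v)[i := Some n]]"
  by (simp add: set_arrow_def)

lemma apply_phi_nth:
  assumes "v \<noteq> v'" "v < length P" "v' < length P" "u < length P"
  shows "apply_phi (v, i) (v', j) M P ! u =
    (if u = v then (P ! v)[i := Some (length P)] else if u = v' then (P ! v')[j := Some (length P)] else P ! u)"
  using assms by (simp add: set_arrow_simp nth_append)

text \<open>
  The arrows arriving at a segment are listed from left to right, so that hitting a point splits the
  list at this point, as in the rule which adds a segment.
\<close>

lemma diagram_apply_phi: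
  assumes D: "diagram_of P \<in> diagrams" and v: "v < length P" "i < length (P ! v)" "P ! v ! i = None"
    and v': "v' < length P" "j < length (P ! v')" "P ! v' ! j = None" and ne: "v \<noteq> v'"
  shows "diagram_of (apply_phi (v, i) (v', j) M P) \<in> diagrams"
proof -
  have "diagram_of (apply_phi (v, i) (v', j) M P) =
      (diagram_of P)[v' := arrows ((P ! v')[j := Some (length P)]), v := arrows ((P ! v)[i := Some (length P)])] @ [[]]"
    using ne by (simp add: set_arrow_simp diagram_of_def map_update)
  also have "\<dots> = (diagram_of P)
      [v' := arrows (take j (P ! v')) @ [length (diagram_of P)] @ arrows (drop (Suc j) (P ! v')),
       v := arrows (take i (P ! v)) @ [length (diagram_of P)] @ arrows (drop (Suc i) (P ! v))] @ [[]]"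
    using arrows_hit(2)[OF v(2,3), of "length P"] arrows_hit(2)[OF v'(2,3), of "length P"] by simp
  also have "\<dots> \<in> diagrams"
    using v v' ne arrows_hit(1)[OF v(2,3)] arrows_hit(1)[OF v'(2,3)]
    by (intro diagrams.add_segment[OF D]) auto
  finally show ?thesis .
qed

lemma wf_phi:
  assumes wf: "wf_state (q @ (b, e) # (a, e') # r) P" and ab: "a < b"
  shows "wf_state (q @ segment_factors (length P) M @ r) (apply_phi e e' M P)"
proof -
  obtain v i v' j where e: "e = (v, i)" "e' = (v', j)"
    by (metis surj_pair)
  have ne: "v \<noteq> v'"
    using wf_state_descent wf ab unfolding e by blast
  have v: "v < length P" "i < length (P ! v)" "P ! v ! i = None"
    and v': "v' < length P" "j < length (P ! v')" "P ! v' ! j = None" and D: "diagram_of P \<in> diagrams"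
    using wf unfolding e by (auto simp: wf_state_def)
  let ?R = "\<lambda>(x :: 'a, v :: nat, i :: nat) (y, v', j). v = v' \<longrightarrow> i < j \<and> x \<le> y"
  let ?P = "apply_phi e e' M P"
  have old: "u < length P \<and> l < length (P ! u) \<and> P ! u ! l = None \<and> (u, l) \<noteq> (v, i) \<and> (u, l) \<noteq> (v', j)"
    if "(x, u, l) \<in> set q \<union> set r" for x u l
  proof -
    have "(x, u, l) \<in> set (q @ (b, v, i) # (a, v', j) # r)"
      using that by auto
    then have "u < length P \<and> l < length (P ! u) \<and> P ! u ! l = None"
      using wf unfolding e wf_state_def by blast
    moreover have "sorted_wrt ?R (q @ (b, v, i) # (a, v', j) # r)"
      using wf unfolding e wf_state_def by blast
    then have "(u, l) \<noteq> (v, i) \<and> (u, l) \<noteq> (v', j)"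
      using that by (fastforce simp: sorted_wrt_append)
    ultimately show ?thesis
      by blast
  qed
  have free: "u < length ?P \<and> l < length (?P ! u) \<and> ?P ! u ! l = None" if "(x, u, l) \<in> set q \<union> set r" for x u l
    using old[OF that] v v' ne unfolding e by (simp add: apply_phi_nth) (auto simp: set_arrow_simp nth_append nth_list_update)
  have new: "?P ! length P = replicate (size M) None"
    using v v' unfolding e by (simp add: set_arrow_simp nth_append)
  have len: "length ?P = Suc (length P)"
    unfolding e by (simp add: set_arrow_simp)
  have "sorted_wrt ?R (q @ segment_factors (length P) M @ r)"
    using wf sorted_segment_factors[of "length P" M] old
    by (fastforce simp: wf_state_def sorted_wrt_append set_segment_factors)
  moreover have "\<forall>(x, u, l)\<in>set (q @ segment_factors (length P) M @ r). u < length ?P \<and> l < length (?P ! u) \<and> ?P ! u ! l = None"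
    using free new len by (fastforce simp: set_segment_factors)
  moreover have "diagram_of ?P \<in> diagrams"
    unfolding e by (rule diagram_apply_phi[OF D v v' ne])
  ultimately show ?thesis
    by (simp add: wf_state_def)
qed

lemma run_invariant:
  assumes "run phi ts (p, P, c) = Some (p', P', c')" and "Inv p P"
    and exchange: "\<And>q b e a e' r P. a < b \<Longrightarrow> Inv (q @ (b, e) # (a, e') # r) P \<Longrightarrow> Inv (q @ (a, e') # (b, e) # r) P"
    and phi: "\<And>q b e a e' r P M. a < b \<Longrightarrow> Inv (q @ (b, e) # (a, e') # r) P \<Longrightarrow>
      Inv (q @ segment_factors (length P) M @ r) (apply_phi e e' M P)"
  shows "Inv p' P'"
  using assms(1,2)
proof (induction ts arbitrary: p P c)
  case Nil
  then show ?case
    by (auto split: if_splits)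
next
  case (Cons t ts)
  show ?case
  proof (cases p rule: tracked_word_cases)
    case irreducible
    then show ?thesis
      using Cons.prems by (simp add: run_irreducible del: run.simps)
  next
    case (reducible q b e a e' r)
    have inv: "Inv (q @ (b, e) # (a, e') # r) P"
      using Cons.prems(2) unfolding reducible(1) .
    show ?thesis
      using Cons.prems(1) unfolding reducible(1) run_reducible[OF reducible(2,3)]
      by (cases t) (auto simp del: run.simps intro: Cons.IH exchange[OF reducible(2) inv] phi[OF reducible(2) inv])
  qed
qed

lemma run_wf:
  "run phi ts (p, P, c) = Some (p', P', c') \<Longrightarrow> wf_state p P \<Longrightarrow> wf_state p' P'"
  by (rule run_invariant[where Inv = wf_state]) (blast intro: wf_exchange wf_phi)+

lemma length_set_arrow [simp]: "length (set_arrow n e P) = length P"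
  by (cases e) (simp add: set_arrow_simp)

lemma run_length:
  "run phi ts (p, P, c) = Some (p', P', c') \<Longrightarrow> length P' = length P + phi_uses ts"
proof (induction ts arbitrary: p P c)
  case Nil
  then show ?case
    by (auto split: if_splits)
next
  case (Cons t ts)
  show ?case
  proof (cases p rule: tracked_word_cases)
    case irreducible
    then show ?thesis
      using Cons.prems by (simp add: run_irreducible del: run.simps)
  next
    case (reducible q b e a e' r)
    show ?thesis
      using Cons.prems(1) unfolding reducible(1) run_reducible[OF reducible(2,3)]
      by (cases t) (auto simp del: run.simps dest: Cons.IH)
  qed
qed

lemma run_segment_length:
  assumes "run phi ts (p, P, c) = Some (p', P', c')" "v < length P"
  shows "length (P' ! v) = length (P ! v)"
proof -
  have set_arrow: "length (set_arrow n e P ! v) = length (P ! v)" if "v < length P" for n e P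
    using that by (cases e; cases "fst e = v") (simp_all add: set_arrow_simp)
  have "v < length P' \<and> length (P' ! v) = length (P ! v)"
    by (rule run_invariant[OF assms(1), where Inv = "\<lambda>p' P'. v < length P' \<and> length (P' ! v) = length (P ! v)"])
      (use assms(2) in \<open>auto simp: nth_append set_arrow\<close>)
  then show ?thesis ..
qed

lemma run_arrow_persists:
  assumes "run phi ts (p, P, c) = Some (p', P', c')" "v < length P" "i < length (P ! v)" "P ! v ! i \<noteq> None"
  shows "P' ! v ! i \<noteq> None"
proof -
  let ?Inv = "\<lambda>P. v < length P \<and> i < length (P ! v) \<and> P ! v ! i \<noteq> None"
  have set_arrow: "?Inv (set_arrow n e P)" if "?Inv P" for n e P
    using that by (cases e; cases "fst e = v"; cases "snd e = i") (simp_all add: set_arrow_simp)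
  have "?Inv P'"
    by (rule run_invariant[OF assms(1), where Inv = "\<lambda>p' P'. ?Inv P'"])
      (use assms in \<open>simp, simp, metis (no_types, lifting) length_set_arrow set_arrow nth_append length_append less_SucI trans_less_add1\<close>)
  then show ?thesis
    by simp
qed

lemma run_monomials_diagram:
  assumes "run phi ts (start_word \<alpha> \<beta>, start_picture \<alpha> \<beta>, c) = Some (p, P, c')"
  shows "diagram_of P \<in> diagrams" "length P = phi_uses ts + 2"
  using run_wf[OF assms wf_start] run_length[OF assms] by (simp_all add: wf_state_def)

lemma occurring_graphs_subset: "occurring_graphs phi k \<subseteq> GC k"
proof
  fix G assume "G \<in> occurring_graphs phi k"
  then obtain P \<alpha> \<beta> ts p c where G: "G = diagram_iso k `` {diagram_of P}" "phi_uses ts = k"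
    and run: "run phi ts (start_word \<alpha> \<beta>, start_picture \<alpha> \<beta>, 1) = Some (p, P, c)"
    unfolding occurring_graphs_def run_monomials_def phi_uses_def by blast
  show "G \<in> GC k"
    unfolding G(1) GC_def using run_monomials_diagram[OF run] G(2) by (intro quotientI) simp
qed


section \<open>Diagrams and acyclic ordered graphs\<close>

definition segments_hit_by :: "diagram \<Rightarrow> nat \<Rightarrow> nat set" where
  "segments_hit_by D u = {v. v < length D \<and> u \<in> set (D ! v)}"

text \<open>
  A description of the diagrams without induction: each new segment has exactly two arrows, they
  point to different segments, and all arrows descend in the numbering of the segments.
\<close>

definition wf_diagram :: "diagram \<Rightarrow> bool" where
  "wf_diagram D \<longleftrightarrow> 2 \<le> length D \<and>
     (\<forall>v<length D. distinct (D ! v) \<and> (\<forall>u\<in>set (D ! v). v < u \<and> 2 \<le> u \<and> u < length D)) \<and>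
     (\<forall>u. 2 \<le> u \<and> u < length D \<longrightarrow> card (segments_hit_by D u) = 2)"

lemma wf_diagramD:
  assumes "wf_diagram D"
  shows "2 \<le> length D" "v < length D \<Longrightarrow> distinct (D ! v)"
    "v < length D \<Longrightarrow> u \<in> set (D ! v) \<Longrightarrow> v < u \<and> 2 \<le> u \<and> u < length D"
    "2 \<le> u \<Longrightarrow> u < length D \<Longrightarrow> card (segments_hit_by D u) = 2"
  using assms unfolding wf_diagram_def by blast+

lemma wf_diagram_if_diagrams:
  assumes "D \<in> diagrams"
  shows "wf_diagram D"
  using assms
proof induction
  case initial
  have "[[], [] :: nat list] ! v = []" if "v < Suc (Suc 0)" for v
    using that by (auto simp: less_Suc_eq)
  then show ?case
    by (simp add: wf_diagram_def)
next
  case (add_segment D v w xs ys us vs)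
  let ?n = "length D"
  define D' where "D' = D[v := xs @ [?n] @ ys, w := us @ [?n] @ vs] @ [[]]"
  have len: "length D' = Suc ?n"
    by (simp add: D'_def)
  have wf: "wf_diagram D"
    by (rule add_segment.IH)
  have nth: "D' ! z = (if z = w then us @ [?n] @ vs else if z = v then xs @ [?n] @ ys else D ! z)" if "z < ?n" for z
    using that add_segment.hyps by (simp add: D'_def nth_append)
  have last: "D' ! ?n = []"
    by (simp add: D'_def nth_append)
  have set: "set (D' ! z) = set (D ! z) \<union> (if z = v \<or> z = w then {?n} else {})" if "z < ?n" for z
    using nth[OF that] add_segment.hyps by auto
  have less: "u < ?n" if "z < ?n" "u \<in> set (D ! z)" for z u
    using wf_diagramD(3)[OF wf] that by blast
  have "distinct (D' ! z) \<and> (\<forall>u\<in>set (D' ! z). z < u \<and> 2 \<le> u \<and> u < length D')" if z: "z < length D'" for z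
  proof (cases "z = ?n")
    case False
    then have z: "z < ?n"
      using z len by simp
    have "distinct (D ! z)" "?n \<notin> set (D ! z)"
      using wf_diagramD(2)[OF wf z] less[OF z, of ?n] by auto
    then have "distinct (D' ! z)"
      using nth[OF z] add_segment.hyps by (auto split: if_splits)
    moreover have "z < u \<and> 2 \<le> u \<and> u < length D'" if "u \<in> set (D' ! z)" for u
      using that z wf_diagramD(3)[OF wf z, of u] wf_diagramD(1)[OF wf] len
      unfolding set[OF z] by (auto split: if_splits)
    ultimately show ?thesis
      by blast
  qed (simp add: last)
  moreover have "card (segments_hit_by D' u) = 2" if u: "2 \<le> u" "u < length D'" for u
  proof (cases "u = ?n")
    case True
    have "z \<in> segments_hit_by D' u \<longleftrightarrow> z \<in> {v, w}" for z
    proof (cases "z < ?n")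
      case True
      then show ?thesis
        using set[OF True] less[OF True, of ?n] \<open>u = ?n\<close> by (auto simp: segments_hit_by_def len)
    next
      case False
      then have "z \<notin> segments_hit_by D' u"
        using last by (cases "z = ?n") (auto simp: segments_hit_by_def len)
      then show ?thesis
        using False add_segment.hyps by auto
    qed
    then have "segments_hit_by D' u = {v, w}"
      by blast
    then show ?thesis
      using \<open>v \<noteq> w\<close> by simp
  next
    case False
    have "z \<in> segments_hit_by D' u \<longleftrightarrow> z \<in> segments_hit_by D u" for z
    proof (cases "z < ?n")
      case True
      then show ?thesis
        using set[OF True] False by (auto simp: segments_hit_by_def len)
    next
      case z: False
      then have "z \<notin> segments_hit_by D' u"
        using last by (cases "z = ?n") (auto simp: segments_hit_by_def len)
      then show ?thesis
        using z by (auto simp: segments_hit_by_def len)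
    qed
    then have "segments_hit_by D' u = segments_hit_by D u"
      by blast
    then show ?thesis
      using wf_diagramD(4)[OF wf] u False len by simp
  qed
  moreover have "2 \<le> length D'"
    using wf_diagramD(1)[OF wf] len by simp
  ultimately have "wf_diagram D'"
    unfolding wf_diagram_def by blast
  then show ?case
    by (simp add: D'_def)
qed

text \<open>
  Conversely, as all arrows descend, the last segment receives no arrow and can be removed; its two
  arrows point to different segments because it occurs in two of the lists.
\<close>

lemma diagrams_if_wf_diagram: "wf_diagram D \<Longrightarrow> D \<in> diagrams"
proof (induction "length D" arbitrary: D rule: less_induct)
  case less
  note wf = less.prems
  show ?case
  proof (cases "length D = 2")
    case True
    have "u \<notin> set (D ! v)" if "v < 2" for u v
      using wf_diagramD(3)[OF wf, of v u] that True by auto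
    then have "D ! v = []" if "v < 2" for v
      using that by (cases "D ! v") force+
    then have "D = [[], []]"
      using True by (intro nth_equalityI) (auto simp: less_2_cases_iff)
    then show ?thesis
      by (simp add: diagrams.initial)
  next
    case False
    define n where "n = length D - 1"
    have n: "length D = Suc n" "2 \<le> n"
      using wf_diagramD(1)[OF wf] False by (auto simp: n_def)
    define E where "E = butlast D"
    have entries: "v < u \<and> 2 \<le> u \<and> u < Suc n" if "v < Suc n" "u \<in> set (D ! v)" for u v
      using wf_diagramD(3)[OF wf, of v u] that n by simp
    have "u \<notin> set (D ! n)" for u
      using entries[of n u] by auto
    then have last: "D ! n = []"
      by (metis list.set_sel(1))
    have DE: "D = E @ [[]]"
      using n last unfolding E_def by (metis append_butlast_last_id last_conv_nth length_0_conv n_def nat.distinct(1))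
    have lenE: "length E = n"
      by (simp add: E_def n_def)
    have En: "E ! z = D ! z" if "z < n" for z
      using that lenE by (simp add: DE nth_append)
    have "card (segments_hit_by D n) = 2"
      using wf_diagramD(4)[OF wf] n by simp
    then obtain v w where vw: "segments_hit_by D n = {v, w}" "v \<noteq> w"
      by (auto simp: card_2_iff)
    have mem: "z = v \<or> z = w \<longleftrightarrow> z < n \<and> n \<in> set (D ! z)" for z
    proof -
      have "z = v \<or> z = w \<longleftrightarrow> z \<in> segments_hit_by D n"
        using vw(1) by simp
      also have "\<dots> \<longleftrightarrow> z < Suc n \<and> n \<in> set (D ! z)"
        by (simp add: segments_hit_by_def n(1))
      also have "\<dots> \<longleftrightarrow> z < n \<and> n \<in> set (D ! z)"
        using last by (cases "z = n") auto
      finally show ?thesis .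
    qed
    obtain xs ys where v: "D ! v = xs @ n # ys" "v < n"
      using mem[of v] split_list by fastforce
    obtain us vs where w: "D ! w = us @ n # vs" "w < n"
      using mem[of w] split_list by fastforce
    define F where "F = E[v := xs @ ys, w := us @ vs]"
    have lenF: "length F = n"
      by (simp add: F_def lenE)
    have Fn: "F ! z = (if z = w then us @ vs else if z = v then xs @ ys else D ! z)" if "z < n" for z
      using that by (simp add: F_def lenE nth_list_update En)
    have dist: "distinct (D ! z)" if "z < n" for z
      using wf_diagramD(2)[OF wf] that n by simp
    have set: "set (F ! z) = set (D ! z) - {n}" if "z < n" for z
      using Fn[OF that] dist[OF that] mem[of z] that v w vw(2) by auto
    have "distinct (F ! z) \<and> (\<forall>u\<in>set (F ! z). z < u \<and> 2 \<le> u \<and> u < length F)" if "z < length F" for z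
    proof
      have z: "z < n"
        using that lenF by simp
      show "distinct (F ! z)"
        using Fn[OF z] dist[OF z] v w vw(2) by auto
      show "\<forall>u\<in>set (F ! z). z < u \<and> 2 \<le> u \<and> u < length F"
        using entries[of z] z unfolding set[OF z] lenF by fastforce
    qed
    moreover have "card (segments_hit_by F u) = 2" if u: "2 \<le> u" "u < length F" for u
    proof -
      have "segments_hit_by F u = segments_hit_by D u"
        using u last n set by (auto simp: segments_hit_by_def lenF less_Suc_eq)
      then show ?thesis
        using wf_diagramD(4)[OF wf] u n lenF by simp
    qed
    moreover have "2 \<le> length F"
      using n lenF by simp
    ultimately have "wf_diagram F"
      unfolding wf_diagram_def by blast
    then have "F \<in> diagrams"
      using less.hyps[of F] n lenF by simp
    then have "F[v := xs @ [length F] @ ys, w := us @ [length F] @ vs] @ [[]] \<in> diagrams"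
      by (rule diagrams.add_segment) (use v w vw Fn lenF in auto)
    also have "F[v := xs @ [length F] @ ys, w := us @ [length F] @ vs] = E"
      using Fn En v w vw(2) by (intro nth_equalityI) (auto simp: lenF lenE nth_list_update)
    finally show ?thesis
      by (simp add: DE)
  qed
qed

lemma wf_diagram_length_segment:
  assumes "wf_diagram D" "v < length D"
  shows "length (D ! v) \<le> length D - 2"
proof -
  have "set (D ! v) \<subseteq> {2..<length D}"
  proof
    fix u assume "u \<in> set (D ! v)"
    then show "u \<in> {2..<length D}"
      using wf_diagramD(3)[OF assms, of u] by simp
  qed
  then have "card (set (D ! v)) \<le> card {2..<length D}"
    by (intro card_mono) auto
  then show ?thesis
    using wf_diagramD(2)[OF assms] by (simp add: distinct_card)
qed

lemma finite_GC: "finite (GC k)"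
proof -
  let ?L = "{xs. set xs \<subseteq> {..<k + 2} \<and> length xs \<le> k}"
  have "{D \<in> diagrams. length D = k + 2} \<subseteq> {D. set D \<subseteq> ?L \<and> length D = k + 2}"
  proof
    fix D assume "D \<in> {D \<in> diagrams. length D = k + 2}"
    then have D: "D \<in> diagrams" "length D = k + 2"
      by simp_all
    have wf: "wf_diagram D"
      by (rule wf_diagram_if_diagrams[OF D(1)])
    have "D ! v \<in> ?L" if "v < length D" for v
      using wf_diagram_length_segment[OF wf that] wf_diagramD(3)[OF wf that] D(2) by auto
    then show "D \<in> {D. set D \<subseteq> ?L \<and> length D = k + 2}"
      using D(2) unfolding set_conv_nth by blast
  qed
  moreover have "finite {D. set D \<subseteq> ?L \<and> length D = k + 2}"
    by (intro finite_lists_length_eq finite_lists_length_le) simp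
  ultimately have "finite {D \<in> diagrams. length D = k + 2}"
    by (rule finite_subset)
  then show ?thesis
    by (simp add: GC_def quotient_def)
qed

lemma permutes_less_iff:
  assumes "h permutes {2..<k + 2}"
  shows "h v < k + 2 \<longleftrightarrow> v < k + 2" and "2 \<le> h v \<longleftrightarrow> 2 \<le> v"
proof -
  have "h v \<in> {2..<k + 2} \<longleftrightarrow> v \<in> {2..<k + 2}"
    by (rule permutes_in_image[OF assms])
  moreover have "v \<notin> {2..<k + 2} \<Longrightarrow> h v = v"
    using assms by (simp add: permutes_not_in)
  ultimately show "h v < k + 2 \<longleftrightarrow> v < k + 2" "2 \<le> h v \<longleftrightarrow> 2 \<le> v"
    by (cases "v \<in> {2..<k + 2}"; force)+
qed

lemma length_relabel_diagram [simp]: "length (relabel_diagram h D) = length D"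
  by (simp add: relabel_diagram_def)

lemma relabel_diagram_nth: "v < length D \<Longrightarrow> relabel_diagram h D ! v = map h (D ! inv h v)"
  by (simp add: relabel_diagram_def)

lemma relabel_diagram_comp:
  assumes D: "length D = k + 2" and h: "h permutes {2..<k + 2}" and g: "g permutes {2..<k + 2}"
  shows "relabel_diagram h (relabel_diagram g D) = relabel_diagram (h \<circ> g) D"
proof (rule nth_equalityI)
  fix v assume "v < length (relabel_diagram h (relabel_diagram g D))"
  then have v: "v < length D"
    by simp
  have "inv h v < length D"
    using v permutes_less_iff(1)[OF permutes_inv[OF h]] D by simp
  moreover have "inv (h \<circ> g) = inv g \<circ> inv h"
    using h g by (intro o_inv_distrib) (simp_all add: permutes_bij)
  ultimately show "relabel_diagram h (relabel_diagram g D) ! v = relabel_diagram (h \<circ> g) D ! v"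
    using v by (simp add: relabel_diagram_nth)
qed simp

lemma relabel_diagram_id: "relabel_diagram id D = D"
  by (rule nth_equalityI) (simp_all add: relabel_diagram_nth inv_id[unfolded id_def] id_def)

lemma diagram_iso_class: "diagram_iso k `` {D} = {relabel_diagram h D | h. h permutes {2..<k + 2}}"
  by (auto simp: diagram_iso_def)

lemma diagram_iso_class_relabel:
  assumes D: "length D = k + 2" and h: "h permutes {2..<k + 2}"
  shows "diagram_iso k `` {relabel_diagram h D} = diagram_iso k `` {D}"
proof -
  have sub: "diagram_iso k `` {relabel_diagram g E} \<subseteq> diagram_iso k `` {E}"
    if "length E = k + 2" "g permutes {2..<k + 2}" for g E
    unfolding diagram_iso_class using relabel_diagram_comp[OF that(1) _ that(2)] permutes_compose[OF that(2)]
    by auto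
  have "relabel_diagram (inv h) (relabel_diagram h D) = D"
    using relabel_diagram_comp[OF D permutes_inv[OF h] h] relabel_diagram_id permutes_inv_o(2)[OF h] by simp
  then have "diagram_iso k `` {D} \<subseteq> diagram_iso k `` {relabel_diagram h D}"
    using sub[of "relabel_diagram h D" "inv h"] D permutes_inv[OF h] by simp
  then show ?thesis
    using sub[OF D h] by blast
qed

lemma GC_class_iff:
  assumes G: "G \<in> GC k" and D: "length D = k + 2"
  shows "D \<in> G \<longleftrightarrow> diagram_iso k `` {D} = G"
proof -
  obtain D0 where D0: "G = diagram_iso k `` {D0}" "length D0 = k + 2"
    using G by (auto simp: GC_def elim!: quotientE)
  have "D \<in> diagram_iso k `` {D}"
    unfolding diagram_iso_class using relabel_diagram_id permutes_id by (metis (mono_tags, lifting) mem_Collect_eq)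
  moreover have "diagram_iso k `` {D} = diagram_iso k `` {D0}" if mem: "D \<in> diagram_iso k `` {D0}"
  proof -
    obtain h where "D = relabel_diagram h D0" "h permutes {2..<k + 2}"
      using mem unfolding diagram_iso_class by blast
    then show ?thesis
      using diagram_iso_class_relabel[OF D0(2)] by simp
  qed
  ultimately show ?thesis
    unfolding D0(1) by blast
qed

lemma GC_length: "G \<in> GC k \<Longrightarrow> D \<in> G \<Longrightarrow> length D = k + 2"
  by (auto simp: GC_def diagram_iso_def elim!: quotientE)

lemma image_setcompr2: "f ` {g i j | i j. P i j} = {f (g i j) | i j. P i j}"
  by blast

lemma contract_relabel:
  assumes D: "length D = k + 2" and h: "h permutes {2..<k + 2}"
  shows "contract (relabel_diagram h D) = relabel_graph h (contract D)"
proof -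
  have inv: "inv h (h v) = v" "h (inv h v) = v" for v
    using permutes_inverses[OF h] by simp_all
  have less: "inv h v < length D \<longleftrightarrow> v < length D" for v
    using permutes_less_iff(1)[OF permutes_inv[OF h]] D by simp
  have E: "{(u, v). v < length D \<and> u \<in> set (relabel_diagram h D ! v)} =
      map_prod h h ` {(u, v). v < length D \<and> u \<in> set (D ! v)}"
  proof (rule set_eqI)
    fix e :: "nat \<times> nat"
    obtain u v where e: "e = (u, v)"
      by (cases e)
    have "e \<in> map_prod h h ` {(u, v). v < length D \<and> u \<in> set (D ! v)} \<longleftrightarrow>
      (\<exists>u' v'. u = h u' \<and> v = h v' \<and> v' < length D \<and> u' \<in> set (D ! v'))"
      unfolding e by (auto simp: image_iff)
    also have "\<dots> \<longleftrightarrow> (\<exists>u'. u = h u' \<and> v < length D \<and> u' \<in> set (D ! inv h v))"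
      using inv less by metis
    also have "\<dots> \<longleftrightarrow> e \<in> {(u, v). v < length D \<and> u \<in> set (relabel_diagram h D ! v)}"
      unfolding e by (auto simp: relabel_diagram_nth)
    finally show "e \<in> {(u, v). v < length D \<and> u \<in> set (relabel_diagram h D ! v)} \<longleftrightarrow>
      e \<in> map_prod h h ` {(u, v). v < length D \<and> u \<in> set (D ! v)}"
      by simp
  qed
  have O: "{((relabel_diagram h D ! v ! i, v), (relabel_diagram h D ! v ! j, v)) | i j.
        v < length D \<and> i < j \<and> j < length (relabel_diagram h D ! v)} =
      map_prod (map_prod h h) (map_prod h h) ` {((D ! inv h v ! i, inv h v), (D ! inv h v ! j, inv h v)) | i j.
        inv h v < length D \<and> i < j \<and> j < length (D ! inv h v)}" (is "?A = ?B") for v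
  proof (cases "v < length D")
    case True
    have "?B = {map_prod (map_prod h h) (map_prod h h) ((D ! inv h v ! i, inv h v), (D ! inv h v ! j, inv h v)) | i j.
        inv h v < length D \<and> i < j \<and> j < length (D ! inv h v)}"
      by (rule image_setcompr2)
    also have "\<dots> = {((h (D ! inv h v ! i), v), (h (D ! inv h v ! j), v)) | i j. i < j \<and> j < length (D ! inv h v)}"
      using True less inv by simp
    also have "\<dots> = ?A"
      by (rule Collect_cong, rule ex_cong1, rule ex_cong1) (use True in \<open>auto simp: relabel_diagram_nth\<close>)
    finally show ?thesis ..
  qed (simp add: less)
  show ?thesis
    unfolding contract_def relabel_graph_def using E O by simp
qed

lemma contract_class:
  assumes D: "length D = k + 2"
  shows "contract ` (diagram_iso k `` {D}) = graph_iso k `` {contract D}"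
proof -
  have "graph_iso k `` {contract D} = {relabel_graph h (contract D) | h. h permutes {2..<k + 2}}"
    unfolding graph_iso_def by blast
  also have "\<dots> = {contract (relabel_diagram h D) | h. h permutes {2..<k + 2}}"
    using contract_relabel[OF D] by (metis (no_types, lifting))
  also have "\<dots> = contract ` (diagram_iso k `` {D})"
    unfolding diagram_iso_class by blast
  finally show ?thesis ..
qed

text \<open>An element of a list without repetitions has as many elements before it as its position tells.\<close>

lemma distinct_lists_eqI:
  assumes xs: "distinct xs" and ys: "distinct ys" and set: "set xs = set ys"
    and order: "\<And>x y. (\<exists>i j. i < j \<and> j < length xs \<and> x = xs ! i \<and> y = xs ! j) \<longleftrightarrow>
      (\<exists>i j. i < j \<and> j < length ys \<and> x = ys ! i \<and> y = ys ! j)"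
  shows "xs = ys"
proof (rule nth_equalityI)
  show len: "length xs = length ys"
    using xs ys set by (metis distinct_card)
  have position: "card {x. \<exists>i j. i < j \<and> j < length zs \<and> x = zs ! i \<and> zs ! l = zs ! j} = l"
    if "distinct zs" "l < length zs" for zs :: "'a list" and l
  proof -
    have "{x. \<exists>i j. i < j \<and> j < length zs \<and> x = zs ! i \<and> zs ! l = zs ! j} = (!) zs ` {..<l}"
      using that nth_eq_iff_index_eq[OF that(1)] by auto
    moreover have "inj_on ((!) zs) {..<l}"
      using that by (intro inj_on_nth) auto
    ultimately show ?thesis
      by (simp add: card_image)
  qed
  fix l assume l: "l < length xs"
  then obtain l' where l': "l' < length ys" "ys ! l' = xs ! l"
    using set by (metis in_set_conv_nth)
  have "l = card {x. \<exists>i j. i < j \<and> j < length xs \<and> x = xs ! i \<and> xs ! l = xs ! j}"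
    using position[OF xs l] by simp
  also have "\<dots> = card {x. \<exists>i j. i < j \<and> j < length ys \<and> x = ys ! i \<and> xs ! l = ys ! j}"
    unfolding order ..
  also have "\<dots> = l'"
    using position[OF ys l'(1)] l'(2) by simp
  finally show "xs ! l = ys ! l"
    using l'(2) by simp
qed

text \<open>
  A list without repetitions is recovered from the sources of the arrows at the vertex and their order.
\<close>

lemma contract_inj:
  assumes D: "length D = n" "\<forall>v<n. distinct (D ! v)" and D': "length D' = n" "\<forall>v<n. distinct (D' ! v)"
    and eq: "contract D = contract D'"
  shows "D = D'"
proof (rule nth_equalityI)
  fix v assume "v < length D"
  then have v: "v < n"
    using D by simp
  have E: "{(u, v). v < n \<and> u \<in> set (D ! v)} = {(u, v). v < n \<and> u \<in> set (D' ! v)}"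
    using eq D D' by (simp add: contract_def)
  have "snd (contract D) v = snd (contract D') v"
    using eq by simp
  then have O: "{((D ! v ! i, v), (D ! v ! j, v)) | i j. i < j \<and> j < length (D ! v)} =
      {((D' ! v ! i, v), (D' ! v ! j, v)) | i j. i < j \<and> j < length (D' ! v)}"
    using v D D' by (simp add: contract_def)
  show "D ! v = D' ! v"
  proof (rule distinct_lists_eqI)
    show "set (D ! v) = set (D' ! v)"
      using E v by blast
    show "(\<exists>i j. i < j \<and> j < length (D ! v) \<and> x = D ! v ! i \<and> y = D ! v ! j) \<longleftrightarrow>
      (\<exists>i j. i < j \<and> j < length (D' ! v) \<and> x = D' ! v ! i \<and> y = D' ! v ! j)" for x y
    proof -
      have "((x, v), (y, v)) \<in> {((D ! v ! i, v), (D ! v ! j, v)) | i j. i < j \<and> j < length (D ! v)} \<longleftrightarrow>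
        ((x, v), (y, v)) \<in> {((D' ! v ! i, v), (D' ! v ! j, v)) | i j. i < j \<and> j < length (D' ! v)}"
        unfolding O ..
      then show ?thesis
        by auto
    qed
  qed (use v D D' in auto)
qed (use D D' in simp)

text \<open>Sorting the elements by the number of their predecessors gives a linear extension.\<close>

lemma topological_sort:
  assumes A: "finite A" and r: "acyclic r"
  obtains xs where "set xs = A" "distinct xs" "\<And>i j. j \<le> i \<Longrightarrow> i < length xs \<Longrightarrow> (xs ! i, xs ! j) \<notin> r"
proof -
  define rank where "rank x = card {y \<in> A. (y, x) \<in> r\<^sup>+}" for x
  obtain l where l: "set l = A" "distinct l"
    using finite_distinct_list[OF A] by blast
  define xs where "xs = sort_key rank l"
  have xs: "set xs = A" "distinct xs" "sorted (map rank xs)"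
    by (simp_all add: xs_def l)
  have less: "rank x < rank y" if "x \<in> A" "(x, y) \<in> r" for x y
    unfolding rank_def
  proof (rule psubset_card_mono)
    have "(x, x) \<notin> r\<^sup>+"
      using r by (simp add: acyclic_def)
    then show "{z \<in> A. (z, x) \<in> r\<^sup>+} \<subset> {z \<in> A. (z, y) \<in> r\<^sup>+}"
      using that by (auto intro: trancl_into_trancl)
  qed (use A in simp)
  have "(xs ! i, xs ! j) \<notin> r" if "j \<le> i" "i < length xs" for i j
  proof
    assume "(xs ! i, xs ! j) \<in> r"
    then have "rank (xs ! i) < rank (xs ! j)"
      using less that(2) xs(1) nth_mem by blast
    moreover have "rank (xs ! j) \<le> rank (xs ! i)"
      using sorted_nth_mono[OF xs(3) that(1)] that by simp
    ultimately show False
      by simp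
  qed
  then show thesis
    using that xs by blast
qed

lemma contract_acyclic_ordered:
  assumes wf: "wf_diagram D" and len: "length D = k + 2"
  shows "contract D \<in> acyclic_ordered_graphs k"
proof -
  define E where "E = {(u, v). v < length D \<and> u \<in> set (D ! v)}"
  define ord where "ord v = {((D ! v ! i, v), (D ! v ! j, v)) | i j. v < length D \<and> i < j \<and> j < length (D ! v)}" for v
  have entry: "v < u \<and> 2 \<le> u \<and> u < k + 2" if "(u, v) \<in> E" for u v
    using that wf_diagramD(3)[OF wf, of v u] len by (simp add: E_def)
  have sub: "E \<subseteq> {0..<k + 2} \<times> {0..<k + 2}"
    using entry by fastforce
  have fin: "finite E"
    using sub by (rule finite_subset) simp
  have out: "card {e \<in> E. fst e = u} = 2" if "u \<in> {2..<k + 2}" for u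
  proof -
    have "{e \<in> E. fst e = u} = Pair u ` segments_hit_by D u"
      by (auto simp: E_def segments_hit_by_def)
    then show ?thesis
      using wf_diagramD(4)[OF wf, of u] that len by (simp add: card_image inj_on_def)
  qed
  have "card E = (\<Sum>u\<in>{2..<k + 2}. card {e \<in> E. fst e = u})"
  proof -
    have "fst ` E \<subseteq> {2..<k + 2}"
      using entry by fastforce
    then show ?thesis
      using sum.group[OF fin, of "{2..<k + 2}" fst "\<lambda>_. 1 :: nat"] by simp
  qed
  also have "\<dots> = 2 * k"
    using out by simp
  finally have card: "card E = 2 * k" .
  have "E \<subseteq> less_than\<inverse>"
    using entry by fastforce
  then have acyclic: "acyclic E"
    by (rule acyclic_subset[OF acyclic_converse[THEN iffD2, OF wf_acyclic[OF wf_less_than]], rotated])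
  have "irrefl E"
    using entry by (force simp: irrefl_def)
  then have kontsevich: "kontsevich_graph k E"
    using sub card out by (simp add: kontsevich_graph_def)
  have order: "ord v \<subseteq> incoming E v \<times> incoming E v \<and> strict_linear_order_on (incoming E v) (ord v)" for v
  proof (cases "v < length D")
    case False
    then have "incoming E v = {}" "ord v = {}"
      by (auto simp: incoming_def E_def ord_def)
    then show ?thesis
      by (simp add: strict_linear_order_on_def irrefl_def total_on_def)
  next
    case True
    define xs where "xs = D ! v"
    have dist: "distinct xs"
      using wf_diagramD(2)[OF wf True] by (simp add: xs_def)
    have inc: "incoming E v = {(xs ! i, v) | i. i < length xs}"
      using True by (auto simp: incoming_def E_def xs_def in_set_conv_nth)
    have ord: "ord v = {((xs ! i, v), (xs ! j, v)) | i j. i < j \<and> j < length xs}"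
      using True by (auto simp: ord_def xs_def)
    have eq: "xs ! i = xs ! j \<longleftrightarrow> i = j" if "i < length xs" "j < length xs" for i j
      by (rule nth_eq_iff_index_eq[OF dist that])
    have "trans (ord v)"
    proof (rule transI)
      fix x y z assume "(x, y) \<in> ord v" "(y, z) \<in> ord v"
      then obtain i j i' j' where "x = (xs ! i, v)" "y = (xs ! j, v)" "i < j" "j < length xs"
        "y = (xs ! i', v)" "z = (xs ! j', v)" "i' < j'" "j' < length xs"
        unfolding ord by blast
      then show "(x, z) \<in> ord v"
        unfolding ord using eq[of j i'] by fastforce
    qed
    moreover have "irrefl (ord v)"
      unfolding ord irrefl_def using eq by fastforce
    moreover have "total_on (incoming E v) (ord v)"
    proof (rule total_onI)
      fix x y assume "x \<in> incoming E v" "y \<in> incoming E v" "x \<noteq> y"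
      then obtain i j where ij: "x = (xs ! i, v)" "y = (xs ! j, v)" "i < length xs" "j < length xs" "i \<noteq> j"
        unfolding inc by blast
      then show "(x, y) \<in> ord v \<or> (y, x) \<in> ord v"
        unfolding ord by (cases "i < j") (blast, metis (mono_tags, lifting) linorder_neqE_nat mem_Collect_eq)
    qed
    moreover have "ord v \<subseteq> incoming E v \<times> incoming E v"
      unfolding ord inc by fastforce
    ultimately show ?thesis
      by (simp add: strict_linear_order_on_def)
  qed
  show ?thesis
    using kontsevich acyclic order
    by (simp add: contract_def acyclic_ordered_graphs_def E_def[symmetric] ord_def[symmetric])
qed

text \<open>
  The order of the incoming edges at each vertex is written as a list. The numbering of the vertices
  is arbitrary here, so that the result becomes a diagram only after a renumbering.
\<close>

lemma contract_surj_lists: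
  assumes X: "X \<in> acyclic_ordered_graphs k"
  obtains D where "length D = k + 2" "contract D = X" "\<And>v. v < k + 2 \<Longrightarrow> distinct (D ! v)"
proof -
  obtain E ord where X_eq: "X = (E, ord)"
    by (cases X)
  have K: "kontsevich_graph k E"
    and ord: "\<And>v. ord v \<subseteq> incoming E v \<times> incoming E v" "\<And>v. strict_linear_order_on (incoming E v) (ord v)"
    using X by (simp_all add: X_eq acyclic_ordered_graphs_def)
  have sub: "E \<subseteq> {0..<k + 2} \<times> {0..<k + 2}"
    using K by (simp add: kontsevich_graph_def)
  then have fin: "finite E"
    by (rule finite_subset) simp
  have "\<exists>xs. distinct xs \<and> set xs = {u. (u, v) \<in> E} \<and>
      ord v = {((xs ! i, v), (xs ! j, v)) | i j. i < j \<and> j < length xs}" for v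
  proof -
    have so: "trans (ord v)" "irrefl (ord v)" "total_on (incoming E v) (ord v)"
      using ord(2)[of v] by (simp_all add: strict_linear_order_on_def)
    have "acyclic (ord v)"
      using so by (simp add: acyclic_irrefl)
    moreover have "finite (incoming E v)"
      using fin by (simp add: incoming_def)
    ultimately obtain es where es: "set es = incoming E v" "distinct es"
      "\<And>i j. j \<le> i \<Longrightarrow> i < length es \<Longrightarrow> (es ! i, es ! j) \<notin> ord v"
      using topological_sort by metis
    define xs where "xs = map fst es"
    have len: "length xs = length es"
      by (simp add: xs_def)
    have es_xs: "es ! i = (xs ! i, v)" if "i < length es" for i
      using nth_mem[OF that] that by (auto simp: es(1) incoming_def xs_def prod_eq_iff)
    have "inj_on fst (incoming E v)"
      by (auto simp: inj_on_def incoming_def)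
    then have "distinct xs"
      using es(1,2) by (simp add: xs_def distinct_map)
    moreover have "set xs = {u. (u, v) \<in> E}"
      by (auto simp: xs_def es(1) incoming_def image_iff)
    moreover have "ord v = {((xs ! i, v), (xs ! j, v)) | i j. i < j \<and> j < length xs}" (is "_ = ?O")
    proof
      show "ord v \<subseteq> ?O"
      proof
        fix e assume e: "e \<in> ord v"
        then have "fst e \<in> set es" "snd e \<in> set es"
          using ord(1)[of v] by (auto simp: es(1))
        then obtain i j where ij: "fst e = es ! i" "i < length es" "snd e = es ! j" "j < length es"
          by (metis in_set_conv_nth)
        then have "i < j"
          using es(3)[of j i] e by (metis linorder_not_le prod.collapse)
        moreover have "e = ((xs ! i, v), (xs ! j, v))"
          using ij es_xs by (metis prod.collapse)
        ultimately show "e \<in> ?O"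
          using ij(4) len by auto
      qed
      show "?O \<subseteq> ord v"
      proof
        fix e assume "e \<in> ?O"
        then obtain i j where e: "e = ((xs ! i, v), (xs ! j, v))" "i < j" "j < length es"
          using len by auto
        have "es ! i \<in> incoming E v" "es ! j \<in> incoming E v"
          using e by (simp_all flip: es(1))
        moreover have "es ! i \<noteq> es ! j"
          using es(2) e by (simp add: nth_eq_iff_index_eq)
        ultimately have "(es ! i, es ! j) \<in> ord v \<or> (es ! j, es ! i) \<in> ord v"
          using so(3) by (simp add: total_on_def)
        then have "(es ! i, es ! j) \<in> ord v"
          using es(3)[of i j] e by auto
        then show "e \<in> ord v"
          using e es_xs by simp
      qed
    qed
    ultimately show ?thesis
      by blast
  qed
  then have "\<exists>L. \<forall>v. distinct (L v) \<and> set (L v) = {u. (u, v) \<in> E} \<and>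
      ord v = {((L v ! i, v), (L v ! j, v)) | i j. i < j \<and> j < length (L v)}"
    by (intro choice allI)
  then obtain L where "\<forall>v. distinct (L v) \<and> set (L v) = {u. (u, v) \<in> E} \<and>
      ord v = {((L v ! i, v), (L v ! j, v)) | i j. i < j \<and> j < length (L v)}" ..
  then have L: "distinct (L v)" "set (L v) = {u. (u, v) \<in> E}"
    "ord v = {((L v ! i, v), (L v ! j, v)) | i j. i < j \<and> j < length (L v)}" for v
    by blast+
  define D where "D = map L [0..<k + 2]"
  have D: "length D = k + 2" "D ! v = L v" if "v < k + 2" for v
    using that by (simp_all add: D_def del: upt_Suc)
  have len: "length D = k + 2"
    by (simp add: D_def)
  have "{(u, v). v < length D \<and> u \<in> set (D ! v)} = E"
    using sub by (auto simp: len D(2) L(2))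
  moreover have "{((D ! v ! i, v), (D ! v ! j, v)) | i j. v < length D \<and> i < j \<and> j < length (D ! v)} = ord v" for v
  proof (cases "v < k + 2")
    case True
    then show ?thesis
      unfolding L(3)[of v] by (simp add: len D(2))
  next
    case False
    then have "L v = []"
      using sub L(2)[of v] by (auto simp flip: set_empty)
    then show ?thesis
      unfolding L(3)[of v] using False by (simp add: len)
  qed
  ultimately have "contract D = X"
    by (simp add: contract_def X_eq)
  then show thesis
    using that[OF len] D(2) L(1) by simp
qed

text \<open>
  As the graph is acyclic, its vertices of first type can be numbered so that all arrows descend.
\<close>

lemma renumbered_diagram:
  assumes D: "length D = k + 2" "\<And>v. v < k + 2 \<Longrightarrow> distinct (D ! v)"
    and X: "contract D \<in> acyclic_ordered_graphs k"
  obtains h where "h permutes {2..<k + 2}" "relabel_diagram h D \<in> diagrams"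
proof -
  define E where "E = fst (contract D)"
  have E: "(u, v) \<in> E \<longleftrightarrow> v < k + 2 \<and> u \<in> set (D ! v)" for u v
    by (simp add: E_def contract_def D(1))
  have K: "kontsevich_graph k E" and acyclic: "acyclic E"
    using X by (auto simp: E_def acyclic_ordered_graphs_def)
  have sub: "E \<subseteq> {0..<k + 2} \<times> {0..<k + 2}" and card: "card E = 2 * k"
    and out: "\<And>u. u \<in> {2..<k + 2} \<Longrightarrow> card {e \<in> E. fst e = u} = 2"
    using K by (simp_all add: kontsevich_graph_def)
  have fin: "finite E"
    using sub by (rule finite_subset) simp
  \<comment> \<open>All \<open>2 k\<close> arrows start at the vertices of first type, so that none starts at \<open>0\<close> or \<open>1\<close>.\<close>
  have first_type: "2 \<le> u \<and> u < k + 2" if "(u, v) \<in> E" for u v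
  proof -
    let ?F = "{e \<in> E. fst e \<in> {2..<k + 2}}"
    have "card ?F = (\<Sum>u\<in>{2..<k + 2}. card {e \<in> ?F. fst e = u})"
      using sum.group[of ?F "{2..<k + 2}" fst "\<lambda>_. 1 :: nat"] fin by fastforce
    also have "\<dots> = (\<Sum>u\<in>{2..<k + 2}. card {e \<in> E. fst e = u})"
      by (intro sum.cong refl arg_cong[where f = card]) auto
    also have "\<dots> = card E"
      using out card by simp
    finally have "?F = E"
      using fin by (intro card_subset_eq) auto
    then have "(u, v) \<in> ?F"
      using that by simp
    then show ?thesis
      by simp
  qed
  have "acyclic (E\<inverse>)"
    using acyclic by (simp add: acyclic_converse)
  then obtain xs where xs: "set xs = {2..<k + 2}" "distinct xs"
    "\<And>i j. j \<le> i \<Longrightarrow> i < length xs \<Longrightarrow> (xs ! i, xs ! j) \<notin> E\<inverse>"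
    using topological_sort[of "{2..<k + 2}"] by (metis finite_atLeastLessThan)
  have len: "length xs = k"
    using distinct_card[OF xs(2)] by (simp add: xs(1))
  \<comment> \<open>The vertices of first type are listed from the place \<open>2\<close> on in the topological order.\<close>
  define g where "g v = (if v \<in> {2..<k + 2} then xs ! (v - 2) else v)" for v
  have "bij_betw g {2..<k + 2} {2..<k + 2}"
  proof -
    have "bij_betw (\<lambda>v. v - 2) {2..<k + 2} {..<length xs}"
      by (rule bij_betwI[of _ _ _ "\<lambda>v. v + 2"]) (auto simp: len)
    from bij_betw_trans[OF this bij_betw_nth[OF xs(2) refl xs(1)[symmetric]]]
    show ?thesis
      by (rule bij_betw_cong[THEN iffD1, rotated]) (simp add: g_def)
  qed
  then have g: "g permutes {2..<k + 2}"
    by (rule bij_imp_permutes) (auto simp: g_def)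
  define h where "h = inv g"
  have h: "h permutes {2..<k + 2}"
    unfolding h_def by (rule permutes_inv[OF g])
  have inv: "inv h = g" "h (g v) = v" "g (h v) = v" for v
    using permutes_inverses[OF g] permutes_inv_inv[OF g] by (simp_all add: h_def)
  define D' where "D' = relabel_diagram h D"
  have len': "length D' = k + 2"
    by (simp add: D'_def D(1))
  have g_less: "g v < k + 2 \<longleftrightarrow> v < k + 2" "2 \<le> g v \<longleftrightarrow> 2 \<le> v" for v
    using permutes_less_iff[OF g] by simp_all
  have nth: "D' ! v = map h (D ! g v)" if "v < k + 2" for v
    using that by (simp add: D'_def relabel_diagram_nth D(1) inv)
  have arrow: "u \<in> set (D' ! v) \<longleftrightarrow> (g u, g v) \<in> E" if "v < k + 2" for u v
    using that g_less inv unfolding nth[OF that] E by (auto simp: image_iff) metis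
  have descend: "v < u" if uv: "(g u, g v) \<in> E" for u v
  proof (rule ccontr)
    assume "\<not> v < u"
    have u: "2 \<le> u" "u < k + 2" "v < k + 2"
      using first_type[OF uv] sub uv g_less by auto
    then have "g u = xs ! (u - 2)" "g v = xs ! (v - 2)"
      using \<open>\<not> v < u\<close> by (simp_all add: g_def)
    then show False
      using xs(3)[of "u - 2" "v - 2"] uv u \<open>\<not> v < u\<close> len by auto
  qed
  have "wf_diagram D'"
    unfolding wf_diagram_def
  proof (intro conjI allI impI ballI)
    show "2 \<le> length D'"
      by (simp add: len')
    fix v assume "v < length D'"
    then have v: "v < k + 2"
      by (simp add: len')
    show "distinct (D' ! v)"
      using D(2)[of "g v"] v g_less permutes_inj[OF h]
      by (auto simp: nth distinct_map intro: inj_on_subset)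
    fix u assume "u \<in> set (D' ! v)"
    then have uv: "(g u, g v) \<in> E"
      using arrow[OF v] by simp
    show "v < u" "2 \<le> u" "u < length D'"
      using descend[OF uv] first_type[OF uv] g_less len' by simp_all
  next
    fix u assume u: "2 \<le> u \<and> u < length D'"
    have "{e \<in> E. fst e = g u} = (\<lambda>v. (g u, g v)) ` segments_hit_by D' u"
    proof (rule set_eqI)
      fix e :: "nat \<times> nat"
      have "e \<in> (\<lambda>v. (g u, g v)) ` segments_hit_by D' u \<longleftrightarrow>
          (\<exists>v. e = (g u, g v) \<and> v < k + 2 \<and> (g u, g v) \<in> E)"
        using arrow by (auto simp: segments_hit_by_def len')
      also have "\<dots> \<longleftrightarrow> (\<exists>v. e = (g u, g v) \<and> (g u, g v) \<in> E)"
        using E g_less by blast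
      also have "\<dots> \<longleftrightarrow> e \<in> {e \<in> E. fst e = g u}"
        by (cases e) (auto, metis inv(3))
      finally show "e \<in> {e \<in> E. fst e = g u} \<longleftrightarrow> e \<in> (\<lambda>v. (g u, g v)) ` segments_hit_by D' u"
        by simp
    qed
    moreover have "inj_on (\<lambda>v. (g u, g v)) (segments_hit_by D' u)"
      using permutes_inj[OF g] by (auto simp: inj_on_def)
    moreover have "g u \<in> {2..<k + 2}"
      using u g_less len' by simp
    ultimately show "card (segments_hit_by D' u) = 2"
      using out[of "g u"] by (simp add: card_image)
  qed
  then have "D' \<in> diagrams"
    by (rule diagrams_if_wf_diagram)
  then show thesis
    using that h by (simp add: D'_def)
qed

text \<open>
  Contraction commutes with renumbering, so it maps classes onto classes. A class is recovered from
  its image because contraction is injective, and each class of graphs is reached because it contains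
  a graph in which all arrows descend.
\<close>

theorem contract_bij: "bij_betw ((`) contract) (GC k) (kontsevich_classes k)"
  unfolding bij_betw_def
proof
  show "inj_on ((`) contract) (GC k)"
  proof (rule inj_onI)
    fix G G' assume G: "G \<in> GC k" and G': "G' \<in> GC k" and eq: "contract ` G = contract ` G'"
    obtain D where D: "G = diagram_iso k `` {D}" "D \<in> diagrams" "length D = k + 2"
      using G by (auto simp: GC_def elim!: quotientE)
    obtain D' where D': "G' = diagram_iso k `` {D'}" "D' \<in> diagrams" "length D' = k + 2"
      using G' by (auto simp: GC_def elim!: quotientE)
    have "D' \<in> G'"
      using GC_class_iff[OF G' D'(3)] D'(1) by simp
    then have "contract D' \<in> contract ` G"
      unfolding eq by (rule imageI)
    then obtain h where h: "h permutes {2..<k + 2}" "contract D' = contract (relabel_diagram h D)"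
      unfolding D(1) diagram_iso_class by blast
    have dist: "distinct (C ! v)" if "C \<in> diagrams" "v < length C" for C v
      using wf_diagramD(2)[OF wf_diagram_if_diagrams[OF that(1)] that(2)] .
    have "D' = relabel_diagram h D"
    proof (rule contract_inj[OF _ _ _ _ h(2)])
      show "\<forall>v<k + 2. distinct (D' ! v)"
        using dist[OF D'(2)] D'(3) by simp
      show "\<forall>v<k + 2. distinct (relabel_diagram h D ! v)"
        using dist[OF D(2)] D(3) permutes_less_iff(1)[OF permutes_inv[OF h(1)]] permutes_inj[OF h(1)]
        by (auto simp: relabel_diagram_nth distinct_map intro: inj_on_subset)
    qed (simp_all add: D(3) D'(3))
    then show "G = G'"
      using diagram_iso_class_relabel[OF D(3) h(1)] by (simp add: D(1) D'(1))
  qed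
  show "(`) contract ` GC k = kontsevich_classes k"
  proof
    show "(`) contract ` GC k \<subseteq> kontsevich_classes k"
    proof clarify
      fix G assume "G \<in> GC k"
      then obtain D where D: "G = diagram_iso k `` {D}" "D \<in> diagrams" "length D = k + 2"
        by (auto simp: GC_def elim!: quotientE)
      show "contract ` G \<in> kontsevich_classes k"
        unfolding D(1) contract_class[OF D(3)] kontsevich_classes_def
        by (rule quotientI) (rule contract_acyclic_ordered[OF wf_diagram_if_diagrams[OF D(2)] D(3)])
    qed
    show "kontsevich_classes k \<subseteq> (`) contract ` GC k"
    proof
      fix C assume "C \<in> kontsevich_classes k"
      then obtain X where X: "C = graph_iso k `` {X}" "X \<in> acyclic_ordered_graphs k"
        unfolding kontsevich_classes_def by (rule quotientE)
      obtain D where D: "length D = k + 2" "contract D = X" "\<And>v. v < k + 2 \<Longrightarrow> distinct (D ! v)"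
        using contract_surj_lists[OF X(2)] by blast
      obtain h where h: "h permutes {2..<k + 2}" "relabel_diagram h D \<in> diagrams"
        using renumbered_diagram[OF D(1,3)] X(2) D(2) by blast
      have "diagram_iso k `` {D} \<in> GC k"
        unfolding GC_def diagram_iso_class_relabel[OF D(1) h(1), symmetric]
        by (rule quotientI) (simp add: h(2) D(1))
      moreover have "C = contract ` (diagram_iso k `` {D})"
        unfolding X(1) contract_class[OF D(1)] D(2) ..
      ultimately show "C \<in> (`) contract ` GC k"
        by blast
    qed
  qed
qed


section \<open>Deleting the factors which no arrow reaches\<close>

text \<open>
  The two functions delete the factors with positions in \<open>U\<close> from a word and from a picture. The
  remaining factors are renumbered on each segment, because positions in a picture are indices.
\<close>

definition shrink :: "(nat \<times> nat) set \<Rightarrow> 'x tracked \<Rightarrow> 'x tracked" where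
  "shrink U p = map (\<lambda>(x, v, i). (x, v, card {j. j < i \<and> (v, j) \<notin> U})) (filter (\<lambda>(x, e). e \<notin> U) p)"

definition trim :: "(nat \<times> nat) set \<Rightarrow> picture \<Rightarrow> picture" where
  "trim U P = map (\<lambda>v. nths (P ! v) {i. (v, i) \<notin> U}) [0..<length P]"

lemma length_trim [simp]: "length (trim U P) = length P"
  by (simp add: trim_def)

lemma trim_nth: "v < length P \<Longrightarrow> trim U P ! v = nths (P ! v) {i. (v, i) \<notin> U}"
  by (simp add: trim_def)

lemma shrink_append: "shrink U (p @ q) = shrink U p @ shrink U q"
  by (simp add: shrink_def)

lemma shrink_Cons_kept:
  "(v, i) \<notin> U \<Longrightarrow> shrink U ((x, v, i) # p) = (x, v, card {j. j < i \<and> (v, j) \<notin> U}) # shrink U p"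
  by (simp add: shrink_def)

lemma map_fst_shrink: "map fst (shrink U p) = map fst (filter (\<lambda>(x, e). e \<notin> U) p)"
  by (simp add: shrink_def comp_def split_def)

lemma sorted_shrink: "sorted (map fst p) \<Longrightarrow> sorted (map fst (shrink U p))"
  unfolding map_fst_shrink by (rule sorted_filter)

lemma shrink_segment_factors:
  assumes "\<And>i. (n, i) \<notin> U"
  shows "shrink U (segment_factors n M) = segment_factors n M"
proof -
  have "filter (\<lambda>(x, e). e \<notin> U) (segment_factors n M) = segment_factors n M"
    using assms by (auto simp: set_segment_factors intro!: filter_True)
  moreover have "map (\<lambda>(x, v, i). (x, v, card {j. j < i \<and> (v, j) \<notin> U})) (segment_factors n M) = segment_factors n M"
    using assms by (auto simp: set_segment_factors intro!: map_idI)
  ultimately show ?thesis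
    by (simp add: shrink_def)
qed

lemma nths_update:
  assumes "i < length xs" "i \<in> I"
  shows "nths (xs[i := a]) I = (nths xs I)[card {j. j < i \<and> j \<in> I} := a]"
proof -
  have len: "length (nths (take i xs) I) = card {j. j < i \<and> j \<in> I}"
    using assms(1) by (simp add: length_nths)
  have "nths xs I = nths (take i xs @ xs ! i # drop (Suc i) xs) I"
    using id_take_nth_drop[OF assms(1)] by simp
  also have "\<dots> = nths (take i xs) I @ xs ! i # nths (drop (Suc i) xs) {j. Suc (j + i) \<in> I}"
    using assms by (simp add: nths_append nths_Cons)
  finally have "(nths xs I)[card {j. j < i \<and> j \<in> I} := a] =
      nths (take i xs) I @ a # nths (drop (Suc i) xs) {j. Suc (j + i) \<in> I}"
    by (simp add: len[symmetric] list_update_append)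
  also have "\<dots> = nths (xs[i := a]) I"
    using assms by (simp add: upd_conv_take_nth_drop nths_append nths_Cons)
  finally show ?thesis ..
qed

lemma arrows_nths:
  "(\<And>i. i < length xs \<Longrightarrow> i \<notin> I \<Longrightarrow> xs ! i = None) \<Longrightarrow> arrows (nths xs I) = arrows xs"
proof (induction xs rule: rev_induct)
  case (snoc x xs)
  have "xs ! i = None" if "i < length xs" "i \<notin> I" for i
    using snoc.prems[of i] that by (simp add: nth_append)
  then have "arrows (nths xs I) = arrows xs"
    by (rule snoc.IH)
  moreover have "x = None" if "length xs \<notin> I"
    using snoc.prems[of "length xs"] that by simp
  ultimately show ?case
    by (cases x) (auto simp: nths_append)
qed simp

lemma diagram_of_trim:
  assumes "\<And>v i. (v, i) \<in> U \<Longrightarrow> P ! v ! i = None"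
  shows "diagram_of (trim U P) = diagram_of P"
  by (rule nth_equalityI) (use assms in \<open>auto simp: trim_nth intro!: arrows_nths\<close>)

lemma trim_apply_phi:
  assumes U: "\<And>i. (length P, i) \<notin> U" and v: "v < length P" "i < length (P ! v)" "(v, i) \<notin> U"
    and v': "v' < length P" "j < length (P ! v')" "(v', j) \<notin> U" and ne: "v \<noteq> v'"
  shows "trim U (apply_phi (v, i) (v', j) M P) =
    apply_phi (v, card {l. l < i \<and> (v, l) \<notin> U}) (v', card {l. l < j \<and> (v', l) \<notin> U}) M (trim U P)"
    (is "?L = ?R")
proof (rule nth_equalityI)
  show "length ?L = length ?R"
    by simp
  fix u assume "u < length ?L"
  then consider "u < length P" | "u = length P"
    by fastforce
  then show "?L ! u = ?R ! u"
  proof cases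
    case 1
    have "?L ! u = nths (apply_phi (v, i) (v', j) M P ! u) {l. (u, l) \<notin> U}"
      using 1 by (intro trim_nth) simp
    also have "\<dots> = ?R ! u"
    proof -
      have "nths ((P ! v)[i := Some (length P)]) {l. (v, l) \<notin> U} =
          (nths (P ! v) {l. (v, l) \<notin> U})[card {l. l < i \<and> (v, l) \<notin> U} := Some (length P)]"
        using nths_update[OF v(2), of "{l. (v, l) \<notin> U}"] v(3) by simp
      moreover have "nths ((P ! v')[j := Some (length P)]) {l. (v', l) \<notin> U} =
          (nths (P ! v') {l. (v', l) \<notin> U})[card {l. l < j \<and> (v', l) \<notin> U} := Some (length P)]"
        using nths_update[OF v'(2), of "{l. (v', l) \<notin> U}"] v'(3) by simp
      ultimately show ?thesis
        using 1 v(1) v'(1) apply_phi_nth[OF ne, of P u i j M]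
          apply_phi_nth[OF ne, of "trim U P" u "card {l. l < i \<and> (v, l) \<notin> U}" "card {l. l < j \<and> (v', l) \<notin> U}" M]
        by (simp add: trim_nth)
    qed
    finally show ?thesis .
  next
    case 2
    then show ?thesis
      using U by (simp add: trim_nth nth_append nths_all)
  qed
qed

text \<open>
  A factor which is never replaced does not influence the reduction of the others: the rightmost
  descent is the same with and without it, unless it is one of the two factors of the descent, and
  then their exchange changes nothing once the factor is deleted. So the reductions of a word which
  leave the factors in \<open>U\<close> in place correspond to the reductions of the word without them. Here \<open>X\<close>
  is the monomial of the deleted factors.
\<close>

lemma run_sum_delete:
  fixes phi :: "'x::{finite, linorder} \<Rightarrow> 'x \<Rightarrow> 'x multiset \<Rightarrow> 'b::comm_ring_1"
  assumes Q: "length_bound L Q" and Q': "length_bound L Q'"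
    and eq: "\<And>p P. wf_state p P \<Longrightarrow> (\<forall>(v, i)\<in>U. P ! v ! i = None) \<Longrightarrow>
      mset (map fst (filter (\<lambda>(x, e). e \<in> U) p)) = X \<Longrightarrow> Q' p P \<longleftrightarrow> Q (shrink U p) (trim U P)"
    and "wf_state p P" "\<forall>(v, i)\<in>U. v < length P \<and> i < length (P ! v) \<and> P ! v ! i = None"
    and "mset (map fst (filter (\<lambda>(x, e). e \<in> U) p)) = X"
  shows "run_sum phi k (\<lambda>p' P'. (\<forall>(v, i)\<in>U. P' ! v ! i = None) \<and> Q' p' P') p P =
    run_sum phi k Q (shrink U p) (trim U P)"
  using assms(4-6)
proof (induction k p P rule: reduction_induct)
  case (irreducible k p P)
  have "\<forall>(v, i)\<in>U. P ! v ! i = None"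
    using irreducible.prems(2) by blast
  then show ?case
    using eq[OF irreducible.prems(1) _ irreducible.prems(3)] sorted_shrink[OF irreducible.hyps, of U] irreducible.hyps
    by (simp add: run_sum_irreducible)
next
  case (reducible k q b e a e' r P)
  let ?B = "\<lambda>p' P'. (\<forall>(v, i)\<in>U. P' ! v ! i = None) \<and> Q' p' P'"
  let ?p = "q @ (b, e) # (a, e') # r" and ?s = "q @ (a, e') # (b, e) # r"
  have B: "length_bound L ?B"
    using Q' unfolding length_bound_def by blast
  note wf = reducible.prems(1) and U = reducible.prems(2) and X = reducible.prems(3)
  note ab = reducible.hyps
  obtain v i v' j where e: "e = (v, i)" "e' = (v', j)"
    by (metis surj_pair)
  have ne: "v \<noteq> v'"
    using wf_state_descent wf ab(1) unfolding e by blast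
  have v: "v < length P" "i < length (P ! v)" and v': "v' < length P" "j < length (P ! v')"
    using wf unfolding e wf_state_def by auto
  have U': "u < length P" "l < length (P ! u)" "P ! u ! l = None" if "(u, l) \<in> U" for u l
    using U that by blast+
  have swap: "run_sum phi k ?B ?s P = run_sum phi k Q (shrink U ?s) (trim U P)"
    by (rule reducible.IH(1)[OF wf_exchange[OF wf ab(1)] U]) (use X in auto)
  show ?case
  proof (cases "e \<in> U \<or> e' \<in> U")
    case True
    have "run_sum phi k' ?B (q @ segment_factors (length P) M @ r) (apply_phi e e' M P) = 0" for k' M
    proof (rule run_sum_empty)
      fix ts p' P' c
      assume run: "run phi ts (q @ segment_factors (length P) M @ r, apply_phi e e' M P, 1) = Some (p', P', c)"
      have "P' ! v ! i \<noteq> None" "P' ! v' ! j \<noteq> None"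
        using run_arrow_persists[OF run, of v i] run_arrow_persists[OF run, of v' j] v v' ne
        unfolding e by (simp_all add: apply_phi_nth)
      then show "\<not> ?B p' P'"
        using True unfolding e by fastforce
    qed
    then have "run_sum phi k ?B ?p P = run_sum phi k ?B ?s P"
      unfolding run_sum_reducible[OF B ab order_refl] by (simp split: nat.split)
    moreover have "shrink U ?s = shrink U ?p"
      using True unfolding shrink_append by (auto simp: shrink_def)
    ultimately show ?thesis
      using swap by simp
  next
    case False
    define \<rho> where "\<rho> = (\<lambda>(v, i). (v :: nat, card {l. l < i \<and> (v, l) \<notin> U}))"
    have kept: "shrink U ?p = shrink U q @ (b, \<rho> e) # (a, \<rho> e') # shrink U r"
      "shrink U ?s = shrink U q @ (a, \<rho> e') # (b, \<rho> e) # shrink U r"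
      using False unfolding e shrink_append by (simp_all add: shrink_Cons_kept \<rho>_def)
    have ab': "a < b" "sorted (a # map fst (shrink U r))"
      using ab sorted_shrink[of "(a, v', j) # r" U] False unfolding e by (simp_all add: shrink_Cons_kept)
    have new: "(length P, l) \<notin> U" for l
      using U'(1) by blast
    have step: "run_sum phi k' ?B (q @ segment_factors (length P) M @ r) (apply_phi e e' M P) =
        run_sum phi k' Q (shrink U q @ segment_factors (length (trim U P)) M @ shrink U r)
          (apply_phi (\<rho> e) (\<rho> e') M (trim U P))" if k: "k = Suc k'" for k' M
    proof -
      have trim: "trim U (apply_phi e e' M P) = apply_phi (\<rho> e) (\<rho> e') M (trim U P)"
        using trim_apply_phi[OF new v _ v' _ ne, of M] False unfolding e \<rho>_def by simp
      have shrink: "shrink U (q @ segment_factors (length P) M @ r) =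
          shrink U q @ segment_factors (length (trim U P)) M @ shrink U r"
        by (simp add: shrink_append shrink_segment_factors new)
      have "run_sum phi k' ?B (q @ segment_factors (length P) M @ r) (apply_phi e e' M P) =
        run_sum phi k' Q (shrink U (q @ segment_factors (length P) M @ r)) (trim U (apply_phi e e' M P))"
      proof (rule reducible.IH(2)[OF k wf_phi[OF wf ab(1)]])
        have "u < Suc (length P) \<and> l < length (apply_phi e e' M P ! u) \<and> apply_phi e e' M P ! u ! l = None"
          if "(u, l) \<in> U" for u l
        proof -
          have not_hit: "(u, l) \<noteq> (v, i)" "(u, l) \<noteq> (v', j)"
            using False that unfolding e by auto
          have "apply_phi e e' M P ! u ! l = P ! u ! l" "length (apply_phi e e' M P ! u) = length (P ! u)"
            using U'(1)[OF that] not_hit v(1) v'(1) ne unfolding e by (auto simp: apply_phi_nth)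
          then show ?thesis
            using U'[OF that] by simp
        qed
        then show "\<forall>(u, l)\<in>U. u < length (apply_phi e e' M P) \<and> l < length (apply_phi e e' M P ! u) \<and>
            apply_phi e e' M P ! u ! l = None"
          by auto
        have "filter (\<lambda>(x, e). e \<in> U) (segment_factors (length P) M) = []"
          using new by (auto simp: filter_empty_conv set_segment_factors)
        then show "mset (map fst (filter (\<lambda>(x, e). e \<in> U) (q @ segment_factors (length P) M @ r))) = X"
          using X False by simp
      qed
      then show ?thesis
        unfolding trim shrink .
    qed
    show ?thesis
      unfolding run_sum_reducible[OF B ab order_refl] kept(1) run_sum_reducible[OF Q ab' order_refl]
      using swap step unfolding kept(2) by (simp split: nat.split)
  qed
qed


section \<open>The operators of the graphs\<close>

definition multiset_choose :: "'x::finite multiset \<Rightarrow> 'x multiset \<Rightarrow> nat" where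
  "multiset_choose \<alpha> \<gamma> = (\<Prod>x\<in>UNIV. count \<alpha> x choose count \<gamma> x)"

lemma multiset_choose_empty: "multiset_choose {#} \<gamma> = of_bool (\<gamma> = {#})"
proof (cases "\<gamma> = {#}")
  case False
  then obtain x where "x \<in># \<gamma>"
    by blast
  then have "count ({#} :: 'a multiset) x choose count \<gamma> x = 0"
    by (simp add: not_in_iff binomial_eq_0)
  then have "multiset_choose {#} \<gamma> = 0"
    unfolding multiset_choose_def by (meson UNIV_I finite prod_zero)
  then show ?thesis
    using False by simp
qed (simp add: multiset_choose_def)

lemma multiset_choose_eq_0:
  assumes "\<not> \<gamma> \<subseteq># \<alpha>"
  shows "multiset_choose \<alpha> \<gamma> = 0"
proof -
  obtain x where "count \<alpha> x < count \<gamma> x"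
    using assms by (auto simp: subseteq_mset_def not_le)
  then show ?thesis
    unfolding multiset_choose_def by (intro prod_zero) (auto intro!: bexI[of _ x] binomial_eq_0)
qed

lemma multiset_choose_Pascal:
  "multiset_choose (add_mset x \<alpha>) (add_mset x \<gamma>) = multiset_choose \<alpha> (add_mset x \<gamma>) + multiset_choose \<alpha> \<gamma>"
  unfolding multiset_choose_def by (simp add: prod.remove[of UNIV x] algebra_simps)

lemma multiset_choose_add_notin:
  assumes "x \<notin># \<gamma>"
  shows "multiset_choose (add_mset x \<alpha>) \<gamma> = multiset_choose \<alpha> \<gamma>"
  unfolding multiset_choose_def using assms by (intro prod.cong) (auto simp: not_in_iff)

text \<open>
  The number of ways to choose the positions of the hit factors, with given monomial, on a segment
  is a product of binomial coefficients.
\<close>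

lemma sum_over_hit_sets:
  fixes h :: "'x::finite multiset \<Rightarrow> 'b::comm_ring_1"
  assumes "length xs \<le> L"
  shows "(\<Sum>A\<in>Pow {..<length xs}. h (mset (nths xs A))) =
    (\<Sum>\<gamma>\<in>multisets_upto L. of_nat (multiset_choose (mset xs) \<gamma>) * h \<gamma>)"
  using assms
proof (induction xs arbitrary: h rule: rev_induct)
  case Nil
  have "(\<Sum>\<gamma>\<in>multisets_upto L. of_nat (multiset_choose (mset []) \<gamma>) * h \<gamma>) =
      (\<Sum>\<gamma>\<in>multisets_upto L. if \<gamma> = {#} then h \<gamma> else 0)"
    by (rule sum.cong) (auto simp: multiset_choose_empty)
  then show ?case
    by simp
next
  case (snoc x xs)
  let ?n = "length xs" and ?c = "\<lambda>\<alpha> \<gamma>. of_nat (multiset_choose \<alpha> \<gamma>) :: 'b"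
  let ?M = "multisets_upto L :: 'x multiset set"
  have IH: "(\<Sum>A\<in>Pow {..<?n}. h (mset (nths xs A))) = (\<Sum>\<gamma>\<in>?M. ?c (mset xs) \<gamma> * h \<gamma>)" for h
    using snoc by simp
  have Pow: "Pow {..<length (xs @ [x])} = Pow {..<?n} \<union> insert ?n ` Pow {..<?n}"
    by (simp add: lessThan_Suc Pow_insert)
  have old: "nths (xs @ [x]) A = nths xs A" if "A \<in> Pow {..<?n}" for A
    using that by (auto simp: nths_append)
  have new: "nths (xs @ [x]) (insert ?n A) = nths xs A @ [x]" if "A \<in> Pow {..<?n}" for A
  proof -
    have "nths xs (insert ?n A) = nths xs A"
      unfolding nths_def by (intro arg_cong[of _ _ "map fst"] filter_cong) (auto simp: set_zip)
    then show ?thesis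
      by (simp add: nths_append)
  qed
  have inj: "inj_on (insert ?n) (Pow {..<?n})"
    by (rule inj_on_inverseI[of _ "\<lambda>A. A - {?n}"]) auto
  have "(\<Sum>A\<in>Pow {..<length (xs @ [x])}. h (mset (nths (xs @ [x]) A))) =
      (\<Sum>A\<in>Pow {..<?n}. h (mset (nths (xs @ [x]) A))) +
      (\<Sum>A\<in>insert ?n ` Pow {..<?n}. h (mset (nths (xs @ [x]) A)))"
    unfolding Pow by (rule sum.union_disjoint) auto
  also have "\<dots> = (\<Sum>A\<in>Pow {..<?n}. h (mset (nths xs A))) + (\<Sum>A\<in>Pow {..<?n}. h (add_mset x (mset (nths xs A))))"
    using old new by (simp add: sum.reindex[OF inj])
  also have "\<dots> = (\<Sum>\<gamma>\<in>?M. ?c (mset xs) \<gamma> * h \<gamma>) + (\<Sum>\<gamma>\<in>?M. ?c (mset xs) \<gamma> * h (add_mset x \<gamma>))"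
    unfolding IH IH[of "\<lambda>\<gamma>. h (add_mset x \<gamma>)"] ..
  also have "(\<Sum>\<gamma>\<in>?M. ?c (mset xs) \<gamma> * h (add_mset x \<gamma>)) =
      (\<Sum>\<gamma>\<in>?M. if x \<in># \<gamma> then ?c (mset xs) (\<gamma> - {#x#}) * h \<gamma> else 0)"
  proof -
    \<comment> \<open>A multiset of the maximal size \<open>L\<close> has no extension in the range, but is not contained in \<open>mset xs\<close>.\<close>
    let ?small = "{\<gamma> \<in> ?M. size \<gamma> < L}"
    have "(\<Sum>\<gamma>\<in>?M. ?c (mset xs) \<gamma> * h (add_mset x \<gamma>)) = (\<Sum>\<gamma>\<in>?small. ?c (mset xs) \<gamma> * h (add_mset x \<gamma>))"
    proof (rule sum.mono_neutral_right)
      show "\<forall>\<gamma>\<in>?M - ?small. ?c (mset xs) \<gamma> * h (add_mset x \<gamma>) = 0"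
      proof
        fix \<gamma> assume \<gamma>: "\<gamma> \<in> ?M - ?small"
        then have "\<not> \<gamma> \<subseteq># mset xs"
          using snoc.prems size_mset_mono[of \<gamma> "mset xs"] by auto
        then show "?c (mset xs) \<gamma> * h (add_mset x \<gamma>) = 0"
          by (simp add: multiset_choose_eq_0)
      qed
    qed auto
    also have "\<dots> = (\<Sum>\<gamma>\<in>add_mset x ` ?small. ?c (mset xs) (\<gamma> - {#x#}) * h \<gamma>)"
      by (subst sum.reindex) (auto simp: inj_on_def)
    also have "add_mset x ` ?small = {\<gamma> \<in> ?M. x \<in># \<gamma>}"
    proof
      show "{\<gamma> \<in> ?M. x \<in># \<gamma>} \<subseteq> add_mset x ` ?small"
      proof
        fix \<gamma> assume \<gamma>: "\<gamma> \<in> {\<gamma> \<in> ?M. x \<in># \<gamma>}"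
        then obtain \<gamma>' where "\<gamma> = add_mset x \<gamma>'"
          by (auto dest: multi_member_split)
        then show "\<gamma> \<in> add_mset x ` ?small"
          using \<gamma> by auto
      qed
    qed auto
    also have "(\<Sum>\<gamma>\<in>{\<gamma> \<in> ?M. x \<in># \<gamma>}. ?c (mset xs) (\<gamma> - {#x#}) * h \<gamma>) =
        (\<Sum>\<gamma>\<in>?M. if x \<in># \<gamma> then ?c (mset xs) (\<gamma> - {#x#}) * h \<gamma> else 0)"
      by (rule sum.inter_filter) simp
    finally show ?thesis .
  qed
  also have "(\<Sum>\<gamma>\<in>?M. ?c (mset xs) \<gamma> * h \<gamma>) + \<dots> = (\<Sum>\<gamma>\<in>?M. ?c (mset (xs @ [x])) \<gamma> * h \<gamma>)"
    unfolding sum.distrib[symmetric]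
  proof (rule sum.cong[OF refl])
    fix \<gamma>
    show "?c (mset xs) \<gamma> * h \<gamma> + (if x \<in># \<gamma> then ?c (mset xs) (\<gamma> - {#x#}) * h \<gamma> else 0) =
        ?c (mset (xs @ [x])) \<gamma> * h \<gamma>"
    proof (cases "x \<in># \<gamma>")
      case True
      then obtain \<gamma>' where "\<gamma> = add_mset x \<gamma>'"
        by (auto dest: multi_member_split)
      then show ?thesis
        by (simp add: multiset_choose_Pascal algebra_simps)
    qed (simp add: multiset_choose_add_notin)
  qed
  finally show ?case .
qed

definition multiset_fact :: "'x::finite multiset \<Rightarrow> nat" where
  "multiset_fact \<gamma> = (\<Prod>x\<in>UNIV. fact (count \<gamma> x))"

lemma multiset_fact_choose_add:
  "multiset_fact (add_mset y \<gamma>) * multiset_choose (M + add_mset y \<gamma>) (add_mset y \<gamma>) =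
    multiset_fact \<gamma> * multiset_choose (M + \<gamma>) \<gamma> * Suc (count M y + count \<gamma> y)"
proof -
  define g where "g \<gamma> x = fact (count \<gamma> x) * (count M x + count \<gamma> x choose count \<gamma> x)" for \<gamma> x
  have prod: "multiset_fact \<gamma> * multiset_choose (M + \<gamma>) \<gamma> = g \<gamma> y * prod (g \<gamma>) (UNIV - {y})" for \<gamma>
    by (simp add: multiset_fact_def multiset_choose_def g_def prod.distrib[symmetric] prod.remove[of UNIV y])
  have "fact (Suc c) * (Suc (a + c) choose Suc c) = fact c * (a + c choose c) * Suc (a + c)" for a c :: nat
  proof -
    have "fact (Suc c) * (Suc (a + c) choose Suc c) = fact c * (Suc c * (Suc (a + c) choose Suc c))"
      by (simp only: fact_Suc of_nat_id mult_ac)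
    also have "\<dots> = fact c * (a + c choose c) * Suc (a + c)"
      by (simp only: Suc_times_binomial mult_ac)
    finally show ?thesis .
  qed
  then have "g (add_mset y \<gamma>) y = g \<gamma> y * Suc (count M y + count \<gamma> y)"
    by (simp add: g_def del: binomial_Suc_Suc fact_Suc mult_Suc_right)
  moreover have "prod (g (add_mset y \<gamma>)) (UNIV - {y}) = prod (g \<gamma>) (UNIV - {y})"
    by (rule prod.cong) (simp_all add: g_def)
  ultimately show ?thesis
    unfolding prod by (simp only: mult_ac)
qed

text \<open>
  On monomials, \<open>\<partial>^\<gamma> x^(M + \<gamma>)\<close> is \<open>\<gamma>!\<close> times the number of ways to choose \<open>\<gamma>\<close> in \<open>M + \<gamma>\<close>, times \<open>x^M\<close>.
\<close>

lemma multi_deriv_eq: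
  fixes F :: "'x::{finite, linorder} multiset \<Rightarrow> 'b::comm_ring_1"
  shows "multi_deriv \<gamma> F M = of_nat (multiset_fact \<gamma> * multiset_choose (M + \<gamma>) \<gamma>) * F (M + \<gamma>)"
proof -
  have "fold partial_deriv ys F M =
      of_nat (multiset_fact (mset ys) * multiset_choose (M + mset ys) (mset ys)) * F (M + mset ys)" for ys
  proof (induction ys arbitrary: F)
    case Nil
    then show ?case
      by (simp add: multiset_fact_def multiset_choose_def)
  next
    case (Cons y ys)
    have "fold partial_deriv (y # ys) F M =
        of_nat (multiset_fact (mset ys) * multiset_choose (M + mset ys) (mset ys)) *
        (of_nat (Suc (count M y + count (mset ys) y)) * F (add_mset y (M + mset ys)))"
      by (simp add: Cons.IH partial_deriv_def)
    also have "\<dots> = of_nat (multiset_fact (mset ys) * multiset_choose (M + mset ys) (mset ys) *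
        Suc (count M y + count (mset ys) y)) * F (add_mset y (M + mset ys))"
      unfolding of_nat_mult by (simp only: mult.assoc)
    finally show ?case
      unfolding multiset_fact_choose_add[symmetric] by simp
  qed
  from this[of "sorted_list_of_multiset \<gamma>"] show ?thesis
    by (simp add: multi_deriv_def)
qed

text \<open>
  The conditions on \<open>None\<close> say that every factor of both arguments is hit. The monomial \<open>X\<close> is that
  of the factors deleted beforehand, which reappears in the final monomial.
\<close>

definition full_sum ::
  "('x::linorder \<Rightarrow> 'x \<Rightarrow> 'x multiset \<Rightarrow> 'b::comm_ring_1) \<Rightarrow> diagram set \<Rightarrow> nat \<Rightarrow> 'x multiset \<Rightarrow>
   'x multiset \<Rightarrow> 'x multiset \<Rightarrow> 'x multiset \<Rightarrow> 'b" where
  "full_sum phi G k \<gamma> \<delta> X M = run_sum phi k (\<lambda>p P. diagram_of P \<in> G \<and> mset (map fst p) + X = M \<and>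
     None \<notin> set (P ! 0) \<and> None \<notin> set (P ! 1)) (start_word \<gamma> \<delta>) (start_picture \<gamma> \<delta>)"

definition hit_points :: "nat option list \<Rightarrow> nat set" where
  "hit_points xs = {i. i < length xs \<and> xs ! i \<noteq> None}"

definition untouched :: "nat \<Rightarrow> nat set \<Rightarrow> nat \<Rightarrow> nat set \<Rightarrow> (nat \<times> nat) set" where
  "untouched m A n B = {0} \<times> ({..<m} - A) \<union> {1} \<times> ({..<n} - B)"

lemma nths_beyond: "nths xs ({i. i \<in> A \<or> length xs \<le> i}) = nths xs A"
  unfolding nths_def by (intro arg_cong[of _ _ "map fst"] filter_cong) (auto simp: set_zip)

lemma shrink_segment:
  "shrink U (segment_factors v M) = segment_factors v (mset (nths (sorted_list_of_multiset M) {i. (v, i) \<notin> U}))"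
proof -
  let ?I = "{i. (v, i) \<notin> U}"
  define f where "f xs = map (\<lambda>i. (xs ! i, v, i)) [0..<length xs]" for xs :: "'a list"
  have f_snoc: "f (xs @ [x]) = f xs @ [(x, v, length xs)]" for xs x
    by (simp add: f_def nth_append)
  have f: "shrink U (f xs) = f (nths xs ?I)" for xs
  proof (induction xs rule: rev_induct)
    case (snoc x xs)
    have "{j. j < length xs \<and> (v, j) \<notin> U} = {j. j < length xs \<and> j \<in> ?I}"
      by simp
    then have "shrink U [(x, v, length xs)] = (if length xs \<in> ?I then [(x, v, length (nths xs ?I))] else [])"
      by (simp add: shrink_def length_nths)
    then show ?case
      using snoc.IH by (simp add: f_snoc shrink_append nths_append)
  qed (simp add: shrink_def f_def)
  have f_segment: "segment_factors v (mset xs) = f xs" if "sorted xs" for xs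
    using that by (simp add: segment_factors_def f_def sorted_sort_id)
  show ?thesis
    using f[of "sorted_list_of_multiset M"] f_segment[of "sorted_list_of_multiset M"]
      f_segment[OF sorted_nths, of "sorted_list_of_multiset M" ?I] by simp
qed

lemma nths_replicate: "nths (replicate (length xs) c) I = replicate (length (nths xs I)) c"
  unfolding map_replicate_const[symmetric] by (rule nths_map)

lemma hit_points_iff:
  assumes "A \<subseteq> {..<length xs}"
  shows "hit_points xs = A \<longleftrightarrow> (\<forall>i\<in>{..<length xs} - A. xs ! i = None) \<and>
    None \<notin> set (nths xs {i. i \<in> A \<or> length xs \<le> i})"
proof -
  have "None \<notin> set (nths xs {i. i \<in> A \<or> length xs \<le> i}) \<longleftrightarrow> (\<forall>i<length xs. i \<in> A \<longrightarrow> xs ! i \<noteq> None)"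
    unfolding set_nths by (auto simp: eq_commute[of None])
  moreover have "hit_points xs = A \<longleftrightarrow> (\<forall>i<length xs. i \<in> A \<longleftrightarrow> xs ! i \<noteq> None)"
    unfolding hit_points_def set_eq_iff using assms by blast
  moreover have "(\<forall>i\<in>{..<length xs} - A. xs ! i = None) \<longleftrightarrow> (\<forall>i<length xs. i \<notin> A \<longrightarrow> xs ! i = None)"
    by auto
  ultimately show ?thesis
    by metis
qed

lemma mset_filter_partition:
  "mset (map f (filter P xs)) + mset (map f (filter (\<lambda>x. \<not> P x) xs)) = mset (map f xs)"
  by (induction xs) auto

lemma deleted_content:
  "mset (map fst (filter (\<lambda>(x, e). e \<in> U) p)) + mset (map fst (shrink U p)) = mset (map fst p)"
  using mset_filter_partition[of fst "\<lambda>(x, e). e \<in> U" p] unfolding map_fst_shrink by (simp add: split_def)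

lemma length_bound_content:
  assumes "\<And>p P. Q p P \<Longrightarrow> mset (map fst p) \<subseteq># M"
  shows "length_bound (size M) Q"
  unfolding length_bound_def
proof (intro allI impI)
  fix p P assume "Q p P"
  from size_mset_mono[OF assms[OF this]] show "length p \<le> size M"
    by simp
qed

text \<open>
  The factors outside \<open>A\<close> and \<open>B\<close> are never replaced and can be deleted. What remains depends on the
  monomials \<open>\<gamma>\<close> and \<open>\<delta>\<close> of the hit factors, and no longer on their positions.
\<close>

lemma run_sum_hits:
  fixes phi :: "'x::{finite, linorder} \<Rightarrow> 'x \<Rightarrow> 'x multiset \<Rightarrow> 'b::comm_ring_1"
  assumes A: "A \<subseteq> {..<size \<alpha>}" and B: "B \<subseteq> {..<size \<beta>}"
    and \<gamma>: "\<gamma> = mset (nths (sorted_list_of_multiset \<alpha>) A)" and \<delta>: "\<delta> = mset (nths (sorted_list_of_multiset \<beta>) B)"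
  shows "run_sum phi k (\<lambda>p P. (diagram_of P \<in> G \<and> mset (map fst p) = M) \<and>
      (hit_points (P ! 0), hit_points (P ! 1)) = (A, B)) (start_word \<alpha> \<beta>) (start_picture \<alpha> \<beta>) =
    full_sum phi G k \<gamma> \<delta> ((\<alpha> - \<gamma>) + (\<beta> - \<delta>)) M"
proof -
  define U where "U = untouched (size \<alpha>) A (size \<beta>) B"
  define X where "X = (\<alpha> - \<gamma>) + (\<beta> - \<delta>)"
  let ?p = "start_word \<alpha> \<beta>" and ?P = "start_picture \<alpha> \<beta>"
  let ?N = "\<lambda>P. None \<notin> set (nths (P ! 0) {i. (0, i) \<notin> U}) \<and> None \<notin> set (nths (P ! 1) {i. (1, i) \<notin> U})"
  let ?Q = "\<lambda>p P. diagram_of P \<in> G \<and> mset (map fst p) + X = M \<and> None \<notin> set (P ! 0) \<and> None \<notin> set (P ! 1)"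
  let ?Q' = "\<lambda>p P. diagram_of P \<in> G \<and> mset (map fst p) = M \<and> ?N P"
  have I: "{i. (0, i) \<notin> U} = {i. i \<in> A \<or> size \<alpha> \<le> i}" "{i. (1, i) \<notin> U} = {i. i \<in> B \<or> size \<beta> \<le> i}"
    by (auto simp: U_def untouched_def)
  have nths: "nths (sorted_list_of_multiset \<alpha>) {i. (0, i) \<notin> U} = nths (sorted_list_of_multiset \<alpha>) A"
    "nths (sorted_list_of_multiset \<beta>) {i. (1, i) \<notin> U} = nths (sorted_list_of_multiset \<beta>) B"
    using nths_beyond[of "sorted_list_of_multiset \<alpha>" A] nths_beyond[of "sorted_list_of_multiset \<beta>" B]
    unfolding I by (simp_all add: length_sorted_list_of_multiset)
  have segments: "shrink U (segment_factors 0 \<alpha>) = segment_factors 0 \<gamma>"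
    "shrink U (segment_factors 1 \<beta>) = segment_factors 1 \<delta>"
    unfolding shrink_segment nths \<gamma> \<delta> by simp_all
  have shrink: "shrink U ?p = start_word \<gamma> \<delta>"
    unfolding shrink_append segments ..
  have trim: "trim U ?P = start_picture \<gamma> \<delta>"
  proof (rule nth_equalityI)
    have "nths (replicate (size \<alpha>) None) {i. (0, i) \<notin> U} = replicate (size \<gamma>) None"
      "nths (replicate (size \<beta>) None) {i. (1, i) \<notin> U} = replicate (size \<delta>) None"
      using nths_replicate[of "sorted_list_of_multiset \<alpha>" None "{i. (0, i) \<notin> U}"]
        nths_replicate[of "sorted_list_of_multiset \<beta>" None "{i. (1, i) \<notin> U}"]
      unfolding nths \<gamma> \<delta> by (simp_all add: length_sorted_list_of_multiset)
    moreover fix v assume "v < length (trim U ?P)"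
    then have "v = 0 \<or> v = 1"
      by auto
    ultimately show "trim U ?P ! v = start_picture \<gamma> \<delta> ! v"
      by (auto simp: trim_nth)
  qed simp
  have content: "mset (map fst (filter (\<lambda>(x, e). e \<in> U) ?p)) = X"
  proof -
    have "mset (map fst (filter (\<lambda>(x, e). e \<in> U) (segment_factors 0 \<alpha>))) + \<gamma> = \<alpha>"
      using deleted_content[of U "segment_factors 0 \<alpha>"] unfolding segments by simp
    moreover have "mset (map fst (filter (\<lambda>(x, e). e \<in> U) (segment_factors 1 \<beta>))) + \<delta> = \<beta>"
      using deleted_content[of U "segment_factors 1 \<beta>"] unfolding segments by simp
    ultimately show ?thesis
      unfolding X_def filter_append map_append mset_append by (metis add_diff_cancel_right')
  qed
  have "run_sum phi k (\<lambda>p P. (diagram_of P \<in> G \<and> mset (map fst p) = M) \<and>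
      (hit_points (P ! 0), hit_points (P ! 1)) = (A, B)) ?p ?P =
    run_sum phi k (\<lambda>p P. (\<forall>(v, i)\<in>U. P ! v ! i = None) \<and> ?Q' p P) ?p ?P"
  proof (rule run_sum_cong)
    fix ts p' P' c
    assume run: "run phi ts (?p, ?P, 1) = Some (p', P', c)"
    have len: "length (P' ! 0) = size \<alpha>" "length (P' ! 1) = size \<beta>"
      using run_segment_length[OF run, of 0] run_segment_length[OF run, of 1] by simp_all
    have "(\<forall>(v, i)\<in>U. P' ! v ! i = None) \<longleftrightarrow>
        (\<forall>i\<in>{..<size \<alpha>} - A. P' ! 0 ! i = None) \<and> (\<forall>i\<in>{..<size \<beta>} - B. P' ! 1 ! i = None)"
      unfolding U_def untouched_def by (auto simp: ball_Un)
    then show "(diagram_of P' \<in> G \<and> mset (map fst p') = M) \<and> (hit_points (P' ! 0), hit_points (P' ! 1)) = (A, B) \<longleftrightarrow>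
        (\<forall>(v, i)\<in>U. P' ! v ! i = None) \<and> ?Q' p' P'"
      using hit_points_iff[of A "P' ! 0"] hit_points_iff[of B "P' ! 1"] A B unfolding len I by blast
  qed
  also have "\<dots> = run_sum phi k ?Q (shrink U ?p) (trim U ?P)"
  proof (rule run_sum_delete)
    show "length_bound (size M) ?Q" "length_bound (size M) ?Q'"
      by (rule length_bound_content, auto simp del: mset_map)+
    fix p :: "'x tracked" and P
    assume wf: "wf_state p P" and U: "\<forall>(v, i)\<in>U. P ! v ! i = None"
      and X: "mset (map fst (filter (\<lambda>(x, e). e \<in> U) p)) = X"
    have "2 \<le> length P"
      using wf wf_diagramD(1)[OF wf_diagram_if_diagrams, of "diagram_of P"] by (simp add: wf_state_def)
    then have "0 < length P" "1 < length P"
      by linarith+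
    then have "trim U P ! 0 = nths (P ! 0) {i. (0, i) \<notin> U}" "trim U P ! 1 = nths (P ! 1) {i. (1, i) \<notin> U}"
      by (simp_all only: trim_nth)
    moreover have "diagram_of (trim U P) = diagram_of P"
      using U by (intro diagram_of_trim) blast
    moreover have "mset (map fst p) = mset (map fst (shrink U p)) + X"
      using deleted_content[of U p] unfolding X by (simp add: add.commute)
    ultimately show "?Q' p P \<longleftrightarrow> ?Q (shrink U p) (trim U P)"
      by simp
  next
    show "wf_state ?p ?P"
      by (rule wf_start)
    show "\<forall>(v, i)\<in>U. v < length ?P \<and> i < length (?P ! v) \<and> ?P ! v ! i = None"
      by (auto simp: U_def untouched_def)
    show "mset (map fst (filter (\<lambda>(x, e). e \<in> U) ?p)) = X"
      by (rule content)
  qed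
  also have "\<dots> = full_sum phi G k \<gamma> \<delta> X M"
    unfolding shrink trim full_sum_def ..
  finally show ?thesis
    unfolding X_def .
qed

text \<open>
  The graph determines the number of uses of \<open>phi\<close>, which is the number of its new segments.
\<close>

lemma sum_runs_with_graph:
  fixes phi :: "'x::{finite, linorder} \<Rightarrow> 'x \<Rightarrow> 'x multiset \<Rightarrow> 'b::comm_ring_1"
  assumes G: "G \<in> GC k"
  shows "(\<Sum>(ts, c)\<in>runs_with_graph phi G \<alpha> \<beta> M. c) =
    run_sum phi k (\<lambda>p P. diagram_of P \<in> G \<and> mset (map fst p) = M) (start_word \<alpha> \<beta>) (start_picture \<alpha> \<beta>)"
proof -
  let ?p = "start_word \<alpha> \<beta>" and ?P = "start_picture \<alpha> \<beta>"
  let ?C = "run_choices phi k (\<lambda>p P. diagram_of P \<in> G \<and> mset (map fst p) = M) ?p ?P"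
  have "runs_with_graph phi G \<alpha> \<beta> M = (\<lambda>ts. (ts, run_weight phi ?p ?P ts)) ` ?C"
  proof (rule set_eqI)
    fix y :: "'x multiset option list \<times> 'b"
    obtain ts c where y: "y = (ts, c)"
      by (cases y)
    have uses: "phi_uses ts = k" if "run phi ts (?p, ?P, 1) = Some (p, P, c)" "diagram_of P \<in> G" for p P c
      using run_length[OF that(1)] GC_length[OF G that(2)] by simp
    have "y \<in> runs_with_graph phi G \<alpha> \<beta> M \<longleftrightarrow>
        (\<exists>p P. run phi ts (?p, ?P, 1) = Some (p, P, c) \<and> diagram_of P \<in> G \<and> mset (map fst p) = M)"
      unfolding y runs_with_graph_def run_monomials_def by simp
    also have "\<dots> \<longleftrightarrow> ts \<in> ?C \<and> c = run_weight phi ?p ?P ts"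
      using uses unfolding run_choices_def run_weight_def by fastforce
    also have "\<dots> \<longleftrightarrow> y \<in> (\<lambda>ts. (ts, run_weight phi ?p ?P ts)) ` ?C"
      unfolding y by blast
    finally show "y \<in> runs_with_graph phi G \<alpha> \<beta> M \<longleftrightarrow> y \<in> (\<lambda>ts. (ts, run_weight phi ?p ?P ts)) ` ?C" .
  qed
  then show ?thesis
    unfolding run_sum_def by (simp add: sum.reindex inj_on_def)
qed

lemma length_arrows: "None \<notin> set xs \<Longrightarrow> length (arrows xs) = length xs"
proof (induction xs)
  case (Cons x xs)
  then show ?case
    by (cases x) auto
qed simp

text \<open>A graph with \<open>k\<close> new segments has at most \<open>k\<close> arrows arriving at each of the two old ones.\<close>

lemma full_sum_order:
  assumes "full_sum phi G k \<gamma> \<delta> X M \<noteq> 0"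
  shows "size \<gamma> \<le> k \<and> size \<delta> \<le> k"
proof (rule ccontr)
  assume large: "\<not> (size \<gamma> \<le> k \<and> size \<delta> \<le> k)"
  have "full_sum phi G k \<gamma> \<delta> X M = 0"
    unfolding full_sum_def
  proof (rule run_sum_empty)
    fix ts p P c
    assume k: "phi_uses ts = k" and run: "run phi ts (start_word \<gamma> \<delta>, start_picture \<gamma> \<delta>, 1) = Some (p, P, c)"
    have D: "diagram_of P \<in> diagrams" "length P = k + 2"
      using run_monomials_diagram[OF run] k by simp_all
    have bound: "length (P ! v) \<le> k" if "v < 2" "None \<notin> set (P ! v)" for v
      using wf_diagram_length_segment[OF wf_diagram_if_diagrams[OF D(1)], of v] length_arrows[OF that(2)] that(1) D(2)
      by simp
    have "length (P ! 0) = size \<gamma>" "length (P ! 1) = size \<delta>"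
      using run_segment_length[OF run, of 0] run_segment_length[OF run, of 1] by simp_all
    then show "\<not> (diagram_of P \<in> G \<and> mset (map fst p) + X = M \<and> None \<notin> set (P ! 0) \<and> None \<notin> set (P ! 1))"
      using bound[of 0] bound[of 1] large by auto
  qed
  then show False
    using assms by simp
qed

lemma full_sum_degree:
  assumes "full_sum phi G k \<gamma> \<delta> X M \<noteq> 0"
  shows "size X \<le> size M"
proof (rule ccontr)
  assume "\<not> size X \<le> size M"
  then have "N + X \<noteq> M" for N
    by auto
  then have "full_sum phi G k \<gamma> \<delta> X M = 0"
    unfolding full_sum_def by (intro run_sum_empty) blast
  then show False
    using assms by simp
qed

lemma full_sum_expand:
  fixes phi :: "'x::{finite, linorder} \<Rightarrow> 'x \<Rightarrow> 'x multiset \<Rightarrow> 'b::comm_ring_1"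
  shows "full_sum phi G k \<gamma> \<delta> X M =
    (\<Sum>N\<in>multisets_upto (size M). of_bool (N + X = M) * full_sum phi G k \<gamma> \<delta> {#} N)"
proof -
  let ?Q = "\<lambda>p P. diagram_of P \<in> G \<and> mset (map fst p) + X = M \<and> None \<notin> set (P ! 0) \<and> None \<notin> set (P ! 1)"
  let ?p = "start_word \<gamma> \<delta>" and ?P = "start_picture \<gamma> \<delta>"
  have "length_bound (size M) ?Q"
    by (rule length_bound_content) (auto simp del: mset_map)
  then have "full_sum phi G k \<gamma> \<delta> X M =
      (\<Sum>N\<in>multisets_upto (size M). run_sum phi k (\<lambda>p P. ?Q p P \<and> mset (map fst p) = N) ?p ?P)"
    unfolding full_sum_def
  proof (rule run_sum_partition)
    fix p :: "'x tracked" and P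
    assume "?Q p P"
    then have "M = mset (map fst p) + X"
      by blast
    then show "mset (map fst p) \<in> multisets_upto (size M)"
      by simp
  qed simp
  also have "\<dots> = (\<Sum>N\<in>multisets_upto (size M). of_bool (N + X = M) * full_sum phi G k \<gamma> \<delta> {#} N)"
  proof (rule sum.cong[OF refl])
    fix N
    show "run_sum phi k (\<lambda>p P. ?Q p P \<and> mset (map fst p) = N) ?p ?P = of_bool (N + X = M) * full_sum phi G k \<gamma> \<delta> {#} N"
    proof (cases "N + X = M")
      case True
      then show ?thesis
        unfolding full_sum_def by (simp del: mset_map, intro run_sum_cong) auto
    next
      case False
      then show ?thesis
        by (simp del: mset_map, intro run_sum_empty) auto
    qed
  qed
  finally show ?thesis .
qed

lemma sum_over_hit_sets_upto:
  fixes h :: "'x::{finite, linorder} multiset \<Rightarrow> 'b::comm_ring_1"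
  assumes h: "\<And>\<gamma>. h \<gamma> \<noteq> 0 \<Longrightarrow> size \<gamma> \<le> k"
  shows "(\<Sum>A\<in>Pow {..<size \<alpha>}. h (mset (nths (sorted_list_of_multiset \<alpha>) A))) =
    (\<Sum>\<gamma>\<in>multisets_upto k. of_nat (multiset_choose \<alpha> \<gamma>) * h \<gamma>)"
proof -
  let ?f = "\<lambda>\<gamma>. of_nat (multiset_choose \<alpha> \<gamma>) * h \<gamma>"
  have choose: "multiset_choose \<alpha> \<gamma> = 0" if "\<not> size \<gamma> \<le> size \<alpha>" for \<gamma>
    using that size_mset_mono[of \<gamma> \<alpha>] by (intro multiset_choose_eq_0) blast
  have h0: "h \<gamma> = 0" if "\<not> size \<gamma> \<le> k" for \<gamma>
    using h that by blast
  have "(\<Sum>A\<in>Pow {..<size \<alpha>}. h (mset (nths (sorted_list_of_multiset \<alpha>) A))) = sum ?f (multisets_upto (size \<alpha>))"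
    using sum_over_hit_sets[of "sorted_list_of_multiset \<alpha>" "size \<alpha>" h] by (simp add: length_sorted_list_of_multiset)
  also have "\<dots> = sum ?f (multisets_upto (max (size \<alpha>) k))"
    by (rule sum.mono_neutral_left) (auto simp: choose)
  also have "\<dots> = sum ?f (multisets_upto k)"
    by (rule sum.mono_neutral_right) (auto simp: h0)
  finally show ?thesis .
qed

text \<open>
  The terms with graph in \<open>G\<close> for monomial arguments: \<open>\<gamma>\<close> and \<open>\<delta>\<close> are the monomials of the factors
  which are hit. Apart from reappearing in the final monomial, the other factors matter only through the
  number of positions of the hit ones; this is what makes it a differential operator.
\<close>

lemma sum_runs_with_graph_expand:
  fixes phi :: "'x::{finite, linorder} \<Rightarrow> 'x \<Rightarrow> 'x multiset \<Rightarrow> 'b::comm_ring_1"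
  assumes G: "G \<in> GC k"
  shows "(\<Sum>(ts, c)\<in>runs_with_graph phi G \<alpha> \<beta> M. c) =
    (\<Sum>\<gamma>\<in>multisets_upto k. \<Sum>\<delta>\<in>multisets_upto k. of_nat (multiset_choose \<alpha> \<gamma>) *
      (of_nat (multiset_choose \<beta> \<delta>) * full_sum phi G k \<gamma> \<delta> ((\<alpha> - \<gamma>) + (\<beta> - \<delta>)) M))"
proof -
  let ?Q = "\<lambda>p P. diagram_of P \<in> G \<and> mset (map fst p) = M"
  let ?p = "start_word \<alpha> \<beta>" and ?P = "start_picture \<alpha> \<beta>"
  let ?A = "Pow {..<size \<alpha>}" and ?B = "Pow {..<size \<beta>}"
  let ?T = "\<lambda>\<gamma> \<delta>. full_sum phi G k \<gamma> \<delta> ((\<alpha> - \<gamma>) + (\<beta> - \<delta>)) M"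
  let ?\<gamma> = "\<lambda>A. mset (nths (sorted_list_of_multiset \<alpha>) A)" and ?\<delta> = "\<lambda>B. mset (nths (sorted_list_of_multiset \<beta>) B)"
  have bound: "length_bound (size M) ?Q"
    by (rule length_bound_content) (auto simp del: mset_map)
  have "run_sum phi k ?Q ?p ?P =
      (\<Sum>j\<in>?A \<times> ?B. run_sum phi k (\<lambda>p P. ?Q p P \<and> (hit_points (P ! 0), hit_points (P ! 1)) = j) ?p ?P)"
  proof (rule run_sum_partition[OF bound])
    fix ts p' P' c
    assume run: "run phi ts (?p, ?P, 1) = Some (p', P', c)"
    have "length (P' ! 0) = size \<alpha>" "length (P' ! 1) = size \<beta>"
      using run_segment_length[OF run, of 0] run_segment_length[OF run, of 1] by simp_all
    then show "(hit_points (P' ! 0), hit_points (P' ! 1)) \<in> ?A \<times> ?B"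
      by (auto simp: hit_points_def)
  qed simp
  also have "\<dots> = (\<Sum>(A, B)\<in>?A \<times> ?B. ?T (?\<gamma> A) (?\<delta> B))"
    by (rule sum.cong[OF refl]) (auto simp only: mem_Times_iff Pow_iff split_paired_all fst_conv snd_conv prod.case
      intro!: run_sum_hits)
  also have "\<dots> = (\<Sum>A\<in>?A. \<Sum>B\<in>?B. ?T (?\<gamma> A) (?\<delta> B))"
    by (simp add: sum.cartesian_product)
  also have "\<dots> = (\<Sum>A\<in>?A. \<Sum>\<delta>\<in>multisets_upto k. of_nat (multiset_choose \<beta> \<delta>) * ?T (?\<gamma> A) \<delta>)"
    by (intro sum.cong refl sum_over_hit_sets_upto) (blast dest: full_sum_order)
  also have "\<dots> = (\<Sum>\<gamma>\<in>multisets_upto k. of_nat (multiset_choose \<alpha> \<gamma>) *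
      (\<Sum>\<delta>\<in>multisets_upto k. of_nat (multiset_choose \<beta> \<delta>) * ?T \<gamma> \<delta>))"
  proof (rule sum_over_hit_sets_upto)
    fix \<gamma> assume "(\<Sum>\<delta>\<in>multisets_upto k. of_nat (multiset_choose \<beta> \<delta>) * ?T \<gamma> \<delta>) \<noteq> 0"
    then obtain \<delta> where "of_nat (multiset_choose \<beta> \<delta>) * ?T \<gamma> \<delta> \<noteq> 0"
      by (rule sum.not_neutral_contains_not_neutral)
    then have "?T \<gamma> \<delta> \<noteq> 0"
      by auto
    then show "size \<gamma> \<le> k"
      by (blast dest: full_sum_order)
  qed
  finally show ?thesis
    unfolding sum_runs_with_graph[OF G] by (simp add: sum_distrib_left)
qed

lemma ctimes_eq_sum:
  fixes F H :: "'x::finite multiset \<Rightarrow> 'b::comm_ring_1"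
  assumes "size M \<le> R"
  shows "ctimes F H M = (\<Sum>M1\<in>multisets_upto R. \<Sum>M2\<in>multisets_upto R. of_bool (M1 + M2 = M) * (F M1 * H M2))"
proof -
  let ?V = "multisets_upto R :: 'x multiset set"
  have "(\<Sum>M1\<in>?V. \<Sum>M2\<in>?V. of_bool (M1 + M2 = M) * (F M1 * H M2)) =
      (\<Sum>(M1, M2)\<in>?V \<times> ?V. of_bool (M1 + M2 = M) * (F M1 * H M2))"
    by (rule sum.cartesian_product)
  also have "\<dots> = (\<Sum>(M1, M2) | M1 + M2 = M. of_bool (M1 + M2 = M) * (F M1 * H M2))"
    by (rule sum.mono_neutral_right) (use assms in \<open>auto simp: of_bool_def split: if_splits\<close>)
  also have "\<dots> = ctimes F H M"
    unfolding ctimes_def by (rule sum.cong) auto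
  finally show ?thesis ..
qed

lemma ctimes_ctimes:
  fixes c F H :: "'x::finite multiset \<Rightarrow> 'b::comm_ring_1"
  defines "V \<equiv> \<lambda>M :: 'x multiset. multisets_upto (size M) :: 'x multiset set"
  shows "ctimes c (ctimes F H) M =
    (\<Sum>M1\<in>V M. \<Sum>M2\<in>V M. (\<Sum>N\<in>V M. of_bool (N + (M1 + M2) = M) * c N) * (F M1 * H M2))"
proof -
  let ?V = "multisets_upto (size M) :: 'x multiset set"
  have collapse: "(\<Sum>K\<in>?V. of_bool (N + K = M) * of_bool (M1 + M2 = K)) = (of_bool (N + (M1 + M2) = M) :: 'b)" for N M1 M2
  proof -
    have "(\<Sum>K\<in>?V. of_bool (N + K = M) * of_bool (M1 + M2 = K)) =
        (\<Sum>K\<in>?V. if K = M1 + M2 then of_bool (N + (M1 + M2) = M) else 0 :: 'b)"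
      by (rule sum.cong) auto
    also have "\<dots> = (if M1 + M2 \<in> ?V then of_bool (N + (M1 + M2) = M) else 0)"
      by (rule sum.delta) simp
    also have "\<dots> = of_bool (N + (M1 + M2) = M)"
      by auto
    finally show ?thesis .
  qed
  have "ctimes c (ctimes F H) M = (\<Sum>N\<in>?V. \<Sum>K\<in>?V. of_bool (N + K = M) * (c N *
      (\<Sum>M1\<in>?V. \<Sum>M2\<in>?V. of_bool (M1 + M2 = K) * (F M1 * H M2))))"
    unfolding ctimes_eq_sum[OF order_refl, of c] by (intro sum.cong refl) (simp add: ctimes_eq_sum)
  also have "\<dots> = (\<Sum>N\<in>?V. \<Sum>K\<in>?V. \<Sum>M1\<in>?V. \<Sum>M2\<in>?V.
      of_bool (N + K = M) * of_bool (M1 + M2 = K) * (c N * (F M1 * H M2)))"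
    unfolding sum_distrib_left by (intro sum.cong refl) (simp only: mult_ac)
  also have "\<dots> = (\<Sum>N\<in>?V. \<Sum>M1\<in>?V. \<Sum>M2\<in>?V. \<Sum>K\<in>?V.
      of_bool (N + K = M) * of_bool (M1 + M2 = K) * (c N * (F M1 * H M2)))"
  proof (rule sum.cong[OF refl])
    fix N
    let ?t = "\<lambda>K M1 M2. of_bool (N + K = M) * of_bool (M1 + M2 = K) * (c N * (F M1 * H M2))"
    have "(\<Sum>K\<in>?V. \<Sum>M1\<in>?V. \<Sum>M2\<in>?V. ?t K M1 M2) = (\<Sum>M1\<in>?V. \<Sum>K\<in>?V. \<Sum>M2\<in>?V. ?t K M1 M2)"
      by (rule sum.swap)
    also have "\<dots> = (\<Sum>M1\<in>?V. \<Sum>M2\<in>?V. \<Sum>K\<in>?V. ?t K M1 M2)"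
      by (rule sum.cong[OF refl]) (rule sum.swap)
    finally show "(\<Sum>K\<in>?V. \<Sum>M1\<in>?V. \<Sum>M2\<in>?V. ?t K M1 M2) = (\<Sum>M1\<in>?V. \<Sum>M2\<in>?V. \<Sum>K\<in>?V. ?t K M1 M2)" .
  qed
  also have "\<dots> = (\<Sum>N\<in>?V. \<Sum>M1\<in>?V. \<Sum>M2\<in>?V. of_bool (N + (M1 + M2) = M) * (c N * (F M1 * H M2)))"
    unfolding sum_distrib_right[symmetric] collapse ..
  also have "\<dots> = (\<Sum>M1\<in>?V. \<Sum>N\<in>?V. \<Sum>M2\<in>?V. of_bool (N + (M1 + M2) = M) * (c N * (F M1 * H M2)))"
    by (rule sum.swap)
  also have "\<dots> = (\<Sum>M1\<in>?V. \<Sum>M2\<in>?V. \<Sum>N\<in>?V. of_bool (N + (M1 + M2) = M) * (c N * (F M1 * H M2)))"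
    by (rule sum.cong[OF refl]) (rule sum.swap)
  also have "\<dots> = (\<Sum>M1\<in>?V. \<Sum>M2\<in>?V. (\<Sum>N\<in>?V. of_bool (N + (M1 + M2) = M) * c N) * (F M1 * H M2))"
    unfolding sum_distrib_right by (simp only: mult.assoc)
  finally show ?thesis
    unfolding V_def .
qed

text \<open>
  This is the substitution \<open>\<alpha> = N + \<gamma>\<close> in a sum over the monomials \<open>x^\<alpha>\<close> of \<open>f\<close>; the binomial
  coefficient vanishes unless \<open>\<gamma>\<close> divides \<open>\<alpha>\<close>.
\<close>

lemma sum_over_monomials:
  fixes \<iota> :: "'k::field \<Rightarrow> 'b::comm_ring_1" and \<Phi> :: "'x::finite multiset \<Rightarrow> 'b"
  assumes \<iota>: "algebra_map \<iota>" and \<Phi>: "\<And>N. \<Phi> N \<noteq> 0 \<Longrightarrow> size N \<le> R"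
  shows "(\<Sum>\<alpha>\<in>Poly_Mapping.keys f. \<iota> (Poly_Mapping.lookup f \<alpha>) * (of_nat (multiset_choose \<alpha> \<gamma>) * \<Phi> (\<alpha> - \<gamma>))) =
    (\<Sum>N\<in>multisets_upto R. scalar_ext \<iota> f (N + \<gamma>) * (of_nat (multiset_choose (N + \<gamma>) \<gamma>) * \<Phi> N))"
proof -
  let ?t = "\<lambda>\<alpha>. \<iota> (Poly_Mapping.lookup f \<alpha>) * (of_nat (multiset_choose \<alpha> \<gamma>) * \<Phi> (\<alpha> - \<gamma>))"
  let ?V = "multisets_upto R :: 'x multiset set"
  have "?t \<alpha> = 0" if "\<alpha> \<notin> (\<lambda>N. N + \<gamma>) ` ?V" for \<alpha>
  proof (cases "\<gamma> \<subseteq># \<alpha>")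
    case True
    then have "\<alpha> - \<gamma> \<notin> ?V"
      using that by (metis imageI subset_mset.diff_add)
    then have "\<Phi> (\<alpha> - \<gamma>) = 0"
      using \<Phi>[of "\<alpha> - \<gamma>"] by auto
    then show ?thesis
      by simp
  next
    case False
    then show ?thesis
      by (simp add: multiset_choose_eq_0)
  qed
  then have "sum ?t (Poly_Mapping.keys f) = sum ?t ((\<lambda>N. N + \<gamma>) ` ?V)"
    by (intro sum.mono_neutral_cong) (auto simp: in_keys_iff algebra_map_zero[OF \<iota>])
  also have "\<dots> = (\<Sum>N\<in>?V. ?t (N + \<gamma>))"
    by (subst sum.reindex) (simp_all add: inj_on_def)
  finally show ?thesis
    by (simp add: scalar_ext_def)
qed

lemma algebra_map_of_nat:
  assumes "algebra_map \<iota>"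
  shows "\<iota> (of_nat n) = of_nat n"
  using assms algebra_map_zero[OF assms] by (induction n) (simp_all add: algebra_map_def)

lemma full_sum_ctensor:
  fixes phi :: "'x::{finite, linorder} \<Rightarrow> 'x \<Rightarrow> 'x multiset \<Rightarrow> 'b::comm_ring_1"
  assumes "is_ideal m" "cochain m phi"
  shows "full_sum phi G k \<gamma> \<delta> {#} \<in> ctensor m k"
proof -
  have "(\<lambda>i. run_sum phi k (\<lambda>p P. mset (map fst p) = i \<and>
      diagram_of P \<in> G \<and> None \<notin> set (P ! 0) \<and> None \<notin> set (P ! 1)) (start_word \<gamma> \<delta>) (start_picture \<gamma> \<delta>)) \<in> ctensor m k"
    by (rule run_sum_ctensor[OF assms, of size]) simp
  moreover have "full_sum phi G k \<gamma> \<delta> {#} = (\<lambda>i. run_sum phi k (\<lambda>p P. mset (map fst p) = i \<and>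
      diagram_of P \<in> G \<and> None \<notin> set (P ! 0) \<and> None \<notin> set (P ! 1)) (start_word \<gamma> \<delta>) (start_picture \<gamma> \<delta>))"
    unfolding full_sum_def by (intro ext run_sum_cong) auto
  ultimately show ?thesis
    by simp
qed

text \<open>
  The coefficient of \<open>\<partial>^\<gamma> \<otimes> \<partial>^\<delta>\<close> is the sum of the terms for \<open>x^\<gamma>\<close> and \<open>x^\<delta>\<close> in which every factor is hit,
  divided by \<open>\<gamma>! \<delta>!\<close>. It vanishes if \<open>\<gamma>\<close> or \<open>\<delta>\<close> has degree above \<open>k\<close>, so that the operator
  has finite order.
\<close>

theorem graph_op_bidifferential:
  fixes \<iota> :: "'k::field_char_0 \<Rightarrow> 'b::comm_ring_1"
    and phi :: "'x::{finite, linorder} \<Rightarrow> 'x \<Rightarrow> 'x multiset \<Rightarrow> 'b"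
  assumes \<iota>: "algebra_map \<iota>" and m: "is_ideal m" and phi: "cochain m phi" and G: "G \<in> GC k"
  shows "bidifferential \<iota> m k (graph_op \<iota> phi G)"
proof -
  \<comment> \<open>This is the only use of characteristic \<open>0\<close>: the factorials are invertible.\<close>
  define s where "s \<gamma> \<delta> = \<iota> (inverse (of_nat (multiset_fact \<gamma> * multiset_fact \<delta>)))" for \<gamma> \<delta> :: "'x multiset"
  define c where "c \<gamma> \<delta> N = s \<gamma> \<delta> * full_sum phi G k \<gamma> \<delta> {#} N" for \<gamma> \<delta> N
  let ?V = "multisets_upto k :: 'x multiset set"
  have s: "s \<gamma> \<delta> * (of_nat (multiset_fact \<gamma>) * of_nat (multiset_fact \<delta>)) = 1" for \<gamma> \<delta>
  proof -
    have "multiset_fact \<gamma> * multiset_fact \<delta> \<noteq> 0"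
      by (simp add: multiset_fact_def)
    then have "inverse (of_nat (multiset_fact \<gamma> * multiset_fact \<delta>)) * of_nat (multiset_fact \<gamma> * multiset_fact \<delta>) = (1 :: 'k)"
      by (intro left_inverse) (simp only: of_nat_eq_0_iff not_False_eq_True)
    then have "s \<gamma> \<delta> * \<iota> (of_nat (multiset_fact \<gamma> * multiset_fact \<delta>)) = 1"
      using \<iota> unfolding s_def algebra_map_def by metis
    then have "s \<gamma> \<delta> * of_nat (multiset_fact \<gamma> * multiset_fact \<delta>) = 1"
      unfolding algebra_map_of_nat[OF \<iota>] .
    then show ?thesis
      by (simp only: of_nat_mult)
  qed
  have c_zero: "c \<gamma> \<delta> = (\<lambda>N. 0)" if "(\<gamma>, \<delta>) \<notin> ?V \<times> ?V" for \<gamma> \<delta>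
    using that full_sum_order[of phi G k \<gamma> \<delta> "{#}"] unfolding c_def by (intro ext) fastforce
  have "graph_op \<iota> phi G f g M = (\<Sum>(\<gamma>, \<delta>).
      ctimes (c \<gamma> \<delta>) (ctimes (multi_deriv \<gamma> (scalar_ext \<iota> f)) (multi_deriv \<delta> (scalar_ext \<iota> g))) M)" for f g M
  proof -
    let ?f = "Poly_Mapping.lookup f" and ?g = "Poly_Mapping.lookup g" and ?A = "Poly_Mapping.keys f" and ?B = "Poly_Mapping.keys g"
    let ?F = "scalar_ext \<iota> f" and ?G = "scalar_ext \<iota> g" and ?W = "multisets_upto (size M) :: 'x multiset set"
    let ?T = "\<lambda>\<gamma> \<delta> X. full_sum phi G k \<gamma> \<delta> X M"
    let ?b = "\<lambda>\<alpha> \<gamma>. of_nat (multiset_choose \<alpha> \<gamma>) :: 'b"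
    have size: "size N \<le> size M \<and> size N' \<le> size M" if "?T \<gamma> \<delta> (N + N') \<noteq> 0" for \<gamma> \<delta> N N'
      using full_sum_degree[OF that] by simp
    have term_eq: "ctimes (c \<gamma> \<delta>) (ctimes (multi_deriv \<gamma> ?F) (multi_deriv \<delta> ?G)) M =
        (\<Sum>M1\<in>?W. ?F (M1 + \<gamma>) * (?b (M1 + \<gamma>) \<gamma> * (\<Sum>M2\<in>?W. ?G (M2 + \<delta>) * (?b (M2 + \<delta>) \<delta> * ?T \<gamma> \<delta> (M1 + M2)))))" for \<gamma> \<delta>
    proof -
      have "(\<Sum>N\<in>?W. of_bool (N + X = M) * c \<gamma> \<delta> N) = s \<gamma> \<delta> * ?T \<gamma> \<delta> X" for X
        unfolding full_sum_expand[of phi G k \<gamma> \<delta> X M] sum_distrib_left c_def by (simp only: mult.left_commute)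
      then have "ctimes (c \<gamma> \<delta>) (ctimes (multi_deriv \<gamma> ?F) (multi_deriv \<delta> ?G)) M =
          (\<Sum>M1\<in>?W. \<Sum>M2\<in>?W. (s \<gamma> \<delta> * ?T \<gamma> \<delta> (M1 + M2)) * (multi_deriv \<gamma> ?F M1 * multi_deriv \<delta> ?G M2))"
        unfolding ctimes_ctimes by (simp only:)
      also have "\<dots> = (\<Sum>M1\<in>?W. \<Sum>M2\<in>?W. (s \<gamma> \<delta> * (of_nat (multiset_fact \<gamma>) * of_nat (multiset_fact \<delta>))) *
          (?F (M1 + \<gamma>) * (?b (M1 + \<gamma>) \<gamma> * (?G (M2 + \<delta>) * (?b (M2 + \<delta>) \<delta> * ?T \<gamma> \<delta> (M1 + M2))))))"
        unfolding multi_deriv_eq of_nat_mult by (simp only: mult_ac)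
      also have "\<dots> = (\<Sum>M1\<in>?W. ?F (M1 + \<gamma>) * (?b (M1 + \<gamma>) \<gamma> *
          (\<Sum>M2\<in>?W. ?G (M2 + \<delta>) * (?b (M2 + \<delta>) \<delta> * ?T \<gamma> \<delta> (M1 + M2)))))"
        unfolding s by (simp only: mult_1_left sum_distrib_left)
      finally show ?thesis .
    qed
    have monomials: "(\<Sum>\<alpha>\<in>?A. \<Sum>\<beta>\<in>?B. \<iota> (?f \<alpha> * ?g \<beta>) *
          (?b \<alpha> \<gamma> * (?b \<beta> \<delta> * ?T \<gamma> \<delta> ((\<alpha> - \<gamma>) + (\<beta> - \<delta>))))) =
        (\<Sum>M1\<in>?W. ?F (M1 + \<gamma>) * (?b (M1 + \<gamma>) \<gamma> * (\<Sum>M2\<in>?W. ?G (M2 + \<delta>) * (?b (M2 + \<delta>) \<delta> * ?T \<gamma> \<delta> (M1 + M2)))))" for \<gamma> \<delta>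
    proof -
      let ?\<Phi> = "\<lambda>M1. \<Sum>M2\<in>?W. ?G (M2 + \<delta>) * (?b (M2 + \<delta>) \<delta> * ?T \<gamma> \<delta> (M1 + M2))"
      have "(\<Sum>\<alpha>\<in>?A. \<Sum>\<beta>\<in>?B. \<iota> (?f \<alpha> * ?g \<beta>) *
          (?b \<alpha> \<gamma> * (?b \<beta> \<delta> * ?T \<gamma> \<delta> ((\<alpha> - \<gamma>) + (\<beta> - \<delta>))))) =
        (\<Sum>\<alpha>\<in>?A. \<iota> (?f \<alpha>) * (?b \<alpha> \<gamma> *
          (\<Sum>\<beta>\<in>?B. \<iota> (?g \<beta>) * (?b \<beta> \<delta> * ?T \<gamma> \<delta> ((\<alpha> - \<gamma>) + (\<beta> - \<delta>))))))"
        using \<iota> unfolding algebra_map_def by (simp only: sum_distrib_left mult_ac)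
      also have "\<dots> = (\<Sum>\<alpha>\<in>?A. \<iota> (?f \<alpha>) * (?b \<alpha> \<gamma> * ?\<Phi> (\<alpha> - \<gamma>)))"
      proof -
        have "(\<Sum>\<beta>\<in>?B. \<iota> (?g \<beta>) * (?b \<beta> \<delta> * ?T \<gamma> \<delta> (N + (\<beta> - \<delta>)))) = ?\<Phi> N" for N
          by (rule sum_over_monomials[OF \<iota>, of "\<lambda>M2. ?T \<gamma> \<delta> (N + M2)"]) (use size in blast)
        then show ?thesis
          by (simp only:)
      qed
      also have "\<dots> = (\<Sum>M1\<in>?W. ?F (M1 + \<gamma>) * (?b (M1 + \<gamma>) \<gamma> * ?\<Phi> M1))"
      proof (rule sum_over_monomials[OF \<iota>, of ?\<Phi>])
        fix M1 assume "?\<Phi> M1 \<noteq> 0"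
        then obtain M2 where "?G (M2 + \<delta>) * (?b (M2 + \<delta>) \<delta> * ?T \<gamma> \<delta> (M1 + M2)) \<noteq> 0"
          by (rule sum.not_neutral_contains_not_neutral)
        then have "?T \<gamma> \<delta> (M1 + M2) \<noteq> 0"
          by auto
        then show "size M1 \<le> size M"
          using size by blast
      qed
      finally show ?thesis .
    qed
    have "graph_op \<iota> phi G f g M = (\<Sum>\<alpha>\<in>?A. \<Sum>\<beta>\<in>?B. \<Sum>\<gamma>\<in>?V. \<Sum>\<delta>\<in>?V.
        \<iota> (?f \<alpha> * ?g \<beta>) * (?b \<alpha> \<gamma> * (?b \<beta> \<delta> * ?T \<gamma> \<delta> ((\<alpha> - \<gamma>) + (\<beta> - \<delta>)))))"
      unfolding graph_op_def sum_runs_with_graph_expand[OF G] by (simp only: sum_distrib_left)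
    also have "\<dots> = (\<Sum>\<gamma>\<in>?V. \<Sum>\<delta>\<in>?V. \<Sum>\<alpha>\<in>?A. \<Sum>\<beta>\<in>?B.
        \<iota> (?f \<alpha> * ?g \<beta>) * (?b \<alpha> \<gamma> * (?b \<beta> \<delta> * ?T \<gamma> \<delta> ((\<alpha> - \<gamma>) + (\<beta> - \<delta>)))))"
      by (simp only: sum.swap[of _ ?V "?B"] sum.swap[of _ ?V "?A"])
    also have "\<dots> = (\<Sum>\<gamma>\<in>?V. \<Sum>\<delta>\<in>?V. ctimes (c \<gamma> \<delta>) (ctimes (multi_deriv \<gamma> ?F) (multi_deriv \<delta> ?G)) M)"
      unfolding monomials term_eq ..
    also have "\<dots> = (\<Sum>(\<gamma>, \<delta>)\<in>?V \<times> ?V. ctimes (c \<gamma> \<delta>) (ctimes (multi_deriv \<gamma> ?F) (multi_deriv \<delta> ?G)) M)"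
      by (rule sum.cartesian_product)
    also have "\<dots> = (\<Sum>(\<gamma>, \<delta>). ctimes (c \<gamma> \<delta>) (ctimes (multi_deriv \<gamma> ?F) (multi_deriv \<delta> ?G)) M)"
    proof (rule Sum_any.expand_superset[symmetric])
      show "{x. (case x of (\<gamma>, \<delta>) \<Rightarrow> ctimes (c \<gamma> \<delta>) (ctimes (multi_deriv \<gamma> ?F) (multi_deriv \<delta> ?G)) M) \<noteq> 0} \<subseteq> ?V \<times> ?V"
      proof
        fix x assume x: "x \<in> {x. (case x of (\<gamma>, \<delta>) \<Rightarrow>
          ctimes (c \<gamma> \<delta>) (ctimes (multi_deriv \<gamma> ?F) (multi_deriv \<delta> ?G)) M) \<noteq> 0}"
        obtain \<gamma> \<delta> where "x = (\<gamma>, \<delta>)"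
          by (cases x)
        then show "x \<in> ?V \<times> ?V"
          using x c_zero[of \<gamma> \<delta>] by (cases "x \<in> ?V \<times> ?V") (simp_all add: ctimes_def)
      qed
    qed simp
    finally show ?thesis .
  qed
  moreover have "c \<gamma> \<delta> \<in> ctensor m k" for \<gamma> \<delta>
    unfolding c_def by (intro ctensor_scale full_sum_ctensor m phi)
  moreover have "finite {(\<gamma>, \<delta>). c \<gamma> \<delta> \<notin> ctensor m n}" for n
  proof (rule finite_subset)
    show "{(\<gamma>, \<delta>). c \<gamma> \<delta> \<notin> ctensor m n} \<subseteq> ?V \<times> ?V"
    proof
      fix x assume x: "x \<in> {(\<gamma>, \<delta>). c \<gamma> \<delta> \<notin> ctensor m n}"
      obtain \<gamma> \<delta> where "x = (\<gamma>, \<delta>)"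
        by (cases x)
      then show "x \<in> ?V \<times> ?V"
        using x c_zero[of \<gamma> \<delta>] by (cases "x \<in> ?V \<times> ?V") simp_all
    qed
  qed simp
  ultimately show ?thesis
    unfolding bidifferential_def by blast
qed

lemma sum_graph_op:
  fixes phi :: "'x::{finite, linorder} \<Rightarrow> 'x \<Rightarrow> 'x multiset \<Rightarrow> 'b::comm_ring_1"
  shows "(\<Sum>G\<in>GC k. graph_op \<iota> phi G f g M) =
    (\<Sum>\<alpha>\<in>Poly_Mapping.keys f. \<Sum>\<beta>\<in>Poly_Mapping.keys g.
      \<iota> (Poly_Mapping.lookup f \<alpha> * Poly_Mapping.lookup g \<beta>) *
      run_sum phi k (\<lambda>p P. mset (map fst p) = M) (start_word \<alpha> \<beta>) (start_picture \<alpha> \<beta>))"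
proof -
  have "(\<Sum>G\<in>GC k. \<Sum>(ts, c)\<in>runs_with_graph phi G \<alpha> \<beta> M. c) =
      run_sum phi k (\<lambda>p P. mset (map fst p) = M) (start_word \<alpha> \<beta>) (start_picture \<alpha> \<beta>)" for \<alpha> \<beta>
  proof -
    let ?p = "start_word \<alpha> \<beta>" and ?P = "start_picture \<alpha> \<beta>"
    have diagram: "diagram_of P' \<in> diagrams \<and> length (diagram_of P') = k + 2"
      if "phi_uses ts = k" "run phi ts (?p, ?P, 1) = Some (p', P', c)" for ts p' P' c
      using run_monomials_diagram[OF that(2)] that(1) by simp
    have "run_sum phi k (\<lambda>p P. mset (map fst p) = M) ?p ?P = (\<Sum>G\<in>GC k.
        run_sum phi k (\<lambda>p P. mset (map fst p) = M \<and> diagram_iso k `` {diagram_of P} = G) ?p ?P)"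
    proof (rule run_sum_partition[OF _ finite_GC])
      show "length_bound (size M) (\<lambda>(p :: 'x tracked) P. mset (map fst p) = M)"
        by (rule length_bound_content) simp
      fix ts p' P' c
      assume "phi_uses ts = k" "run phi ts (?p, ?P, 1) = Some (p', P', c)"
      from diagram[OF this] show "diagram_iso k `` {diagram_of P'} \<in> GC k"
        unfolding GC_def by (intro quotientI) simp
    qed
    also have "\<dots> = (\<Sum>G\<in>GC k. \<Sum>(ts, c)\<in>runs_with_graph phi G \<alpha> \<beta> M. c)"
    proof (rule sum.cong[OF refl])
      fix G assume G: "G \<in> GC k"
      show "run_sum phi k (\<lambda>p P. mset (map fst p) = M \<and> diagram_iso k `` {diagram_of P} = G) ?p ?P =
          (\<Sum>(ts, c)\<in>runs_with_graph phi G \<alpha> \<beta> M. c)"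
        unfolding sum_runs_with_graph[OF G] using GC_class_iff[OF G] diagram by (intro run_sum_cong) blast
    qed
    finally show ?thesis ..
  qed
  then show ?thesis
    unfolding graph_op_def by (simp only: sum.swap[of _ _ "GC k"] sum_distrib_left[symmetric])
qed

theorem theorem1p5:
  fixes \<iota> :: "'k::field_char_0 \<Rightarrow> 'b::comm_ring_1"
    and m :: "'b set"
    and phi :: "'x::{finite, linorder} \<Rightarrow> 'x \<Rightarrow> 'x multiset \<Rightarrow> 'b"
  assumes "algebra_map \<iota>"
    and "complete_local_noetherian m"
    and "cochain m phi"
  shows "(\<forall>f g. has_adic_sum m (\<lambda>k M. \<Sum>G\<in>GC k. graph_op \<iota> phi G f g M) (star \<iota> m phi f g)) \<and>
    (\<forall>k. bij_betw ((`) contract) (GC k) (kontsevich_classes k)) \<and>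
    (\<forall>k. occurring_graphs phi k \<subseteq> GC k) \<and>
    (\<forall>k. \<forall>G\<in>GC k. bidifferential \<iota> m k (graph_op \<iota> phi G))"
proof (intro conjI allI ballI)
  show "has_adic_sum m (\<lambda>k M. \<Sum>G\<in>GC k. graph_op \<iota> phi G f g M) (star \<iota> m phi f g)" for f g
    unfolding sum_graph_op by (rule star_has_adic_sum[OF assms])
  show "bij_betw ((`) contract) (GC k) (kontsevich_classes k)" for k
    by (rule contract_bij)
  show "occurring_graphs phi k \<subseteq> GC k" for k
    by (rule occurring_graphs_subset)
  show "bidifferential \<iota> m k (graph_op \<iota> phi G)" if "G \<in> GC k" for k G
    by (rule graph_op_bidifferential[OF assms(1) maximal_is_ideal[OF assms(2)] assms(3) that])
qed

end
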